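(* Let $T>0$, $a,b>0$, $p>1$ and $\alpha\in(1/p,1]$ be constants, let $f\in C([0,T]\times\mathbb{R},\mathbb{R})$, and set $F(t,x)=\int_0^x f(t,s)\,ds$. Suppose that: (i) there exist a constant $1<r_1<p^2$ and a function $d\in L^1([0,T],\mathbb{R}^+)$ such that $|f(t,x)|\le r_1 d(t)|x|^{r_1-1}$ for all $(t,x)\in[0,T]\times\mathbb{R}$; (ii) there exist a (nonempty) open interval $\mathbb{I}\subset[0,T]$ and three constants $\eta,\delta>0$, $1<r_2<p$ such that $F(t,x)\ge\eta|x|^{r_2}$ for all $(t,x)\in\mathbb{I}\times[-\delta,\delta]$. Then the Kirchhoff-type fractional $p$-Laplacian Dirichlet problem $$\left(a+b\int_0^T|{}_0D_t^\alpha u(t)|^p\,dt\right)^{p-1}{}_tD_T^\alpha\,\phi_p({}_0D_t^\alpha u(t))=f(t,u(t)),\quad t\in(0,T),\qquad u(0)=u(T)=0,$$ possesses at least one nontrivial weak solution, i.e. a weak solution $u\neq 0$.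
   Context: $\phi_p:\mathbb{R}\to\mathbb{R}$ is defined by $\phi_p(s)=|s|^{p-2}s$ for $s\neq 0$ and $\phi_p(0)=0$. Fractional derivatives. For $\gamma>0$ the left and right Riemann-Liouville integrals on $[0,T]$ are ${}_0I_t^\gamma u(t)=\frac1{\Gamma(\gamma)}\int_0^t(t-s)^{\gamma-1}u(s)\,ds$ and ${}_tI_T^\gamma u(t)=\frac1{\Gamma(\gamma)}\int_t^T(s-t)^{\gamma-1}u(s)\,ds$. For $0<\alpha<1$, ${}_0D_t^\alpha u=\frac{d}{dt}\,{}_0I_t^{1-\alpha}u$ and ${}_tD_T^\alpha u=-\frac{d}{dt}\,{}_tI_T^{1-\alpha}u$; for $\alpha=1$, ${}_0D_t^1u=u'$ and ${}_tD_T^1u=-u'$. Function space. $E_0^{\alpha,p}$ is the closure of $C_0^\infty([0,T],\mathbb{R})$ (smooth functions on $[0,T]$ vanishing at $0$ and $T$; using smooth functions compactly supported in $(0,T)$ gives the same space for $1/p<\alpha\le 1$) with respect to the norm $(\|u\|_{L^p}^p+\|{}_0D_t^\alpha u\|_{L^p}^p)^{1/p}$; for $u$ in the closure, ${}_0D_t^\alpha u\in L^p([0,T],\mathbb{R})$ is the $L^p$-limit of the derivatives of an approximating sequence. The space is equipped with the equivalent norm $\|u\|_{E^{\alpha,p}}=\|{}_0D_t^\alpha u\|_{L^p}$. Since $\alpha>1/p$, its elements are continuous functions on $[0,T]$ with $u(0)=u(T)=0$. Weak solutions. A weak solution of the Dirichlet problem is a critical point $u\in E_0^{\alpha,p}$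 of the $C^1$ functional $$I(u)=\frac{1}{bp^2}\left(a+b\|u\|_{E^{\alpha,p}}^p\right)^p-\int_0^TF(t,u(t))\,dt-\frac{a^p}{bp^2},\qquad u\in E_0^{\alpha,p},$$ equivalently $u\in E_0^{\alpha,p}$ such that for all $v\in E_0^{\alpha,p}$ $$(a+b\|u\|_{E^{\alpha,p}}^p)^{p-1}\int_0^T\phi_p({}_0D_t^\alpha u(t))\,{}_0D_t^\alpha v(t)\,dt=\int_0^Tf(t,u(t))v(t)\,dt.$$ *)

theory Defs
  imports "HOL-Analysis.Analysis"
begin

text \<open>
  A function on the interval from \<open>0\<close> to \<open>T\<close> is represented by a function \<open>real \<Rightarrow> real\<close> whose
  values outside the interval are irrelevant.
\<close>

definition RL_left :: "real \<Rightarrow> (real \<Rightarrow> real) \<Rightarrow> real \<Rightarrow> real" where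
  "RL_left \<gamma> u t = 1 / Gamma \<gamma> * (LINT s:{0..t}|lebesgue. (t - s) powr (\<gamma> - 1) * u s)"

text \<open>
  The classical derivative. It is used only for smooth functions and under integrals, so
  its unspecified values at the two endpoints play no role.
\<close>

definition RL_deriv :: "real \<Rightarrow> (real \<Rightarrow> real) \<Rightarrow> real \<Rightarrow> real" where
  "RL_deriv \<alpha> u t = (if \<alpha> = 1 then deriv u t else deriv (RL_left (1 - \<alpha>) u) t)"

definition Lp_fun :: "real \<Rightarrow> real \<Rightarrow> (real \<Rightarrow> real) set" where
  "Lp_fun T p = {u. u \<in> borel_measurable (lebesgue_on {0..T}) \<and>
                    integrable (lebesgue_on {0..T}) (\<lambda>t. \<bar>u t\<bar> powr p)}"

definition Lp_norm :: "real \<Rightarrow> real \<Rightarrow> (real \<Rightarrow> real) \<Rightarrow> real" where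
  "Lp_norm T p u = (LINT t|lebesgue_on {0..T}. \<bar>u t\<bar> powr p) powr (1 / p)"

text \<open>
  \<open>g n\<close> is the \<open>n\<close>-th derivative of \<open>u\<close> on the closed interval, one-sided at the endpoints.
\<close>

definition smooth_Icc :: "real \<Rightarrow> (real \<Rightarrow> real) \<Rightarrow> bool" where
  "smooth_Icc T u \<longleftrightarrow> (\<exists>g :: nat \<Rightarrow> real \<Rightarrow> real.
     (\<forall>t\<in>{0..T}. g 0 t = u t) \<and>
     (\<forall>n. \<forall>t\<in>{0..T}. (g n has_real_derivative g (Suc n) t) (at t within {0..T})))"

definition C0_inf :: "real \<Rightarrow> (real \<Rightarrow> real) set" where
  "C0_inf T = {u. smooth_Icc T u \<and> u 0 = 0 \<and> u T = 0}"

text \<open>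
  The pair \<open>(u, w)\<close> is a limit of pairs \<open>(\<phi>, D \<phi>)\<close> in the norm
  \<open>(\<parallel>u\<parallel>^p + \<parallel>w\<parallel>^p)^(1/p)\<close>, that is, \<open>u\<close> lies in the closure of the smooth functions and \<open>w\<close> is
  its fractional derivative.
\<close>

definition has_frac_deriv ::
  "real \<Rightarrow> real \<Rightarrow> real \<Rightarrow> (real \<Rightarrow> real) \<Rightarrow> (real \<Rightarrow> real) \<Rightarrow> bool" where
  "has_frac_deriv T \<alpha> p u w \<longleftrightarrow> u \<in> Lp_fun T p \<and> w \<in> Lp_fun T p \<and>
     (\<exists>\<phi> :: nat \<Rightarrow> real \<Rightarrow> real. (\<forall>n. \<phi> n \<in> C0_inf T) \<and>
        (\<lambda>n. (Lp_norm T p (\<lambda>t. \<phi> n t - u t) powr p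
              + Lp_norm T p (\<lambda>t. RL_deriv \<alpha> (\<phi> n) t - w t) powr p) powr (1 / p))
          \<longlonglongrightarrow> 0)"

text \<open>
  For \<open>\<alpha> > 1/p\<close> every class in the closure has exactly one continuous representative, and this
  representative is taken as the element of the space.
\<close>

definition E0 :: "real \<Rightarrow> real \<Rightarrow> real \<Rightarrow> (real \<Rightarrow> real) set" where
  "E0 T \<alpha> p = {u. continuous_on {0..T} u \<and> (\<exists>w. has_frac_deriv T \<alpha> p u w)}"

text \<open>The chosen function is unique up to null sets.\<close>

definition frac_deriv :: "real \<Rightarrow> real \<Rightarrow> real \<Rightarrow> (real \<Rightarrow> real) \<Rightarrow> real \<Rightarrow> real" where
  "frac_deriv T \<alpha> p u = (SOME w. has_frac_deriv T \<alpha> p u w)"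

definition E_norm :: "real \<Rightarrow> real \<Rightarrow> real \<Rightarrow> (real \<Rightarrow> real) \<Rightarrow> real" where
  "E_norm T \<alpha> p u = Lp_norm T p (frac_deriv T \<alpha> p u)"

text \<open>The interval integral is oriented, so negative \<open>x\<close> is covered.\<close>

definition primitive :: "(real \<Rightarrow> real \<Rightarrow> real) \<Rightarrow> real \<Rightarrow> real \<Rightarrow> real" where
  "primitive f t x = (LBINT s=0..x. f t s)"

definition energy ::
  "real \<Rightarrow> real \<Rightarrow> real \<Rightarrow> real \<Rightarrow> real \<Rightarrow> (real \<Rightarrow> real \<Rightarrow> real) \<Rightarrow> (real \<Rightarrow> real) \<Rightarrow> real" where
  "energy T a b p \<alpha> f u =
     1 / (b * p\<^sup>2) * (a + b * E_norm T \<alpha> p u powr p) powr p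
     - (LINT t|lebesgue_on {0..T}. primitive f t (u t)) - a powr p / (b * p\<^sup>2)"

text \<open>
  The Frechet derivative of \<open>J\<close> at \<open>u\<close> on the normed space \<open>E0\<close> exists and is zero.
\<close>

definition critical_point ::
  "real \<Rightarrow> real \<Rightarrow> real \<Rightarrow> ((real \<Rightarrow> real) \<Rightarrow> real) \<Rightarrow> (real \<Rightarrow> real) \<Rightarrow> bool" where
  "critical_point T \<alpha> p J u \<longleftrightarrow> u \<in> E0 T \<alpha> p \<and>
     (\<forall>\<epsilon>>0. \<exists>\<rho>>0. \<forall>v\<in>E0 T \<alpha> p. E_norm T \<alpha> p v < \<rho> \<longrightarrow>
        \<bar>J (\<lambda>t. u t + v t) - J u\<bar> \<le> \<epsilon> * E_norm T \<alpha> p v)"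

text \<open>
  The boundary values follow from membership in \<open>E0\<close> when \<open>\<alpha> > 1/p\<close>; they are repeated because
  they are part of the Dirichlet problem.
\<close>

definition weak_solution ::
  "real \<Rightarrow> real \<Rightarrow> real \<Rightarrow> real \<Rightarrow> real \<Rightarrow> (real \<Rightarrow> real \<Rightarrow> real) \<Rightarrow> (real \<Rightarrow> real) \<Rightarrow> bool" where
  "weak_solution T a b p \<alpha> f u \<longleftrightarrow>
     critical_point T \<alpha> p (energy T a b p \<alpha> f) u \<and> u 0 = 0 \<and> u T = 0"

end

(*
  The energy is minimized directly. A function u of the space is the fractional integral of its
  derivative w, so bounds on the L^p norm of w give Hoelder bounds on u. By coercivity (r1 < p^2) and
  Arzela-Ascoli a minimizing sequence has a subsequence for which u_n converges uniformly. The energy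
  of the midpoint of u_n and u_m is still at least the infimum, so the norm of (w_n + w_m) / 2 does not
  drop below the limit of the norms, and uniform convexity makes w_n a Cauchy sequence in L^p; no weak
  compactness is needed. Condition (ii), tested on a small multiple of a bump function supported in
  the interval, makes the minimum negative, so the minimizer is not zero.
*)
theory Submission
  imports Defs "HOL-Complex_Analysis.Great_Picard"
begin

text \<open>The Kirchhoff term increases with the p-th power of the norm and grows like the norm to
  the power p^2, while the potential grows at most like the norm to the power r1; hence the bound on
  r1. Near zero the Kirchhoff term is only of order p in the norm, so a potential of order r2 < p
  outweighs it.

  The space is an abstract closure whose derivative is picked by \<open>SOME\<close>, so little can
  be computed from its definition. The argument therefore runs on pairs (u, w), which is legitimate
  because u determines w up to null sets. The link between u and w comes from smooth functions:
  their Riemann-Liouville derivative is a fractional integral of the ordinary derivative, and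
  fractional integrals of orders alpha and 1 - alpha compose to plain integration.

  The potential depends on u alone and is continuous under uniform convergence. A midpoint with a
  smaller norm would thus lower the Kirchhoff term while leaving the potential almost unchanged, and
  the energy would fall below its infimum. Strict monotonicity of the Kirchhoff term in the norm is
  what this step uses.\<close>

section \<open>Pointwise inequalities for powers\<close>

text \<open>The mean value theorem on the two halves of the interval: they have equal length, and
  the derivative p x^(p-1) is strictly larger on the right one.\<close>

lemma powr_midpoint_less:
  fixes a b p :: real
  assumes "0 \<le> a" "a < b" "1 < p"
  shows "((a + b) / 2) powr p < (a powr p + b powr p) / 2"
proof -
  define m where "m = (a + b) / 2"
  have m: "a < m" "m < b" "m - a = b - m" "0 < m" using assms by (auto simp: m_def field_simps)
  have cont: "continuous_on S (\<lambda>x::real. x powr p)" if "S \<subseteq> {0..}" for S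
    using that assms by (intro continuous_on_powr') (auto intro!: continuous_intros)
  have der: "((\<lambda>x. x powr p) has_real_derivative p * x powr (p - 1)) (at x)" if "x > 0" for x
    using that by (rule has_real_derivative_powr)
  have diff: "(\<lambda>x. x powr p) differentiable (at x)" if "x > 0" for x :: real
    using der[OF that] real_differentiable_def by blast
  obtain l z where z: "a < z" "z < m" "DERIV (\<lambda>x. x powr p) z :> l" "m powr p - a powr p = (m - a) * l"
    using MVT[of a m "\<lambda>x. x powr p"] cont[of "{a..m}"] diff m assms by force
  obtain l' z' where z': "m < z'" "z' < b" "DERIV (\<lambda>x. x powr p) z' :> l'" "b powr p - m powr p = (b - m) * l'"
    using MVT[of m b "\<lambda>x. x powr p"] cont[of "{m..b}"] diff m assms by force
  have "l = p * z powr (p - 1)" "l' = p * z' powr (p - 1)"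
    using z z' m assms by (auto intro!: DERIV_unique[OF _ der])
  moreover have "z powr (p - 1) < z' powr (p - 1)"
    using z z' assms by (intro powr_less_mono2) auto
  ultimately have "l < l'" using assms by simp
  then have "m powr p - a powr p < b powr p - m powr p"
    using z(4) z'(4) m by simp
  then show ?thesis by (simp add: m_def)
qed

text \<open>Passing to absolute values by the triangle inequality keeps the strictness unless the
  moduli agree; then x and y are opposite and the midpoint is 0.\<close>

lemma abs_powr_midpoint_less:
  fixes x y p :: real
  assumes "x \<noteq> y" "1 < p"
  shows "\<bar>(x + y) / 2\<bar> powr p < (\<bar>x\<bar> powr p + \<bar>y\<bar> powr p) / 2"
proof (cases "\<bar>x\<bar> = \<bar>y\<bar>")
  case True
  then have "y = - x" "x \<noteq> 0" using assms(1) by auto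
  then show ?thesis by simp
next
  case False
  have "\<bar>(x + y) / 2\<bar> powr p \<le> ((\<bar>x\<bar> + \<bar>y\<bar>) / 2) powr p"
    using assms by (intro powr_mono2) auto
  also have "\<dots> < (\<bar>x\<bar> powr p + \<bar>y\<bar> powr p) / 2"
    using powr_midpoint_less[of "\<bar>x\<bar>" "\<bar>y\<bar>" p] powr_midpoint_less[of "\<bar>y\<bar>" "\<bar>x\<bar>" p] False assms
    by (cases "\<bar>x\<bar> < \<bar>y\<bar>") (auto simp: add.commute)
  finally show ?thesis .
qed

lemma abs_powr_midpoint_le:
  fixes x y p :: real
  assumes "1 < p"
  shows "\<bar>(x + y) / 2\<bar> powr p \<le> (\<bar>x\<bar> powr p + \<bar>y\<bar> powr p) / 2"
  using abs_powr_midpoint_less[of x y p] assms by (cases "x = y") auto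

text \<open>
  Integrating this pointwise inequality gives the uniform convexity of \<open>L\<^sup>p\<close>; by homogeneity it only
  has to be checked on the unit sphere, where compactness provides the constant.
\<close>

lemma powr_uniformly_convex:
  fixes p \<epsilon> :: real
  assumes p: "1 < p" and "\<epsilon> > 0"
  obtains C where "C \<ge> 0" "\<And>x y::real. \<bar>x - y\<bar> powr p \<le> \<epsilon> * (\<bar>x\<bar> powr p + \<bar>y\<bar> powr p)
      + C * ((\<bar>x\<bar> powr p + \<bar>y\<bar> powr p) / 2 - \<bar>(x + y) / 2\<bar> powr p)"
proof -
  define D where "D z = (\<bar>fst z\<bar> powr p + \<bar>snd z\<bar> powr p) / 2 - \<bar>(fst z + snd z) / 2\<bar> powr p"
    for z :: "real \<times> real"
  define g where "g z = \<bar>fst z - snd z\<bar> powr p - \<epsilon> * (\<bar>fst z\<bar> powr p + \<bar>snd z\<bar> powr p)"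
    for z :: "real \<times> real"
  \<comment> \<open>Only on \<open>K\<close> is a positive constant required. Since \<open>g\<close>
    is negative on the diagonal of the sphere, \<open>K\<close> avoids the diagonal, and the
    convexity defect \<open>D\<close> has a positive minimum there.\<close>
  define K where "K = sphere (0::real \<times> real) 1 \<inter> {z. 0 \<le> g z}"
  have cD: "continuous_on UNIV D" unfolding D_def using p
    by (intro continuous_intros continuous_on_powr') auto
  have cg: "continuous_on UNIV g" unfolding g_def using p
    by (intro continuous_intros continuous_on_powr') auto
  have K: "compact K" unfolding K_def
    using cg by (intro compact_Int_closed compact_sphere closed_Collect_le) auto
  have D0: "D z \<ge> 0" for z using abs_powr_midpoint_le[OF p, of "fst z" "snd z"] by (simp add: D_def)
  have g0: "g z \<le> 2 powr p" if "z \<in> sphere 0 1" for z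
  proof -
    have "\<bar>fst z\<bar> \<le> 1" "\<bar>snd z\<bar> \<le> 1" using that norm_fst_le[of "fst z" "snd z"] norm_snd_le[of "snd z" "fst z"] by auto
    then have "\<bar>fst z - snd z\<bar> powr p \<le> 2 powr p" using p by (intro powr_mono2) auto
    moreover have "0 \<le> \<epsilon> * (\<bar>fst z\<bar> powr p + \<bar>snd z\<bar> powr p)" using assms by simp
    ultimately show ?thesis by (simp add: g_def)
  qed
  obtain C where C: "C \<ge> 0" "\<And>z. z \<in> sphere 0 1 \<Longrightarrow> g z \<le> C * D z"
  proof (cases "K = {}")
    case True
    then show ?thesis using that[of 0] by (force simp: K_def)
  next
    case False
    then obtain z0 where z0: "z0 \<in> K" "\<And>z. z \<in> K \<Longrightarrow> D z0 \<le> D z"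
      using continuous_attains_inf[OF K False continuous_on_subset[OF cD]] by blast
    have "fst z0 \<noteq> snd z0"
    proof
      assume eq: "fst z0 = snd z0"
      have "z0 \<noteq> 0" using z0(1) by (auto simp: K_def)
      then have "fst z0 \<noteq> 0" using eq by (metis fst_zero prod_eqI snd_zero)
      then have "g z0 < 0" using eq assms by (simp add: g_def)
      then show False using z0(1) by (simp add: K_def)
    qed
    then have pos: "D z0 > 0" using abs_powr_midpoint_less[OF _ p] by (simp add: D_def)
    \<comment> \<open>The numerator bounds \<open>g\<close> on the sphere; the denominator is the
      minimum of \<open>D\<close> on \<open>K\<close>.\<close>
    show ?thesis
    proof (rule that[of "2 powr p / D z0"])
      show "0 \<le> 2 powr p / D z0" using pos by simp
      fix z :: "real \<times> real" assume z: "z \<in> sphere 0 1"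
      show "g z \<le> 2 powr p / D z0 * D z"
      proof (cases "0 \<le> g z")
        case True
        then have "D z0 \<le> D z" using z0 z by (simp add: K_def)
        then have "1 \<le> D z / D z0" using pos by simp
        then have "2 powr p * 1 \<le> 2 powr p * (D z / D z0)" by (intro mult_left_mono) auto
        then show ?thesis using g0[OF z] by (simp add: field_simps)
      next
        case False
        moreover have "0 \<le> 2 powr p / D z0 * D z" using D0[of z] pos by simp
        ultimately show ?thesis by linarith
      qed
    qed
  qed
  have scale: "g (r *\<^sub>R z) = r powr p * g z" "D (r *\<^sub>R z) = r powr p * D z" if "r \<ge> 0" for r z
  proof -
    have *: "\<bar>r * x\<bar> powr p = r powr p * \<bar>x\<bar> powr p" for x using that by (simp add: abs_mult powr_mult)
    show "g (r *\<^sub>R z) = r powr p * g z"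
      using *[of "fst z"] *[of "snd z"] *[of "fst z - snd z"] by (simp add: g_def algebra_simps)
    show "D (r *\<^sub>R z) = r powr p * D z"
      using *[of "fst z"] *[of "snd z"] *[of "(fst z + snd z)/2"] by (simp add: D_def field_simps)
  qed
  have all: "g z \<le> C * D z" for z
  proof (cases "z = 0")
    case True
    then show ?thesis using assms by (simp add: g_def D_def)
  next
    case False
    define z' where "z' = (1 / norm z) *\<^sub>R z"
    have "z' \<in> sphere 0 1" using False by (simp add: z'_def)
    moreover have "z = norm z *\<^sub>R z'" using False by (simp add: z'_def)
    ultimately show ?thesis using C(2)[of z'] scale[of "norm z" z'] by (metis mult.left_commute mult_left_mono norm_ge_zero powr_ge_zero)
  qed
  show ?thesis
  proof (rule that[OF C(1)])
    fix x y :: real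
    show "\<bar>x - y\<bar> powr p \<le> \<epsilon> * (\<bar>x\<bar> powr p + \<bar>y\<bar> powr p)
      + C * ((\<bar>x\<bar> powr p + \<bar>y\<bar> powr p) / 2 - \<bar>(x + y) / 2\<bar> powr p)"
      using all[of "(x, y)"] by (simp add: g_def D_def)
  qed
qed

section \<open>Increments and second differences of powers\<close>

lemma abs_powr_add_le:
  fixes x y p :: real
  assumes "0 \<le> p"
  shows "\<bar>x + y\<bar> powr p \<le> 2 powr p * (\<bar>x\<bar> powr p + \<bar>y\<bar> powr p)"
proof -
  have "\<bar>x + y\<bar> powr p \<le> (2 * max \<bar>x\<bar> \<bar>y\<bar>) powr p" using assms by (intro powr_mono2) auto
  also have "\<dots> = 2 powr p * max \<bar>x\<bar> \<bar>y\<bar> powr p" by (simp add: powr_mult)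
  also have "\<dots> \<le> 2 powr p * (\<bar>x\<bar> powr p + \<bar>y\<bar> powr p)"
    by (intro mult_left_mono) (auto simp: max_def)
  finally show ?thesis .
qed

text \<open>With s = y / x the second difference is |x|^p (h(s) - 2), and h has derivative 0 at 0;
  so it is at most epsilon |x|^p |s| as long as s is small. For larger |y| everything is absorbed
  into |y|^p. This form serves every p > 1 without separating p < 2 from p > 2.\<close>

lemma powr_second_difference_small:
  fixes p \<epsilon> :: real
  assumes p: "1 < p" and \<epsilon>: "\<epsilon> > 0"
  obtains C where "C \<ge> 0" "\<And>x y::real. \<bar>x + y\<bar> powr p + \<bar>x - y\<bar> powr p - 2 * \<bar>x\<bar> powr p
      \<le> \<epsilon> * (\<bar>x\<bar> powr (p - 1) * \<bar>y\<bar>) + C * \<bar>y\<bar> powr p"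
proof -
  define h where "h s = (1 + s) powr p + (1 - s) powr p" for s :: real
  have "(h has_real_derivative 0) (at 0)" unfolding h_def
    by (auto intro!: derivative_eq_intros)
  then have "((\<lambda>s. (h s - 2) / s) \<longlongrightarrow> 0) (at 0)"
    by (simp add: has_field_derivative_iff h_def)
  then obtain d0 where d0: "d0 > 0" "\<And>s. s \<noteq> 0 \<Longrightarrow> \<bar>s\<bar> < d0 \<Longrightarrow> \<bar>(h s - 2) / s\<bar> < \<epsilon>"
    using LIM_D[OF _ \<epsilon>, of "\<lambda>s. (h s - 2) / s" 0 0] by auto
  \<comment> \<open>The cap 1 keeps 1 + s and 1 - s positive, so that the absolute values can be
    factored.\<close>
  define d where "d = min d0 1"
  have d: "d > 0" "d \<le> 1" using d0 by (auto simp: d_def)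
  have small: "h s - 2 \<le> \<epsilon> * \<bar>s\<bar>" if "\<bar>s\<bar> < d" for s
  proof (cases "s = 0")
    case False
    then have "\<bar>h s - 2\<bar> / \<bar>s\<bar> < \<epsilon>" using d0(2)[of s] that by (simp add: d_def)
    then have "\<bar>h s - 2\<bar> < \<epsilon> * \<bar>s\<bar>" using False by (simp add: divide_less_eq)
    then show ?thesis by simp
  qed (simp add: h_def)
  \<comment> \<open>In the remaining regime |x| is at most |y| / d, so |x + y| and |x - y| are both
    at most (1/d + 1) |y|.\<close>
  define C where "C = 2 * (1 / d + 1) powr p"
  have C: "C \<ge> 0" by (simp add: C_def)
  show ?thesis
  proof (rule that[OF C])
    fix x y :: real
    show "\<bar>x + y\<bar> powr p + \<bar>x - y\<bar> powr p - 2 * \<bar>x\<bar> powr p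
      \<le> \<epsilon> * (\<bar>x\<bar> powr (p - 1) * \<bar>y\<bar>) + C * \<bar>y\<bar> powr p"
    proof (cases "\<bar>y\<bar> < d * \<bar>x\<bar>")
      case True
      then have x: "x \<noteq> 0" by auto
      define s where "s = y / x"
      have s: "\<bar>s\<bar> < d" "y = s * x" using True x by (auto simp: s_def divide_less_eq abs_divide)
      have "\<bar>x + y\<bar> = \<bar>x\<bar> * (1 + s)" "\<bar>x - y\<bar> = \<bar>x\<bar> * (1 - s)"
        using s d abs_mult[of x "1 + s"] abs_mult[of x "1 - s"] by (auto simp: algebra_simps)
      then have "\<bar>x + y\<bar> powr p = \<bar>x\<bar> powr p * (1 + s) powr p"
        "\<bar>x - y\<bar> powr p = \<bar>x\<bar> powr p * (1 - s) powr p"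
        using s d by (simp_all add: powr_mult)
      then have "\<bar>x + y\<bar> powr p + \<bar>x - y\<bar> powr p - 2 * \<bar>x\<bar> powr p = \<bar>x\<bar> powr p * (h s - 2)"
        by (simp add: h_def distrib_left right_diff_distrib)
      also have "\<dots> \<le> \<bar>x\<bar> powr p * (\<epsilon> * \<bar>s\<bar>)" using small[OF s(1)] by (intro mult_left_mono) auto
      also have "\<dots> = \<epsilon> * (\<bar>x\<bar> powr (p - 1) * \<bar>y\<bar>)"
        using x by (simp add: s(2) abs_mult powr_diff)
      also have "\<dots> \<le> \<epsilon> * (\<bar>x\<bar> powr (p - 1) * \<bar>y\<bar>) + C * \<bar>y\<bar> powr p" using C by simp
      finally show ?thesis .
    next
      case False
      then have "\<bar>x\<bar> \<le> 1 / d * \<bar>y\<bar>" using d by (simp add: field_simps)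
      then have "\<bar>x + y\<bar> \<le> (1 / d + 1) * \<bar>y\<bar>" "\<bar>x - y\<bar> \<le> (1 / d + 1) * \<bar>y\<bar>"
        by (auto simp: algebra_simps)
      then have "\<bar>x + y\<bar> powr p \<le> ((1 / d + 1) * \<bar>y\<bar>) powr p" "\<bar>x - y\<bar> powr p \<le> ((1 / d + 1) * \<bar>y\<bar>) powr p"
        using p by (auto intro!: powr_mono2)
      moreover have "((1 / d + 1) * \<bar>y\<bar>) powr p = (1 / d + 1) powr p * \<bar>y\<bar> powr p"
        using d by (simp add: powr_mult)
      ultimately have "\<bar>x + y\<bar> powr p + \<bar>x - y\<bar> powr p \<le> C * \<bar>y\<bar> powr p" by (simp add: C_def)
      moreover have "0 \<le> \<epsilon> * (\<bar>x\<bar> powr (p - 1) * \<bar>y\<bar>)" using \<epsilon> by simp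
      moreover have "0 \<le> \<bar>x\<bar> powr p" by simp
      ultimately show ?thesis by linarith
    qed
  qed
qed

lemma powr_diff_le:
  fixes a b p :: real
  assumes p: "1 < p" and "0 \<le> a" "a \<le> b"
  shows "b powr p - a powr p \<le> p * b powr (p - 1) * (b - a)"
proof (cases "a = b")
  case False
  have cont: "continuous_on {a..b} (\<lambda>x::real. x powr p)"
    using assms by (intro continuous_on_powr') (auto intro!: continuous_intros)
  have der: "((\<lambda>x. x powr p) has_real_derivative p * x powr (p - 1)) (at x)" if "x > 0" for x
    using that by (rule has_real_derivative_powr)
  have diff: "(\<lambda>x. x powr p) differentiable (at x)" if "x > 0" for x :: real
    using der[OF that] real_differentiable_def by blast
  obtain l z where z: "a < z" "z < b" "DERIV (\<lambda>x. x powr p) z :> l" "b powr p - a powr p = (b - a) * l"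
    using MVT[of a b "\<lambda>x. x powr p"] cont diff assms False by force
  have "l = p * z powr (p - 1)" using z assms by (auto intro!: DERIV_unique[OF _ der])
  also have "\<dots> \<le> p * b powr (p - 1)" using z assms by (intro mult_left_mono powr_mono2) auto
  finally have "(b - a) * l \<le> (b - a) * (p * b powr (p - 1))" using assms by (intro mult_left_mono) auto
  then show ?thesis using z by (simp add: algebra_simps)
qed simp

text \<open>Both |x + y| and |x| lie below b = |x| + |y|, where the slope of the power is at most p
  b^(p-1). Splitting b^(p-1) produces the two summands.\<close>

lemma abs_powr_diff_le:
  fixes x y p :: real
  assumes p: "1 < p"
  shows "\<bar>\<bar>x + y\<bar> powr p - \<bar>x\<bar> powr p\<bar> \<le> p * 2 powr (p - 1) * (\<bar>x\<bar> powr (p - 1) * \<bar>y\<bar> + \<bar>y\<bar> powr p)"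
proof -
  define b where "b = \<bar>x\<bar> + \<bar>y\<bar>"
  have "\<bar>\<bar>x + y\<bar> powr p - \<bar>x\<bar> powr p\<bar> \<le> p * b powr (p - 1) * \<bar>\<bar>x + y\<bar> - \<bar>x\<bar>\<bar>"
  proof (cases "\<bar>x + y\<bar> \<le> \<bar>x\<bar>")
    case True
    have "\<bar>x\<bar> powr p - \<bar>x + y\<bar> powr p \<le> p * \<bar>x\<bar> powr (p - 1) * (\<bar>x\<bar> - \<bar>x + y\<bar>)"
      using powr_diff_le[OF p _ True] by simp
    also have "\<dots> \<le> p * b powr (p - 1) * (\<bar>x\<bar> - \<bar>x + y\<bar>)"
      using p True by (intro mult_right_mono mult_left_mono powr_mono2) (auto simp: b_def)
    finally show ?thesis using True powr_mono2[of p "\<bar>x + y\<bar>" "\<bar>x\<bar>"] p by auto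
  next
    case False
    have "\<bar>x + y\<bar> powr p - \<bar>x\<bar> powr p \<le> p * \<bar>x + y\<bar> powr (p - 1) * (\<bar>x + y\<bar> - \<bar>x\<bar>)"
      using powr_diff_le[OF p, of "\<bar>x\<bar>" "\<bar>x + y\<bar>"] False by simp
    also have "\<dots> \<le> p * b powr (p - 1) * (\<bar>x + y\<bar> - \<bar>x\<bar>)"
      using p False by (intro mult_right_mono mult_left_mono powr_mono2) (auto simp: b_def)
    finally show ?thesis using False powr_mono2[of p "\<bar>x\<bar>" "\<bar>x + y\<bar>"] p by auto
  qed
  also have "\<dots> \<le> p * b powr (p - 1) * \<bar>y\<bar>" using p by (intro mult_left_mono) auto
  also have "b powr (p - 1) \<le> 2 powr (p - 1) * (\<bar>x\<bar> powr (p - 1) + \<bar>y\<bar> powr (p - 1))"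
    using abs_powr_add_le[of "p - 1" "\<bar>x\<bar>" "\<bar>y\<bar>"] p by (simp add: b_def)
  also have "p * (2 powr (p - 1) * (\<bar>x\<bar> powr (p - 1) + \<bar>y\<bar> powr (p - 1))) * \<bar>y\<bar>
     = p * 2 powr (p - 1) * (\<bar>x\<bar> powr (p - 1) * \<bar>y\<bar> + \<bar>y\<bar> powr p)"
    by (cases "y = 0") (auto simp: powr_diff field_simps)
  finally show ?thesis using p by (simp add: mult_right_mono mult_left_mono)
qed

section \<open>Integrals of powers on an interval\<close>

text \<open>Young's inequality is applied after dividing both functions by their norms, so that the
  right side integrates to 1/p + 1/q = 1. If a norm vanishes, the product is zero almost
  everywhere.\<close>

lemma Hoelder:
  fixes f g :: "'a \<Rightarrow> real"
  assumes pq: "1 < p" "1 < q" "1 / p + 1 / q = 1"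
    and f[measurable]: "f \<in> borel_measurable M" and g[measurable]: "g \<in> borel_measurable M"
    and If: "integrable M (\<lambda>x. \<bar>f x\<bar> powr p)" and Ig: "integrable M (\<lambda>x. \<bar>g x\<bar> powr q)"
  shows Hoelder_integrable: "integrable M (\<lambda>x. f x * g x)"
    and Hoelder_inequality: "(LINT x|M. \<bar>f x * g x\<bar>)
      \<le> (LINT x|M. \<bar>f x\<bar> powr p) powr (1 / p) * (LINT x|M. \<bar>g x\<bar> powr q) powr (1 / q)"
proof -
  have Young: "\<bar>u * v\<bar> \<le> \<bar>u\<bar> powr p / p + \<bar>v\<bar> powr q / q" for u v
    using Youngs_inequality[OF pq, of "\<bar>u\<bar>" "\<bar>v\<bar>"] by (simp add: abs_mult)
  have bound: "integrable M (\<lambda>x. \<bar>f x\<bar> powr p / p + \<bar>g x\<bar> powr q / q)"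
    using If Ig by simp
  show int: "integrable M (\<lambda>x. f x * g x)"
    by (rule Bochner_Integration.integrable_bound[OF bound])
      (use Young in \<open>auto intro!: AE_I2 intro: order_trans[OF _ abs_ge_self]\<close>)
  define A where "A = (LINT x|M. \<bar>f x\<bar> powr p)"
  define B where "B = (LINT x|M. \<bar>g x\<bar> powr q)"
  have AB: "A \<ge> 0" "B \<ge> 0" by (auto simp: A_def B_def)
  show "(LINT x|M. \<bar>f x * g x\<bar>)
      \<le> (LINT x|M. \<bar>f x\<bar> powr p) powr (1 / p) * (LINT x|M. \<bar>g x\<bar> powr q) powr (1 / q)"
  proof (cases "A = 0 \<or> B = 0")
    case True
    have "AE x in M. f x * g x = 0"
      using True
    proof
      assume "A = 0"
      then have "AE x in M. \<bar>f x\<bar> powr p = 0"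
        using integral_nonneg_eq_0_iff_AE[OF If] by (simp add: A_def)
      then show ?thesis by eventually_elim simp
    next
      assume "B = 0"
      then have "AE x in M. \<bar>g x\<bar> powr q = 0"
        using integral_nonneg_eq_0_iff_AE[OF Ig] by (simp add: B_def)
      then show ?thesis by eventually_elim simp
    qed
    then have "(LINT x|M. \<bar>f x * g x\<bar>) = (LINT x|M. 0)"
      by (intro integral_cong_AE) auto
    then show ?thesis by simp
  next
    case False
    with AB have AB: "A > 0" "B > 0" by auto
    define a where "a = A powr (1 / p)"
    define b where "b = B powr (1 / q)"
    have ab: "a > 0" "b > 0" "a powr p = A" "b powr q = B"
      using AB pq by (auto simp: a_def b_def powr_powr)
    have "(LINT x|M. \<bar>f x * g x\<bar>) / (a * b) = (LINT x|M. \<bar>f x / a * (g x / b)\<bar>)"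
      using ab by (simp add: abs_mult)
    also have "\<dots> \<le> (LINT x|M. \<bar>f x\<bar> powr p / (A * p) + \<bar>g x\<bar> powr q / (B * q))"
    proof (intro integral_mono)
      show "integrable M (\<lambda>x. \<bar>f x / a * (g x / b)\<bar>)"
        using int by simp
      show "integrable M (\<lambda>x. \<bar>f x\<bar> powr p / (A * p) + \<bar>g x\<bar> powr q / (B * q))"
        using If Ig by simp
      fix x
      show "\<bar>f x / a * (g x / b)\<bar> \<le> \<bar>f x\<bar> powr p / (A * p) + \<bar>g x\<bar> powr q / (B * q)"
        using Young[of "f x / a" "g x / b"] ab by (simp add: powr_divide)
    qed
    also have "\<dots> = 1 / p + 1 / q"
      using If Ig AB by (simp add: A_def[symmetric] B_def[symmetric])
    finally have "(LINT x|M. \<bar>f x * g x\<bar>) \<le> a * b"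
      using ab pq by (simp add: divide_le_eq)
    then show ?thesis by (simp add: a_def b_def A_def B_def)
  qed
qed

section \<open>The p-th power of the norm, and completeness\<close>

definition Lp_int :: "real \<Rightarrow> real \<Rightarrow> (real \<Rightarrow> real) \<Rightarrow> real" where
  "Lp_int T p u = (LINT t|lebesgue_on {0..T}. \<bar>u t\<bar> powr p)"

lemma Lp_int_nonneg [simp]: "0 \<le> Lp_int T p u"
  by (simp add: Lp_int_def)

lemma Lp_norm_eq: "Lp_norm T p u = Lp_int T p u powr (1 / p)"
  by (simp add: Lp_norm_def Lp_int_def)

lemma Lp_norm_powr: "p > 0 \<Longrightarrow> Lp_norm T p u powr p = Lp_int T p u"
  by (simp add: Lp_norm_eq powr_powr)

lemma Lp_funD:
  assumes "u \<in> Lp_fun T p"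
  shows "u \<in> borel_measurable (lebesgue_on {0..T})" "integrable (lebesgue_on {0..T}) (\<lambda>t. \<bar>u t\<bar> powr p)"
  using assms by (auto simp: Lp_fun_def)

text \<open>Since norms enter through their p-th powers and constants are immaterial for
  convergence, the crude factor 2^p takes the place of Minkowski's inequality.\<close>

lemma Lp_fun_add:
  assumes "p > 0" "u \<in> Lp_fun T p" "v \<in> Lp_fun T p"
  shows "(\<lambda>t. u t + v t) \<in> Lp_fun T p"
    and "Lp_int T p (\<lambda>t. u t + v t) \<le> 2 powr p * (Lp_int T p u + Lp_int T p v)"
proof -
  note [measurable] = Lp_funD(1)[OF assms(2)] Lp_funD(1)[OF assms(3)]
  have i: "integrable (lebesgue_on {0..T}) (\<lambda>t. 2 powr p * (\<bar>u t\<bar> powr p + \<bar>v t\<bar> powr p))"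
    using assms by (auto simp: Lp_fun_def)
  have j: "integrable (lebesgue_on {0..T}) (\<lambda>t. \<bar>u t + v t\<bar> powr p)"
    by (rule Bochner_Integration.integrable_bound[OF i])
      (use abs_powr_add_le assms in \<open>auto intro!: AE_I2 intro: order_trans[OF _ abs_ge_self]\<close>)
  then show "(\<lambda>t. u t + v t) \<in> Lp_fun T p" by (simp add: Lp_fun_def)
  have "Lp_int T p (\<lambda>t. u t + v t) \<le> (LINT t|lebesgue_on {0..T}. 2 powr p * (\<bar>u t\<bar> powr p + \<bar>v t\<bar> powr p))"
    unfolding Lp_int_def by (intro integral_mono i j abs_powr_add_le) (use assms in auto)
  then show "Lp_int T p (\<lambda>t. u t + v t) \<le> 2 powr p * (Lp_int T p u + Lp_int T p v)"
    using assms by (simp add: Lp_int_def Lp_fun_def)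
qed

lemma Lp_fun_cmult:
  assumes "p > 0" "u \<in> Lp_fun T p"
  shows "(\<lambda>t. c * u t) \<in> Lp_fun T p" and "Lp_int T p (\<lambda>t. c * u t) = \<bar>c\<bar> powr p * Lp_int T p u"
  using assms by (auto simp: Lp_fun_def Lp_int_def abs_mult powr_mult)

lemma Lp_fun_diff:
  assumes "p > 0" "u \<in> Lp_fun T p" "v \<in> Lp_fun T p"
  shows "(\<lambda>t. u t - v t) \<in> Lp_fun T p"
    and "Lp_int T p (\<lambda>t. u t - v t) \<le> 2 powr p * (Lp_int T p u + Lp_int T p v)"
  using Lp_fun_add[OF assms(1,2) Lp_fun_cmult(1)[OF assms(1,3), of "- 1"]]
    Lp_fun_cmult(2)[OF assms(1,3), of "- 1"] by simp_all

lemma Lp_int_diff_commute: "Lp_int T p (\<lambda>t. u t - v t) = Lp_int T p (\<lambda>t. v t - u t)"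
  by (simp add: Lp_int_def abs_minus_commute)

lemma Lp_int_diff_triangle:
  assumes "p > 0" "u \<in> Lp_fun T p" "v \<in> Lp_fun T p" "w \<in> Lp_fun T p"
  shows "Lp_int T p (\<lambda>t. u t - w t) \<le> 2 powr p * (Lp_int T p (\<lambda>t. u t - v t) + Lp_int T p (\<lambda>t. v t - w t))"
  using Lp_fun_add(2)[OF assms(1) Lp_fun_diff(1)[OF assms(1,2,3)] Lp_fun_diff(1)[OF assms(1,3,4)]]
  by simp

lemma Lp_int_cong_AE:
  assumes "AE t in lebesgue_on {0..T}. u t = v t" "u \<in> Lp_fun T p" "v \<in> Lp_fun T p"
  shows "Lp_int T p u = Lp_int T p v"
proof -
  note [measurable] = Lp_funD(1)[OF assms(2)] Lp_funD(1)[OF assms(3)]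
  show ?thesis unfolding Lp_int_def
    by (intro integral_cong_AE) (use assms(1) in auto)
qed

lemma integrable_continuous_Icc:
  fixes u :: "real \<Rightarrow> real"
  assumes "continuous_on {a..b} u"
  shows "integrable (lebesgue_on {a..b}) u"
  using borel_integrable_atLeastAtMost'[OF assms]
  by (auto simp: set_integrable_def integrable_restrict_space integrable_completion)

lemma continuous_Lp_fun:
  assumes "p > 0" "continuous_on {0..T} u"
  shows "u \<in> Lp_fun T p"
  unfolding Lp_fun_def
  using assms by (auto intro!: integrable_continuous_Icc continuous_intros continuous_on_powr'
      borel_measurable_integrable)

lemma Lp_int_le_const:
  assumes "T > 0" "p > 0" "u \<in> Lp_fun T p" "\<And>t. t \<in> {0..T} \<Longrightarrow> \<bar>u t\<bar> \<le> B"
  shows "Lp_int T p u \<le> T * B powr p"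
proof -
  have "Lp_int T p u \<le> (LINT t|lebesgue_on {0..T}. B powr p)"
    unfolding Lp_int_def
    using assms by (intro integral_mono Lp_funD integrable_const_ivl powr_mono2) auto
  then show ?thesis using assms by (simp add: measure_restrict_space)
qed

text \<open>Hoelder's inequality against the constant function 1. The embedding into L^1 serves both
  completeness and the use of Fubini.\<close>

lemma Lp_fun_abs_integral_le:
  assumes "T > 0" "p > 1" "u \<in> Lp_fun T p"
  shows "integrable (lebesgue_on {0..T}) u"
    and "(LINT t|lebesgue_on {0..T}. \<bar>u t\<bar>) \<le> T powr (1 - 1 / p) * Lp_int T p u powr (1 / p)"
proof -
  define q where "q = p / (p - 1)"
  have pq: "1 < q" "1 / q + 1 / p = 1" "1 / q = 1 - 1 / p" using assms by (auto simp: q_def field_simps)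
  have [simp]: "integrable (lebesgue_on {0..T}) (\<lambda>x. \<bar>1\<bar> powr q)" by simp
  show "integrable (lebesgue_on {0..T}) u"
    using Hoelder_integrable[OF pq(1) assms(2) pq(2), of "\<lambda>_. 1" "lebesgue_on {0..T}" u] Lp_funD[OF assms(3)]
    by simp
  show "(LINT t|lebesgue_on {0..T}. \<bar>u t\<bar>) \<le> T powr (1 - 1 / p) * Lp_int T p u powr (1 / p)"
    using Hoelder_inequality[OF pq(1) assms(2) pq(2), of "\<lambda>_. 1" "lebesgue_on {0..T}" u] Lp_funD[OF assms(3)] assms
    by (simp add: Lp_int_def measure_restrict_space flip: pq(3))
qed

text \<open>Riesz-Fischer: an L^p Cauchy sequence is L^1 Cauchy, so a subsequence converges almost
  everywhere, and Fatou's lemma along it carries the Cauchy estimate over to the limit.\<close>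

lemma Lp_complete:
  assumes "T > 0" "p > 1" and w: "\<And>n::nat. w n \<in> Lp_fun T p"
    and Cauchy: "\<And>\<epsilon>. \<epsilon> > 0 \<Longrightarrow> \<exists>N. \<forall>i\<ge>N. \<forall>j\<ge>N. Lp_int T p (\<lambda>t. w i t - w j t) < \<epsilon>"
  obtains v where "v \<in> Lp_fun T p" "(\<lambda>n. Lp_int T p (\<lambda>t. w n t - v t)) \<longlonglongrightarrow> 0"
proof -
  let ?M = "lebesgue_on {0..T}"
  note [measurable] = Lp_funD(1)[OF w]
  have p0: "p > 0" using assms by simp
  have L1: "\<exists>N. \<forall>i\<ge>N. \<forall>j\<ge>N. (LINT t|?M. norm (w i t - w j t)) < e" if e: "e > 0" for e
  proof -
    define c where "c = T powr (1 - 1 / p)"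
    have c: "c > 0" using assms by (simp add: c_def)
    obtain N where N: "\<And>i j. i \<ge> N \<Longrightarrow> j \<ge> N \<Longrightarrow> Lp_int T p (\<lambda>t. w i t - w j t) < (e / c) powr p"
      using Cauchy[of "(e / c) powr p"] e c by auto
    have "(LINT t|?M. norm (w i t - w j t)) < e" if "i \<ge> N" "j \<ge> N" for i j
    proof -
      have "(LINT t|?M. norm (w i t - w j t)) \<le> c * Lp_int T p (\<lambda>t. w i t - w j t) powr (1 / p)"
        using Lp_fun_abs_integral_le(2)[OF assms(1,2) Lp_fun_diff(1)[OF p0 w w]] by (simp add: c_def)
      also have "\<dots> < c * ((e / c) powr p) powr (1 / p)"
        using c p0 N[OF that] by (intro mult_strict_left_mono powr_less_mono2) auto
      also have "\<dots> = e" using c e p0 by (simp add: powr_powr)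
      finally show ?thesis .
    qed
    then show ?thesis by blast
  qed
  obtain r where r: "strict_mono r" "AE x in ?M. Cauchy (\<lambda>i. w (r i) x)"
    by (rule cauchy_L1_AE_cauchy_subseq[OF Lp_fun_abs_integral_le(1)[OF assms(1,2) w] L1])
  \<comment> \<open>Where the subsequence diverges \<open>lim\<close> is unspecified; this is a null
    set, and \<open>v\<close> is measurable all the same.\<close>
  define v where "v x = lim (\<lambda>i. w (r i) x)" for x
  have [measurable]: "v \<in> borel_measurable ?M" unfolding v_def by measurable
  have lim: "AE x in ?M. (\<lambda>i. w (r i) x) \<longlonglongrightarrow> v x"
    using r(2) by eventually_elim (simp add: v_def Cauchy_convergent_iff convergent_LIMSEQ_iff)
  have nn: "(\<integral>\<^sup>+t. ennreal (\<bar>w i t - w j t\<bar> powr p) \<partial>?M) = ennreal (Lp_int T p (\<lambda>t. w i t - w j t))" for i j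
    unfolding Lp_int_def by (intro nn_integral_eq_integral Lp_funD Lp_fun_diff p0 w) auto
  have Fatou: "(\<integral>\<^sup>+t. ennreal (\<bar>w i t - v t\<bar> powr p) \<partial>?M) \<le> ennreal \<epsilon>"
    if "\<And>j. j \<ge> N \<Longrightarrow> Lp_int T p (\<lambda>t. w i t - w j t) < \<epsilon>" for i N \<epsilon>
  proof -
    have "(\<integral>\<^sup>+t. ennreal (\<bar>w i t - v t\<bar> powr p) \<partial>?M)
        = (\<integral>\<^sup>+t. liminf (\<lambda>k. ennreal (\<bar>w i t - w (r k) t\<bar> powr p)) \<partial>?M)"
    proof (intro nn_integral_cong_AE)
      show "AE t in ?M. ennreal (\<bar>w i t - v t\<bar> powr p) = liminf (\<lambda>k. ennreal (\<bar>w i t - w (r k) t\<bar> powr p))"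
        using lim
      proof eventually_elim
        case (elim t)
        have "(\<lambda>k. ennreal (\<bar>w i t - w (r k) t\<bar> powr p)) \<longlonglongrightarrow> ennreal (\<bar>w i t - v t\<bar> powr p)"
          using elim p0 by (intro tendsto_intros tendsto_ennrealI tendsto_powr2) auto
        then show ?case by (rule lim_imp_Liminf[OF sequentially_bot, symmetric])
      qed
    qed
    also have "\<dots> \<le> liminf (\<lambda>k. \<integral>\<^sup>+t. ennreal (\<bar>w i t - w (r k) t\<bar> powr p) \<partial>?M)"
      by (intro nn_integral_liminf) measurable
    also have "\<dots> \<le> limsup (\<lambda>k. \<integral>\<^sup>+t. ennreal (\<bar>w i t - w (r k) t\<bar> powr p) \<partial>?M)"
      by (intro Liminf_le_Limsup) auto
    also have "\<dots> \<le> ennreal \<epsilon>"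
    proof (rule Limsup_bounded)
      show "\<forall>\<^sub>F k in sequentially. (\<integral>\<^sup>+t. ennreal (\<bar>w i t - w (r k) t\<bar> powr p) \<partial>?M) \<le> ennreal \<epsilon>"
        using eventually_ge_at_top[of N]
      proof eventually_elim
        case (elim k)
        then have "r k \<ge> N" using seq_suble[OF r(1), of k] by linarith
        then show ?case using that[of "r k"] by (simp add: nn ennreal_leI)
      qed
    qed
    finally show ?thesis .
  qed
  have diff: "(\<lambda>t. w i t - v t) \<in> Lp_fun T p \<and> Lp_int T p (\<lambda>t. w i t - v t) \<le> \<epsilon>"
    if "\<And>j. j \<ge> N \<Longrightarrow> Lp_int T p (\<lambda>t. w i t - w j t) < \<epsilon>" for i N \<epsilon>
  proof -
    have "\<epsilon> > 0" using that[of N] Lp_int_nonneg[of T p "\<lambda>t. w i t - w N t"] by linarith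
    have F: "(\<integral>\<^sup>+t. ennreal (\<bar>w i t - v t\<bar> powr p) \<partial>?M) \<le> ennreal \<epsilon>"
      by (rule Fatou[of N]) (rule that)
    have "integrable ?M (\<lambda>t. \<bar>w i t - v t\<bar> powr p)"
    proof (rule integrableI_bounded)
      show "(\<integral>\<^sup>+t. ennreal (norm (\<bar>w i t - v t\<bar> powr p)) \<partial>?M) < \<infinity>"
        using F by (auto intro: le_less_trans)
    qed measurable
    moreover have "Lp_int T p (\<lambda>t. w i t - v t) = enn2real (\<integral>\<^sup>+t. ennreal (\<bar>w i t - v t\<bar> powr p) \<partial>?M)"
      unfolding Lp_int_def by (intro integral_eq_nn_integral) auto
    moreover have "\<dots> \<le> \<epsilon>" using F \<open>\<epsilon> > 0\<close> by (simp add: enn2real_leI)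
    ultimately show ?thesis by (simp add: Lp_fun_def)
  qed
  obtain N0 where N0: "\<And>i j. i \<ge> N0 \<Longrightarrow> j \<ge> N0 \<Longrightarrow> Lp_int T p (\<lambda>t. w i t - w j t) < 1"
    using Cauchy[of 1] by auto
  \<comment> \<open>One difference in L^p is enough, because \<open>v\<close> is \<open>w N0\<close>
    minus that difference.\<close>
  have "(\<lambda>t. w N0 t - v t) \<in> Lp_fun T p" using diff[of N0 N0 1] N0 by auto
  then have v: "v \<in> Lp_fun T p" using Lp_fun_diff(1)[OF p0 w, of "\<lambda>t. w N0 t - v t" N0] by simp
  have "(\<lambda>n. Lp_int T p (\<lambda>t. w n t - v t)) \<longlonglongrightarrow> 0"
  proof (rule LIMSEQ_I)
    fix e :: real assume e: "e > 0"
    obtain N where N: "\<And>i j. i \<ge> N \<Longrightarrow> j \<ge> N \<Longrightarrow> Lp_int T p (\<lambda>t. w i t - w j t) < e / 2"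
      using Cauchy[of "e / 2"] e by auto
    have "norm (Lp_int T p (\<lambda>t. w n t - v t) - 0) < e" if "n \<ge> N" for n
      using diff[of N n "e / 2"] N that e by auto
    then show "\<exists>N. \<forall>n\<ge>N. norm (Lp_int T p (\<lambda>t. w n t - v t) - 0) < e" by blast
  qed
  then show ?thesis using that v by blast
qed

section \<open>Riemann-Liouville integrals\<close>

text \<open>For b = t and e < 0 the integrand is unbounded at t, but e > -1 makes the antiderivative
  continuous up to the endpoint. So the fundamental theorem that asks for a derivative only in the
  interior applies, and nonnegativity turns the result into absolute integrability.\<close>

lemma set_lebesgue_integral_powr_segment:
  fixes a b t e :: real
  assumes "a \<le> b" "b \<le> t" "e > -1"
  shows "set_integrable lebesgue {a..b} (\<lambda>r. (t - r) powr e)"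
    and "(LINT r:{a..b}|lebesgue. (t - r) powr e) = ((t - a) powr (e + 1) - (t - b) powr (e + 1)) / (e + 1)"
proof -
  have 1: "((\<lambda>r. (t - r) powr e) has_integral
      (- ((t - b) powr (e + 1) / (e + 1)) - (- ((t - a) powr (e + 1) / (e + 1))))) {a..b}"
  proof (rule fundamental_theorem_of_calculus_interior)
    show "continuous_on {a..b} (\<lambda>r. - ((t - r) powr (e + 1) / (e + 1)))"
      using assms by (intro continuous_intros continuous_on_powr') auto
    fix r assume "r \<in> {a<..<b}"
    then have "((\<lambda>r. (t - r) powr (e + 1)) has_real_derivative (e + 1) * (t - r) powr (e + 1 - 1) * (0 - 1)) (at r)"
      using assms by (intro DERIV_chain2[OF has_real_derivative_powr]) (auto intro!: derivative_eq_intros)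
    from DERIV_minus[OF DERIV_cdivide[OF this, of "e + 1"]]
    have "((\<lambda>r. - ((t - r) powr (e + 1) / (e + 1))) has_real_derivative (t - r) powr e) (at r)"
      using assms by simp
    then show "((\<lambda>r. - ((t - r) powr (e + 1) / (e + 1))) has_vector_derivative (t - r) powr e) (at r)"
      by (simp add: has_real_derivative_iff_has_vector_derivative)
  qed (use assms in auto)
  then show 2: "set_integrable lebesgue {a..b} (\<lambda>r. (t - r) powr e)"
    by (intro nonnegative_absolutely_integrable_1) auto
  show "(LINT r:{a..b}|lebesgue. (t - r) powr e) = ((t - a) powr (e + 1) - (t - b) powr (e + 1)) / (e + 1)"
    using set_lebesgue_integral_eq_integral(2)[OF 2] integral_unique[OF 1] by (simp add: diff_divide_distrib)
qed

text \<open>Extension by zero moves the variable endpoint t from the domain into the integrand,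
  which makes kernels for different t comparable and jointly measurable. On the diagonal r = t the
  value is 0, since \<open>0 powr _\<close> is 0 for every exponent.\<close>

definition RL_kernel :: "real \<Rightarrow> real \<Rightarrow> real \<Rightarrow> real" where
  "RL_kernel \<gamma> t r = (if 0 \<le> r \<and> r \<le> t then (t - r) powr (\<gamma> - 1) else 0)"

lemma RL_kernel_measurable [measurable]:
  "case_prod (RL_kernel \<gamma>) \<in> borel_measurable (borel \<Otimes>\<^sub>M borel)"
  unfolding RL_kernel_def by measurable

lemma RL_kernel_measurable1 [measurable]: "RL_kernel \<gamma> t \<in> borel_measurable borel"
  unfolding RL_kernel_def by measurable

lemma RL_kernel_zero: "RL_kernel \<gamma> 0 r = 0"
  by (auto simp: RL_kernel_def)

lemma RL_left_kernel: "RL_left \<gamma> w t = 1 / Gamma \<gamma> * (LINT r|lebesgue. RL_kernel \<gamma> t r * w r)"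
  unfolding RL_left_def set_lebesgue_integral_def
  by (intro arg_cong2[where f = "(*)"] refl Bochner_Integration.integral_cong) (auto simp: RL_kernel_def)

lemma RL_left_kernel_on:
  assumes "t \<le> T"
  shows "RL_left \<gamma> w t = 1 / Gamma \<gamma> * (LINT r|lebesgue_on {0..T}. RL_kernel \<gamma> t r * w r)"
proof -
  have "(LINT r|lebesgue_on {0..T}. RL_kernel \<gamma> t r * w r) = (LINT r|lebesgue. RL_kernel \<gamma> t r * w r)"
    using assms by (subst integral_restrict_space) (auto simp: RL_kernel_def indicator_def intro!: Bochner_Integration.integral_cong)
  then show ?thesis by (simp add: RL_left_kernel)
qed

section \<open>Hoelder continuity of fractional integrals\<close>

lemma powr_superadditive:
  fixes u v q :: real
  assumes "0 \<le> u" "0 \<le> v" "1 \<le> q"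
  shows "u powr q + v powr q \<le> (u + v) powr q"
proof -
  have split: "x powr q = x * x powr (q - 1)" if "x \<ge> 0" for x
    using that by (cases "x = 0") (auto simp: powr_diff)
  have "u powr q + v powr q \<le> u * (u + v) powr (q - 1) + v * (u + v) powr (q - 1)"
    unfolding split[OF assms(1)] split[OF assms(2)]
    using assms by (intro add_mono mult_left_mono powr_mono2) auto
  also have "\<dots> = (u + v) powr q" using assms by (simp add: split algebra_simps)
  finally show ?thesis .
qed

lemma AE_lebesgue_on_neq: "AE r in lebesgue_on S. r \<noteq> (s::real)" if "S \<in> sets lebesgue"
proof -
  have "AE r in lebesgue. r \<noteq> s" by (intro AE_completion AE_lborel_singleton)
  then show ?thesis using that by (subst AE_restrict_space_iff) auto
qed

text \<open>For r < s the kernel decreases in its first argument, and superadditivity of the q-th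
  power gives (x - y)^q <= x^q - y^q, which can be integrated explicitly. The parts over [0, s] and
  [s, t] each contribute at most (t - s)^c / c; hence the factor 2.\<close>

lemma RL_kernel_diff_powr:
  assumes "0 < \<gamma>" "\<gamma> \<le> 1" "1 \<le> q" "0 < (\<gamma> - 1) * q + 1" "0 \<le> s" "s \<le> t" "t \<le> T"
  defines "c \<equiv> (\<gamma> - 1) * q + 1"
  shows "integrable (lebesgue_on {0..T}) (\<lambda>r. \<bar>RL_kernel \<gamma> t r - RL_kernel \<gamma> s r\<bar> powr q)"
    and "(LINT r|lebesgue_on {0..T}. \<bar>RL_kernel \<gamma> t r - RL_kernel \<gamma> s r\<bar> powr q) \<le> 2 * (t - s) powr c / c"
proof -
  define e where "e = (\<gamma> - 1) * q"
  have e: "e > -1" "c = e + 1" "c > 0" using assms by (auto simp: e_def c_def)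
  define h where "h r = indicator {0..s} r * ((s - r) powr e - (t - r) powr e) + indicator {s..t} r * (t - r) powr e" for r
  note i1 = set_lebesgue_integral_powr_segment[of 0 s s e, OF \<open>0 \<le> s\<close> order_refl e(1)]
  note i2 = set_lebesgue_integral_powr_segment[of 0 s t e, OF \<open>0 \<le> s\<close> \<open>s \<le> t\<close> e(1)]
  note i3 = set_lebesgue_integral_powr_segment[of s t t e, OF \<open>s \<le> t\<close> order_refl e(1)]
  have ih: "integrable lebesgue h" "integral\<^sup>L lebesgue h \<le> 2 * (t - s) powr c / c"
  proof -
    have h_eq: "h = (\<lambda>r. (indicator {0..s} r *\<^sub>R (s - r) powr e - indicator {0..s} r *\<^sub>R (t - r) powr e)
        + indicator {s..t} r *\<^sub>R (t - r) powr e)"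
      by (auto simp: h_def fun_eq_iff algebra_simps)
    note ints = i1(1)[unfolded set_integrable_def] i2(1)[unfolded set_integrable_def] i3(1)[unfolded set_integrable_def]
    show "integrable lebesgue h" unfolding h_eq by (intro Bochner_Integration.integrable_add Bochner_Integration.integrable_diff ints)
    have "integral\<^sup>L lebesgue h = (s powr c - 0) / c - (t powr c - (t - s) powr c) / c + (t - s) powr c / c"
      unfolding h_eq
      using i1(2) i2(2) i3(2) ints e by (simp add: set_lebesgue_integral_def)
    also have "\<dots> = 2 * (t - s) powr c / c + (s powr c - t powr c) / c" by (simp add: add_divide_distrib diff_divide_distrib)
    also have "(s powr c - t powr c) / c \<le> 0"
      using assms e powr_mono2[of c s t] by (simp add: divide_le_0_iff)
    finally show "integral\<^sup>L lebesgue h \<le> 2 * (t - s) powr c / c" by simp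
  qed
  have h_out: "indicator {0..T} r *\<^sub>R h r = h r" for r
    using assms by (auto simp: h_def indicator_def)
  have ih': "integrable (lebesgue_on {0..T}) h" "integral\<^sup>L (lebesgue_on {0..T}) h = integral\<^sup>L lebesgue h"
    using ih(1) by (simp_all add: integrable_restrict_space integral_restrict_space h_out del: real_scaleR_def)
  \<comment> \<open>At r = s < t the bound fails: both indicators are 1, \<open>0 powr e\<close> is
    0, and the two remaining terms of \<open>h\<close> cancel. A single point is a null set.\<close>
  have bound: "\<bar>RL_kernel \<gamma> t r - RL_kernel \<gamma> s r\<bar> powr q \<le> h r" if "r \<noteq> s" for r
  proof -
    consider "r < 0 \<or> r > t" | "s < r" "r \<le> t" | "0 \<le> r" "r < s" using \<open>r \<noteq> s\<close> by linarith
    then show ?thesis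
    proof cases
      case 1
      then show ?thesis using assms by (auto simp: RL_kernel_def h_def indicator_def)
    next
      case 2
      then show ?thesis using assms by (auto simp: RL_kernel_def h_def indicator_def powr_powr e_def)
    next
      case 3
      define x where "x = (s - r) powr (\<gamma> - 1)"
      define y where "y = (t - r) powr (\<gamma> - 1)"
      have xy: "0 \<le> y" "y \<le> x" using 3 assms by (auto simp: x_def y_def intro!: powr_mono2')
      have "\<bar>RL_kernel \<gamma> t r - RL_kernel \<gamma> s r\<bar> = x - y" using 3 assms xy by (auto simp: RL_kernel_def x_def y_def)
      moreover have "h r = x powr q - y powr q" using 3 by (auto simp: h_def x_def y_def powr_powr e_def)
      moreover have "(x - y) powr q + y powr q \<le> x powr q"
        using powr_superadditive[of "x - y" y q] xy assms by simp
      ultimately show ?thesis by simp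
    qed
  qed
  have AEb: "AE r in lebesgue_on {0..T}. \<bar>RL_kernel \<gamma> t r - RL_kernel \<gamma> s r\<bar> powr q \<le> h r"
    using AE_lebesgue_on_neq[of "{0..T}" s] by (auto elim!: eventually_mono intro: bound)
  have [measurable]: "RL_kernel \<gamma> t' \<in> borel_measurable (lebesgue_on {0..T})" for t'
    using RL_kernel_measurable1 by (intro measurable_restrict_space1 measurable_completion) simp
  show int: "integrable (lebesgue_on {0..T}) (\<lambda>r. \<bar>RL_kernel \<gamma> t r - RL_kernel \<gamma> s r\<bar> powr q)"
    by (rule Bochner_Integration.integrable_bound[OF ih'(1)]) (use AEb in \<open>auto elim!: eventually_mono\<close>)
  show "(LINT r|lebesgue_on {0..T}. \<bar>RL_kernel \<gamma> t r - RL_kernel \<gamma> s r\<bar> powr q) \<le> 2 * (t - s) powr c / c"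
    using integral_mono_AE[OF int ih'(1) AEb] ih(2) ih'(2) by simp
qed

lemma RL_left_at_0 [simp]: "RL_left \<gamma> w 0 = 0"
  by (simp add: RL_left_kernel RL_kernel_zero)

text \<open>With q = p/(p-1) and c = (gamma-1) q + 1 this is (2/c)^(1/q) / Gamma(gamma): the L^q
  bound of \<open>RL_kernel_diff_powr\<close> divided by the normalization of the fractional
  integral.\<close>

definition RL_const :: "real \<Rightarrow> real \<Rightarrow> real" where
  "RL_const \<gamma> p = (2 / ((\<gamma> - 1) * (p / (p - 1)) + 1)) powr (1 - 1 / p) / Gamma \<gamma>"

lemma RL_const_nonneg: "\<gamma> > 0 \<Longrightarrow> RL_const \<gamma> p \<ge> 0"
  by (simp add: RL_const_def Gamma_real_nonneg)

text \<open>Hoelder's inequality with the kernel difference in L^q and w in L^p. The Hoelder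
  exponent gamma - 1/p arises as c / q. Integrability for a single kernel is the case s = 0, where
  the subtracted kernel vanishes.\<close>

lemma RL_kernel_integrable:
  assumes "1 < p" "1 / p < \<gamma>" "\<gamma> \<le> 1" "w \<in> Lp_fun T p" "t \<in> {0..T}"
  shows "integrable (lebesgue_on {0..T}) (\<lambda>r. RL_kernel \<gamma> t r * w r)"
  and RL_left_Hoelder_aux: "s \<in> {0..t} \<Longrightarrow> \<bar>RL_left \<gamma> w t - RL_left \<gamma> w s\<bar>
     \<le> RL_const \<gamma> p * (t - s) powr (\<gamma> - 1 / p) * Lp_int T p w powr (1 / p)"
proof -
  define q where "q = p / (p - 1)"
  have pq: "1 < q" "1 / q + 1 / p = 1" "1 / q = 1 - 1 / p" using assms by (auto simp: q_def field_simps)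
  define c where "c = (\<gamma> - 1) * q + 1"
  \<comment> \<open>Written as q (gamma - 1/p), positivity of c is exactly the condition gamma >
    1/p.\<close>
  have "c = q * (\<gamma> - 1 + 1 / q)" using pq by (simp add: c_def algebra_simps)
  then have c: "c = q * (\<gamma> - 1 / p)" using pq by simp
  then have c0: "c > 0" using assms pq by simp
  have R: "RL_const \<gamma> p = (2 / c) powr (1 / q) / Gamma \<gamma>"
    unfolding RL_const_def c_def pq(3) q_def[symmetric] ..
  have \<gamma>: "\<gamma> > 0" using assms by (meson less_trans zero_less_divide_1_iff zero_less_one)
  have [measurable]: "RL_kernel \<gamma> t' \<in> borel_measurable (lebesgue_on {0..T})" for t'
    using RL_kernel_measurable1 by (intro measurable_restrict_space1 measurable_completion) simp
  have *: "integrable (lebesgue_on {0..T}) (\<lambda>r. \<bar>RL_kernel \<gamma> t r - RL_kernel \<gamma> s r\<bar> powr q)"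
    "(LINT r|lebesgue_on {0..T}. \<bar>RL_kernel \<gamma> t r - RL_kernel \<gamma> s r\<bar> powr q) \<le> 2 * (t - s) powr c / c"
    if "s \<in> {0..t}" "t \<in> {0..T}" for s t
    using RL_kernel_diff_powr[of \<gamma> q s t T] that assms pq \<gamma> c0 by (auto simp: c_def)
  note H = Hoelder_integrable[OF pq(1) assms(1) pq(2)] Hoelder_inequality[OF pq(1) assms(1) pq(2)]
  have int: "integrable (lebesgue_on {0..T}) (\<lambda>r. RL_kernel \<gamma> t r * w r)" if "t \<in> {0..T}" for t
    using H(1)[of "RL_kernel \<gamma> t" "lebesgue_on {0..T}" w] *(1)[of 0 t] that Lp_funD[OF assms(4)]
    by (simp add: RL_kernel_zero)
  from int[OF assms(5)] show "integrable (lebesgue_on {0..T}) (\<lambda>r. RL_kernel \<gamma> t r * w r)" .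
  assume s: "s \<in> {0..t}"
  let ?k = "\<lambda>r. RL_kernel \<gamma> t r - RL_kernel \<gamma> s r"
  have "RL_left \<gamma> w t - RL_left \<gamma> w s = 1 / Gamma \<gamma> * ((LINT r|lebesgue_on {0..T}. RL_kernel \<gamma> t r * w r)
      - (LINT r|lebesgue_on {0..T}. RL_kernel \<gamma> s r * w r))"
    using s assms by (simp add: RL_left_kernel_on[of _ T] diff_divide_distrib)
  also have "\<dots> = 1 / Gamma \<gamma> * (LINT r|lebesgue_on {0..T}. ?k r * w r)"
    using s assms int[of s] int[of t] by (simp add: algebra_simps)
  finally have "\<bar>RL_left \<gamma> w t - RL_left \<gamma> w s\<bar> = 1 / Gamma \<gamma> * \<bar>LINT r|lebesgue_on {0..T}. ?k r * w r\<bar>"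
    using Gamma_real_pos[OF \<gamma>] by (simp add: abs_mult)
  also have "\<bar>LINT r|lebesgue_on {0..T}. ?k r * w r\<bar> \<le> (LINT r|lebesgue_on {0..T}. \<bar>?k r * w r\<bar>)"
    by (rule integral_abs_bound)
  also have "\<dots> \<le> (LINT r|lebesgue_on {0..T}. \<bar>?k r\<bar> powr q) powr (1 / q) * Lp_int T p w powr (1 / p)"
    unfolding Lp_int_def by (rule H(2)) (use *(1)[OF s assms(5)] Lp_funD[OF assms(4)] in auto)
  also have "\<dots> \<le> (2 * (t - s) powr c / c) powr (1 / q) * Lp_int T p w powr (1 / p)"
    using *(2)[OF s assms(5)] pq(1) by (intro mult_right_mono powr_mono2) auto
  also have "(2 * (t - s) powr c / c) powr (1 / q) = ((2 / c) * (t - s) powr c) powr (1 / q)" by simp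
  also have "\<dots> = (2 / c) powr (1 / q) * (t - s) powr (c / q)" using c0 by (subst powr_mult) (auto simp: powr_powr)
  also have "c / q = \<gamma> - 1 / p" using c pq by simp
  also have "1 / Gamma \<gamma> * ((2 / c) powr (1 / q) * (t - s) powr (\<gamma> - 1 / p) * Lp_int T p w powr (1 / p))
     = RL_const \<gamma> p * (t - s) powr (\<gamma> - 1 / p) * Lp_int T p w powr (1 / p)"
    by (simp add: R)
  finally show "\<bar>RL_left \<gamma> w t - RL_left \<gamma> w s\<bar>
     \<le> RL_const \<gamma> p * (t - s) powr (\<gamma> - 1 / p) * Lp_int T p w powr (1 / p)"
    using Gamma_real_pos[OF \<gamma>] by (simp add: divide_right_mono mult_left_mono)
qed

lemma RL_left_Hoelder:
  assumes "1 < p" "1 / p < \<gamma>" "\<gamma> \<le> 1" "w \<in> Lp_fun T p" "t \<in> {0..T}" "s \<in> {0..T}"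
  shows "\<bar>RL_left \<gamma> w t - RL_left \<gamma> w s\<bar>
     \<le> RL_const \<gamma> p * \<bar>t - s\<bar> powr (\<gamma> - 1 / p) * Lp_int T p w powr (1 / p)"
proof (cases "s \<le> t")
  case True
  then show ?thesis using RL_left_Hoelder_aux[OF assms(1-5), of s] assms by simp
next
  case False
  then show ?thesis using RL_left_Hoelder_aux[OF assms(1-4,6), of t] assms by (simp add: abs_minus_commute)
qed

lemma RL_left_bound:
  assumes "1 < p" "1 / p < \<gamma>" "\<gamma> \<le> 1" "w \<in> Lp_fun T p" "t \<in> {0..T}"
  shows "\<bar>RL_left \<gamma> w t\<bar> \<le> RL_const \<gamma> p * T powr (\<gamma> - 1 / p) * Lp_int T p w powr (1 / p)"
proof -
  have "\<gamma> > 0" using assms by (meson less_trans zero_less_divide_1_iff zero_less_one)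
  then have R: "RL_const \<gamma> p \<ge> 0" by (rule RL_const_nonneg)
  have "\<bar>RL_left \<gamma> w t\<bar> \<le> RL_const \<gamma> p * t powr (\<gamma> - 1 / p) * Lp_int T p w powr (1 / p)"
    using RL_left_Hoelder[OF assms, of 0] assms by simp
  also have "\<dots> \<le> RL_const \<gamma> p * T powr (\<gamma> - 1 / p) * Lp_int T p w powr (1 / p)"
    using assms R by (intro mult_right_mono mult_left_mono powr_mono2) auto
  finally show ?thesis .
qed

lemma RL_left_continuous:
  assumes "1 < p" "1 / p < \<gamma>" "\<gamma> \<le> 1" "w \<in> Lp_fun T p"
  shows "continuous_on {0..T} (RL_left \<gamma> w)"
  unfolding continuous_on_def
proof
  fix s assume s: "s \<in> {0..T}"
  have "((\<lambda>t. RL_const \<gamma> p * \<bar>t - s\<bar> powr (\<gamma> - 1 / p) * Lp_int T p w powr (1 / p)) \<longlongrightarrow>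
     RL_const \<gamma> p * \<bar>s - s\<bar> powr (\<gamma> - 1 / p) * Lp_int T p w powr (1 / p)) (at s within {0..T})"
    using assms by (intro tendsto_intros tendsto_powr2) auto
  then have "((\<lambda>t. RL_const \<gamma> p * \<bar>t - s\<bar> powr (\<gamma> - 1 / p) * Lp_int T p w powr (1 / p)) \<longlongrightarrow> 0)
      (at s within {0..T})" by simp
  then have "((\<lambda>t. RL_left \<gamma> w t - RL_left \<gamma> w s) \<longlongrightarrow> 0) (at s within {0..T})"
    by (rule Lim_null_comparison[rotated])
      (use RL_left_Hoelder[OF assms _ s] in \<open>auto simp: eventually_at_filter\<close>)
  then show "(RL_left \<gamma> w \<longlongrightarrow> RL_left \<gamma> w s) (at s within {0..T})" by (simp add: LIM_zero_iff)
qed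

section \<open>Composing fractional integrals of complementary orders\<close>

lemma RL_kernel_nonneg: "0 \<le> RL_kernel \<gamma> t r"
  by (simp add: RL_kernel_def)

text \<open>The substitution s = r + (t - r) x leads to the Beta integral B(gamma, 1 - gamma). The
  powers of t - r from the two kernels combine to 1 / (t - r) and cancel the Jacobian, so the value
  depends on neither r nor t.\<close>

lemma has_bochner_integral_Beta:
  assumes "0 < \<gamma>" "\<gamma> < 1" "0 \<le> r" "r < t"
  shows "has_bochner_integral lborel (\<lambda>s. RL_kernel (1 - \<gamma>) t s * RL_kernel \<gamma> s r) (Gamma \<gamma> * Gamma (1 - \<gamma>))"
proof -
  define h where "h x = (if x \<in> {0..1} then x powr (\<gamma> - 1) * (1 - x) powr (- \<gamma>) else 0)" for x :: real
  have [measurable]: "h \<in> borel_measurable borel" unfolding h_def by measurable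
  have "((\<lambda>x. x powr (\<gamma> - 1) * (1 - x) powr (- \<gamma>)) has_integral Gamma \<gamma> * Gamma (1 - \<gamma>)) {0..1}"
    using has_integral_Beta_real[of \<gamma> "1 - \<gamma>"] assms by (simp add: Beta_def)
  then have "(h has_integral Gamma \<gamma> * Gamma (1 - \<gamma>)) UNIV"
    unfolding h_def by (simp only: has_integral_restrict_UNIV)
  moreover have "0 \<le> h x" for x by (simp add: h_def)
  ultimately have "integral\<^sup>N lborel h = Gamma \<gamma> * Gamma (1 - \<gamma>)"
    by (intro nn_integral_has_integral_lborel) auto
  then have h: "has_bochner_integral lborel h (Gamma \<gamma> * Gamma (1 - \<gamma>))"
    by (intro has_bochner_integral_nn_integral) (use assms in \<open>auto simp: h_def intro!: Gamma_real_nonneg\<close>)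
  have "RL_kernel (1 - \<gamma>) t (r + (t - r) * x) * RL_kernel \<gamma> (r + (t - r) * x) r = h x / (t - r)" for x
  proof (cases "x \<in> {0..1}")
    case True
    have "t - (r + (t - r) * x) = (t - r) * (1 - x)" by (simp add: algebra_simps)
    moreover have "0 \<le> (t - r) * (1 - x)" "0 \<le> (t - r) * x" using True assms by simp_all
    ultimately have "RL_kernel (1 - \<gamma>) t (r + (t - r) * x) = ((t - r) * (1 - x)) powr (- \<gamma>)"
      "RL_kernel \<gamma> (r + (t - r) * x) r = ((t - r) * x) powr (\<gamma> - 1)"
      using assms by (simp_all add: RL_kernel_def)
    moreover have "(t - r) powr (- \<gamma>) * (t - r) powr (\<gamma> - 1) = 1 / (t - r)"
      unfolding powr_add[symmetric] using assms by (simp add: powr_minus_divide)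
    moreover have "((t - r) * (1 - x)) powr (- \<gamma>) * ((t - r) * x) powr (\<gamma> - 1)
      = ((t - r) powr (- \<gamma>) * (t - r) powr (\<gamma> - 1)) * (x powr (\<gamma> - 1) * (1 - x) powr (- \<gamma>))"
      using True assms by (simp add: powr_mult)
    ultimately show ?thesis using True by (simp add: h_def)
  next
    case False
    have "\<not> r + (t - r) * x \<le> t \<or> \<not> 0 \<le> (t - r) * x"
    proof (cases "x < 0")
      case True
      then show ?thesis using assms by (simp add: zero_le_mult_iff)
    next
      case False': False
      then have "(t - r) * 1 < (t - r) * x" using False assms by (intro mult_strict_left_mono) auto
      then show ?thesis by auto
    qed
    then show ?thesis using False by (auto simp: RL_kernel_def h_def)
  qed
  then show ?thesis
    using has_bochner_integral_divide_zero[OF h, of "t - r"] assms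
    by (subst lborel_has_bochner_integral_real_affine_iff[where c = "t - r" and t = r]) (auto simp: divide_inverse mult.commute)
qed

text \<open>
  Fubini reduces the composition of the two fractional integrals to the Beta integral. Product
  measurability is only available for Borel functions, hence the passage to a Borel representative.
\<close>

lemma RL_left_RL_left:
  assumes \<gamma>: "0 < \<gamma>" "\<gamma> < 1" and w: "integrable (lebesgue_on {0..T}) w" and t: "t \<in> {0..T}"
  shows "RL_left (1 - \<gamma>) (RL_left \<gamma> w) t = (LINT r:{0..t}|lebesgue. w r)"
proof -
  have iw: "integrable lebesgue (\<lambda>r. indicator {0..T} r *\<^sub>R w r)"
    using w by (subst (asm) integrable_restrict_space) auto
  note mw = borel_measurable_integrable[OF iw]
  note [measurable] = mw mw[unfolded real_scaleR_def]
  obtain v where v[measurable]: "v \<in> borel_measurable borel"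
    and v_eq: "AE r in lebesgue. indicator {0..T} r *\<^sub>R w r = v r"
    using mw completion_ex_borel_measurable_real[of "\<lambda>r. indicator {0..T} r *\<^sub>R w r" lborel]
    by (auto dest: AE_completion)
  have mv[measurable]: "v \<in> borel_measurable lebesgue" using v by (simp add: measurable_completion)
  have mk[measurable]: "RL_kernel g s \<in> borel_measurable lebesgue" for g s by (simp add: measurable_completion)
  have "integrable lebesgue v"
    using w v_eq by (subst integrable_cong_AE[where g = "\<lambda>r. indicator {0..T} r *\<^sub>R w r"])
      (auto simp: integrable_restrict_space elim!: eventually_mono)
  then have iv: "integrable lborel v" by (simp add: integrable_completion)
  have w_v: "(LINT r|lebesgue. k r * w r) = (LINT r|lborel. k r * v r)"
    if [measurable]: "k \<in> borel_measurable borel" and "\<And>r. r \<notin> {0..T} \<Longrightarrow> k r = 0" for k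
  proof -
    have mk[measurable]: "k \<in> borel_measurable lebesgue" by (simp add: measurable_completion)
    have "(LINT r|lebesgue. k r * w r) = (LINT r|lebesgue. k r * (indicator {0..T} r *\<^sub>R w r))"
      using that(2) by (intro Bochner_Integration.integral_cong) (auto simp: indicator_def)
    also have "\<dots> = (LINT r|lebesgue. k r * v r)"
      using v_eq by (intro integral_cong_AE) (auto elim!: eventually_mono)
    also have "\<dots> = (LINT r|lborel. k r * v r)" by (intro integral_completion) measurable
    finally show ?thesis .
  qed
  define B where "B = Gamma \<gamma> * Gamma (1 - \<gamma>)"
  have B: "B > 0" using \<gamma> by (simp add: B_def Gamma_real_pos)
  have k0: "r \<notin> {0..T} \<Longrightarrow> RL_kernel g s r = 0" if "s \<le> T" for g s r
    using that by (auto simp: RL_kernel_def)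
  have inner: "RL_left \<gamma> w s = 1 / Gamma \<gamma> * (LINT r|lborel. RL_kernel \<gamma> s r * v r)" if "s \<le> T" for s
    using w_v[of "RL_kernel \<gamma> s"] k0[OF that] by (simp add: RL_left_kernel)
  let ?K = "\<lambda>r s. RL_kernel (1 - \<gamma>) t s * RL_kernel \<gamma> s r"
  \<comment> \<open>The indicator is half-open: for r = t the product could be nonzero only at s =
    t, where \<open>0 powr _\<close> is 0. The missing endpoint is restored at the end as a null
    set.\<close>
  have Kint: "has_bochner_integral lborel (?K r) (B * indicator {0..<t} r)" for r
  proof (cases "r \<in> {0..<t}")
    case True
    then show ?thesis using has_bochner_integral_Beta[OF \<gamma>, of r t] by (simp add: B_def)
  next
    case False
    then have "?K r = (\<lambda>_. 0)" using \<gamma> by (auto simp: RL_kernel_def fun_eq_iff)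
    then show ?thesis using False by (simp add: has_bochner_integral_zero)
  qed
  have prod: "integrable (lborel \<Otimes>\<^sub>M lborel) (\<lambda>(r, s). ?K r s * v r)"
  proof (rule lborel_pair.Fubini_integrable)
    show "(\<lambda>(r, s). ?K r s * v r) \<in> borel_measurable (lborel \<Otimes>\<^sub>M lborel)" by measurable
    have "(LINT s|lborel. norm (?K r s * v r)) = B * indicator {0..<t} r * \<bar>v r\<bar>" for r
    proof -
      have "(LINT s|lborel. norm (?K r s * v r)) = (LINT s|lborel. ?K r s * \<bar>v r\<bar>)"
        by (simp add: abs_mult RL_kernel_nonneg)
      then show ?thesis using has_bochner_integral_integral_eq[OF Kint[of r]] by simp
    qed
    moreover have "integrable lborel (\<lambda>r. B * indicator {0..<t} r * \<bar>v r\<bar>)"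
      using integrable_mult_indicator[OF _ integrable_abs[OF iv], of "{0..<t}"] by (simp add: mult.assoc)
    ultimately show "integrable lborel (\<lambda>r. LINT s|lborel. norm (case (r, s) of (r, s) \<Rightarrow> ?K r s * v r))" by simp
    show "AE r in lborel. integrable lborel (\<lambda>s. case (r, s) of (r, s) \<Rightarrow> ?K r s * v r)"
      using Kint by (auto intro!: AE_I2 simp: has_bochner_integral_iff)
  qed
  have "RL_left (1 - \<gamma>) (RL_left \<gamma> w) t
      = 1 / Gamma (1 - \<gamma>) * (LINT s|lebesgue. RL_kernel (1 - \<gamma>) t s * (1 / Gamma \<gamma> * (LINT r|lborel. RL_kernel \<gamma> s r * v r)))"
  proof -
    have "RL_kernel (1 - \<gamma>) t s * RL_left \<gamma> w s
      = RL_kernel (1 - \<gamma>) t s * (1 / Gamma \<gamma> * (LINT r|lborel. RL_kernel \<gamma> s r * v r))" for s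
      using t by (cases "s \<le> t") (simp_all add: inner RL_kernel_def[of _ t s])
    then show ?thesis unfolding RL_left_kernel[of "1 - \<gamma>"] by presburger
  qed
  also have "\<dots> = 1 / Gamma (1 - \<gamma>) * (LINT s|lborel. RL_kernel (1 - \<gamma>) t s * (1 / Gamma \<gamma> * (LINT r|lborel. RL_kernel \<gamma> s r * v r)))"
    by (subst integral_completion) auto
  also have "\<dots> = 1 / B * (LINT s|lborel. LINT r|lborel. ?K r s * v r)"
  proof -
    have "(LINT s|lborel. RL_kernel (1 - \<gamma>) t s * (1 / Gamma \<gamma> * (LINT r|lborel. RL_kernel \<gamma> s r * v r)))
      = (LINT s|lborel. 1 / Gamma \<gamma> * (LINT r|lborel. ?K r s * v r))"
      by (intro Bochner_Integration.integral_cong refl) (simp add: mult.assoc)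
    then show ?thesis using Gamma_real_pos[OF \<gamma>(1)] by (simp add: B_def mult.commute)
  qed
  also have "(LINT s|lborel. LINT r|lborel. ?K r s * v r) = (LINT r|lborel. LINT s|lborel. ?K r s * v r)"
    using lborel_pair.Fubini_integral[of "\<lambda>r s. ?K r s * v r"] prod by simp
  also have "\<dots> = (LINT r|lborel. B * (indicator {0..<t} r * v r))"
  proof -
    have "(LINT s|lborel. ?K r s * v r) = B * (indicator {0..<t} r * v r)" for r
      using has_bochner_integral_integral_eq[OF Kint[of r]] by simp
    then show ?thesis by presburger
  qed
  also have "1 / B * \<dots> = (LINT r|lborel. indicator {0..<t} r * v r)" using B by simp
  also have "\<dots> = (LINT r|lebesgue. indicator {0..<t} r * w r)"
    using t by (subst w_v) (auto simp: indicator_def)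
  also have "\<dots> = (LINT r:{0..t}|lebesgue. w r)"
  proof -
    have [measurable]: "(\<lambda>r. indicator {0..<t} r * w r) \<in> borel_measurable lebesgue"
    proof -
      have "(\<lambda>r. indicator {0..<t} r * (indicator {0..T} r * w r)) \<in> borel_measurable lebesgue"
        by (rule borel_measurable_times[OF borel_measurable_indicator mw[unfolded real_scaleR_def]]) simp
      moreover have "indicator {0..<t} r * (indicator {0..T} r * w r) = indicator {0..<t} r * w r" for r
        using t by (auto simp: indicator_def)
      ultimately show ?thesis by simp
    qed
    have [measurable]: "(\<lambda>r. indicator {0..t} r * w r) \<in> borel_measurable lebesgue"
    proof -
      have "(\<lambda>r. indicator {0..t} r * (indicator {0..T} r * w r)) \<in> borel_measurable lebesgue"
        by (rule borel_measurable_times[OF borel_measurable_indicator mw[unfolded real_scaleR_def]]) simp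
      moreover have "indicator {0..t} r * (indicator {0..T} r * w r) = indicator {0..t} r * w r" for r
        using t by (auto simp: indicator_def)
      ultimately show ?thesis by simp
    qed
    have "AE r in lebesgue. r \<noteq> t" by (intro AE_completion AE_lborel_singleton)
    then have "AE r in lebesgue. indicator {0..<t} r * w r = indicator {0..t} r * w r"
      by eventually_elim (auto simp: indicator_def)
    then show ?thesis unfolding set_lebesgue_integral_def by (simp add: integral_cong_AE)
  qed
  finally show ?thesis .
qed

text \<open>Half-lines form an intersection-stable generator of the Borel sets, so the vanishing of
  the integrals spreads to every Borel set by Dynkin's argument; a function all of whose set
  integrals vanish is zero almost everywhere. This is what makes fractional derivatives
  unique.\<close>

lemma AE_zero_if_integrals_zero:
  fixes w :: "real \<Rightarrow> real"
  assumes w: "integrable (lebesgue_on {0..T}) w"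
    and zero: "\<And>t. t \<in> {0..T} \<Longrightarrow> (LINT r:{0..t}|lebesgue. w r) = 0"
  shows "AE r in lebesgue_on {0..T}. w r = 0"
proof -
  have iw: "integrable lebesgue (\<lambda>r. indicator {0..T} r *\<^sub>R w r)"
    using w by (subst (asm) integrable_restrict_space) auto
  note mw = borel_measurable_integrable[OF iw]
  note [measurable] = mw mw[unfolded real_scaleR_def]
  obtain v where v[measurable]: "v \<in> borel_measurable borel"
    and v_eq: "AE r in lebesgue. indicator {0..T} r *\<^sub>R w r = v r"
    using mw completion_ex_borel_measurable_real[of "\<lambda>r. indicator {0..T} r *\<^sub>R w r" lborel]
    by (auto dest: AE_completion)
  have mv[measurable]: "v \<in> borel_measurable lebesgue" using v by (simp add: measurable_completion)
  have "integrable lebesgue v"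
    using w v_eq by (subst integrable_cong_AE[where g = "\<lambda>r. indicator {0..T} r *\<^sub>R w r"])
      (auto simp: integrable_restrict_space elim!: eventually_mono)
  then have iv: "integrable lborel v" by (simp add: integrable_completion)
  have sv: "set_integrable lborel A v" if "A \<in> sets borel" for A
    unfolding set_integrable_def using that by (intro integrable_mult_indicator iv) auto
  have eq: "(LINT r:A|lborel. v r) = (LINT r|lebesgue. indicator (A \<inter> {0..T}) r *\<^sub>R w r)"
    if [measurable]: "A \<in> sets borel" for A
  proof -
    have [measurable]: "A \<in> sets lebesgue" by (simp add: sets_completionI_sets)
    have "(LINT r:A|lborel. v r) = (LINT r|lebesgue. indicator A r *\<^sub>R v r)"
      unfolding set_lebesgue_integral_def by (subst integral_completion) auto
    also have "\<dots> = (LINT r|lebesgue. indicator A r *\<^sub>R (indicator {0..T} r *\<^sub>R w r))"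
      using v_eq by (intro integral_cong_AE) (auto elim!: eventually_mono)
    finally show ?thesis by (simp add: indicator_inter_arith mult.assoc)
  qed
  have total: "(LINT r:UNIV|lborel. v r) = 0"
  proof (cases "T \<ge> 0")
    case True
    then show ?thesis using zero[of T] eq[of UNIV] by (simp add: set_lebesgue_integral_def)
  qed (simp add: eq)
  have "(LINT r:A|lborel. v r) = 0" if "A \<in> sets borel" for A
  proof -
    have A: "A \<in> sigma_sets UNIV (range atMost)" using that by (simp add: borel_eq_atMost)
    have sets_eq: "sigma_sets UNIV (range atMost) = sets (borel :: real measure)" by (simp add: borel_eq_atMost)
    have "Int_stable (range (atMost :: real \<Rightarrow> _))" by (auto simp: Int_stable_def)
    moreover have "range (atMost :: real \<Rightarrow> _) \<subseteq> Pow UNIV" by simp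
    ultimately show ?thesis using A
    proof (induction rule: sigma_sets_induct_disjoint)
      case (basic A)
      then obtain x :: real where A: "A = {..x}" by auto
      consider "x < 0" | "x \<in> {0..T}" | "x > T" "x \<ge> 0" by fastforce
      then show ?case
      proof cases
        case 1
        then have "A \<inter> {0..T} = {}" by (auto simp: A)
        then show ?thesis using A by (simp add: eq)
      next
        case 2
        then have AT: "A \<inter> {0..T} = {0..x}" by (auto simp: A)
        have "(LINT r:A|lborel. v r) = (LINT r|lebesgue. indicator {0..x} r *\<^sub>R w r)"
          by (subst AT[symmetric], rule eq) (simp add: A)
        then show ?thesis using zero[OF 2] by (simp add: set_lebesgue_integral_def)
      next
        case 3
        then have AT: "A \<inter> {0..T} = UNIV \<inter> {0..T}" by (auto simp: A)
        have "(LINT r:A|lborel. v r) = (LINT r|lebesgue. indicator (UNIV \<inter> {0..T}) r *\<^sub>R w r)"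
          by (subst AT[symmetric], rule eq) (simp add: A)
        also have "\<dots> = (LINT r:UNIV|lborel. v r)" by (rule eq[symmetric]) simp
        finally show ?thesis using total by simp
      qed
    next
      case empty
      then show ?case by (simp add: set_lebesgue_integral_def)
    next
      case (compl A)
      then have [measurable]: "A \<in> sets borel" by (simp add: sets_eq)
      have "(LINT r:(UNIV - A) \<union> A|lborel. v r) = (LINT r:UNIV - A|lborel. v r) + (LINT r:A|lborel. v r)"
        by (rule set_integral_Un) (auto intro!: sv)
      then show ?case using total compl by (simp add: Un_commute)
    next
      case (union A)
      then have [measurable]: "A i \<in> sets borel" for i by (auto simp: sets_eq)
      have "(LINT r:(\<Union>i. A i)|lborel. v r) = (\<Sum>i. (LINT r:A i|lborel. v r))"
        using union by (intro lebesgue_integral_countable_add sv) (auto simp: disjoint_family_on_def)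
      then show ?case using union by simp
    qed
  qed
  then have "AE r in lborel. v r = 0"
    using density_unique_real[OF iv, of "\<lambda>_. 0"] by (simp add: set_lebesgue_integral_def)
  then have "AE r in lebesgue. v r = 0" by (rule AE_completion)
  with v_eq have "AE r in lebesgue. r \<in> {0..T} \<longrightarrow> w r = 0" by eventually_elim auto
  then show ?thesis by (subst AE_restrict_space_iff) auto
qed

section \<open>The fractional derivative space\<close>

lemma RL_left_cong:
  assumes "\<And>s. s \<in> {0..t} \<Longrightarrow> u s = v s"
  shows "RL_left \<gamma> u t = RL_left \<gamma> v t"
proof -
  have "RL_kernel \<gamma> t s * u s = RL_kernel \<gamma> t s * v s" for s
    using assms[of s] by (cases "s \<in> {0..t}") (auto simp: RL_kernel_def)
  then show ?thesis unfolding RL_left_kernel by presburger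
qed

lemma RL_left_linear:
  assumes "1 < p" "1 / p < \<gamma>" "\<gamma> \<le> 1" "u \<in> Lp_fun T p" "v \<in> Lp_fun T p" "t \<in> {0..T}"
  shows "RL_left \<gamma> (\<lambda>s. a * u s + b * v s) t = a * RL_left \<gamma> u t + b * RL_left \<gamma> v t"
proof -
  note i = RL_kernel_integrable[OF assms(1-3,4,6)] RL_kernel_integrable[OF assms(1-3,5,6)]
  have "(LINT r|lebesgue_on {0..T}. RL_kernel \<gamma> t r * (a * u r + b * v r))
     = (LINT r|lebesgue_on {0..T}. a * (RL_kernel \<gamma> t r * u r) + b * (RL_kernel \<gamma> t r * v r))"
    by (intro Bochner_Integration.integral_cong refl) (simp add: algebra_simps)
  also have "\<dots> = a * (LINT r|lebesgue_on {0..T}. RL_kernel \<gamma> t r * u r)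
      + b * (LINT r|lebesgue_on {0..T}. RL_kernel \<gamma> t r * v r)"
    using i by simp
  finally show ?thesis using assms by (simp add: RL_left_kernel_on[of t T] add_divide_distrib)
qed

lemma RL_left_1:
  fixes w :: "real \<Rightarrow> real"
  assumes "integrable (lebesgue_on {0..T}) w" "t \<in> {0..T}"
  shows "RL_left 1 w t = (LINT r:{0..t}|lebesgue. w r)"
proof -
  have "integrable lebesgue (\<lambda>r. indicator {0..T} r *\<^sub>R w r)"
    using assms by (subst (asm) integrable_restrict_space) auto
  then have m: "(\<lambda>r. indicator {0..T} r * w r) \<in> borel_measurable lebesgue"
    by (auto dest: borel_measurable_integrable)
  have [measurable]: "(\<lambda>r. indicator {0..t} r * w r) \<in> borel_measurable lebesgue"
  proof -
    have "(\<lambda>r. indicator {0..t} r * (indicator {0..T} r * w r)) \<in> borel_measurable lebesgue"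
      by (rule borel_measurable_times[OF borel_measurable_indicator m]) simp
    moreover have "indicator {0..t} r * (indicator {0..T} r * w r) = indicator {0..t} r * w r" for r
      using assms by (auto simp: indicator_def)
    ultimately show ?thesis by simp
  qed
  have mk[measurable]: "RL_kernel g s \<in> borel_measurable lebesgue" for g s by (simp add: measurable_completion)
  \<comment> \<open>The kernel of order 1 equals 1 on [0, t) but 0 at r = t, because
    \<open>0 powr 0\<close> is 0.\<close>
  have "AE r in lebesgue. r \<noteq> t" by (intro AE_completion AE_lborel_singleton)
  then have "AE r in lebesgue. RL_kernel 1 t r * (indicator {0..t} r * w r) = indicator {0..t} r * w r"
    by eventually_elim (auto simp: indicator_def RL_kernel_def)
  then have "(LINT r|lebesgue. RL_kernel 1 t r * (indicator {0..t} r * w r)) = (LINT r|lebesgue. indicator {0..t} r * w r)"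
    by (intro integral_cong_AE) auto
  moreover have "RL_kernel 1 t r * (indicator {0..t} r * w r) = RL_kernel 1 t r * w r" for r
    by (auto simp: RL_kernel_def)
  ultimately show ?thesis by (simp add: RL_left_kernel set_lebesgue_integral_def)
qed

text \<open>On functions vanishing at \<open>0\<close> the Riemann-Liouville derivative equals the Caputo derivative,
  which is \<open>Caputo \<alpha> u'\<close>.\<close>

definition Caputo :: "real \<Rightarrow> (real \<Rightarrow> real) \<Rightarrow> real \<Rightarrow> real" where
  "Caputo \<alpha> g = (if \<alpha> = 1 then g else RL_left (1 - \<alpha>) g)"

text \<open>The formulas for fractional derivatives use one continuous derivative. Working at this
  regularity covers both the smooth approximants and the bump function, which is C^1 but not
  C^2.\<close>

definition C1_pair :: "real \<Rightarrow> (real \<Rightarrow> real) \<Rightarrow> (real \<Rightarrow> real) \<Rightarrow> bool" where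
  "C1_pair T \<phi> g \<longleftrightarrow> continuous_on {0..T} g
     \<and> (\<forall>t\<in>{0..T}. (\<phi> has_real_derivative g t) (at t within {0..T})) \<and> \<phi> 0 = 0 \<and> \<phi> T = 0"

lemma C1_pair_continuous: "C1_pair T \<phi> g \<Longrightarrow> continuous_on {0..T} \<phi>"
  unfolding C1_pair_def using DERIV_continuous_on by blast

lemma C0_infE:
  assumes "\<phi> \<in> C0_inf T"
  obtains G :: "nat \<Rightarrow> real \<Rightarrow> real" where "\<And>t. t \<in> {0..T} \<Longrightarrow> G 0 t = \<phi> t"
    "\<And>n t. t \<in> {0..T} \<Longrightarrow> (G n has_real_derivative G (Suc n) t) (at t within {0..T})"
    "\<phi> 0 = 0" "\<phi> T = 0"
  using assms unfolding C0_inf_def smooth_Icc_def mem_Collect_eq by blast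

lemma C0_inf_C1_pair:
  assumes "\<phi> \<in> C0_inf T" obtains g where "C1_pair T \<phi> g"
proof -
  obtain G :: "nat \<Rightarrow> real \<Rightarrow> real" where G: "\<And>t. t \<in> {0..T} \<Longrightarrow> G 0 t = \<phi> t"
    "\<And>n t. t \<in> {0..T} \<Longrightarrow> (G n has_real_derivative G (Suc n) t) (at t within {0..T})"
    using C0_infE[OF assms] by metis
  have "continuous_on {0..T} (G 1)" using G(2)[of _ 1] by (intro DERIV_continuous_on) auto
  moreover have "(\<phi> has_real_derivative G 1 t) (at t within {0..T})" if "t \<in> {0..T}" for t
    using G(2)[OF that, of 0] G(1) that
    by (auto intro: has_field_derivative_transform_within[OF _ zero_less_one])
  ultimately have "C1_pair T \<phi> (G 1)" using assms by (auto simp: C1_pair_def C0_inf_def)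
  then show ?thesis by (rule that)
qed

lemma C1_pair_lincomb:
  assumes "C1_pair T \<phi> g" "C1_pair T \<psi> h"
  shows "C1_pair T (\<lambda>t. a * \<phi> t + b * \<psi> t) (\<lambda>t. a * g t + b * h t)"
  using assms unfolding C1_pair_def by (auto intro!: continuous_intros derivative_eq_intros)

lemma C0_inf_lincomb:
  assumes "\<phi> \<in> C0_inf T" "\<psi> \<in> C0_inf T"
  shows "(\<lambda>t. a * \<phi> t + b * \<psi> t) \<in> C0_inf T"
proof -
  obtain G where G: "\<And>t. t \<in> {0..T} \<Longrightarrow> G 0 t = \<phi> t"
    "\<And>n t. t \<in> {0..T} \<Longrightarrow> (G n has_real_derivative G (Suc n) t) (at t within {0..T})"
    using C0_infE[OF assms(1)] by metis
  obtain H where H: "\<And>t. t \<in> {0..T} \<Longrightarrow> H 0 t = \<psi> t"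
    "\<And>n t. t \<in> {0..T} \<Longrightarrow> (H n has_real_derivative H (Suc n) t) (at t within {0..T})"
    using C0_infE[OF assms(2)] by metis
  have "((\<lambda>t. a * G n t + b * H n t) has_real_derivative a * G (Suc n) t + b * H (Suc n) t) (at t within {0..T})"
    if "t \<in> {0..T}" for n t
    by (intro DERIV_add DERIV_cmult G(2) H(2) that)
  then have "smooth_Icc T (\<lambda>t. a * \<phi> t + b * \<psi> t)" unfolding smooth_Icc_def
    using G(1) H(1) by (intro exI[of _ "\<lambda>n t. a * G n t + b * H n t"]) simp
  then show ?thesis using assms by (simp add: C0_inf_def)
qed

lemma C1_pair_integral:
  assumes "C1_pair T \<phi> g" "t \<in> {0..T}"
  shows "(LINT r:{0..t}|lebesgue. g r) = \<phi> t"
proof -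
  have c: "continuous_on {0..t} g" using assms by (auto simp: C1_pair_def intro: continuous_on_subset)
  have "set_integrable lebesgue {0..t} g"
    using absolutely_integrable_continuous_real[OF c] .
  from set_lebesgue_integral_eq_integral(2)[OF this]
  have "(LINT r:{0..t}|lebesgue. g r) = integral {0..t} g" .
  also have "\<dots> = \<phi> t - \<phi> 0"
  proof (intro integral_unique fundamental_theorem_of_calculus)
    fix s assume "s \<in> {0..t}"
    then have "(\<phi> has_real_derivative g s) (at s within {0..T})" using assms by (auto simp: C1_pair_def)
    then have "(\<phi> has_real_derivative g s) (at s within {0..t})"
      by (rule DERIV_subset) (use assms in auto)
    then show "(\<phi> has_vector_derivative g s) (at s within {0..t})"
      by (simp add: has_real_derivative_iff_has_vector_derivative)
  qed (use assms in auto)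
  finally show ?thesis using assms by (simp add: C1_pair_def)
qed

section \<open>Fractional derivatives of continuously differentiable functions\<close>

locale frac_space =
  fixes T \<alpha> p :: real
  assumes T_pos: "T > 0" and p_gt_1: "1 < p" and \<alpha>_gt: "1 / p < \<alpha>" and \<alpha>_le_1: "\<alpha> \<le> 1"
begin

lemma p_pos: "p > 0" using p_gt_1 by simp

lemma \<alpha>_pos: "\<alpha> > 0" using \<alpha>_gt p_pos by (meson less_trans zero_less_divide_1_iff)

text \<open>The estimates for a fractional integral of order 1 - alpha need an exponent q with 1/q <
  1 - alpha. Continuous functions lie in every L^q, so q = 2 / (1 - alpha) may be taken regardless
  of p.\<close>

lemma Caputo_exponent:
  assumes "\<alpha> \<noteq> 1"
  shows "1 < 2 / (1 - \<alpha>)" "1 / (2 / (1 - \<alpha>)) < 1 - \<alpha>" "1 - \<alpha> \<le> 1"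
  using assms \<alpha>_le_1 \<alpha>_pos by (auto simp: field_simps)

lemma Caputo_continuous: "continuous_on {0..T} g \<Longrightarrow> continuous_on {0..T} (Caputo \<alpha> g)"
proof (cases "\<alpha> = 1")
  case False
  assume g: "continuous_on {0..T} g"
  have "2 / (1 - \<alpha>) > 0" using Caputo_exponent(1)[OF False] by linarith
  then show ?thesis
    using RL_left_continuous[OF Caputo_exponent[OF False] continuous_Lp_fun[OF _ g]] False
    by (simp add: Caputo_def)
qed (simp add: Caputo_def)

lemma Caputo_lincomb:
  assumes "continuous_on {0..T} g" "continuous_on {0..T} h" "t \<in> {0..T}"
  shows "Caputo \<alpha> (\<lambda>s. a * g s + b * h s) t = a * Caputo \<alpha> g t + b * Caputo \<alpha> h t"
proof (cases "\<alpha> = 1")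
  case False
  have "2 / (1 - \<alpha>) > 0" using Caputo_exponent(1)[OF False] by linarith
  then show ?thesis
    using RL_left_linear[OF Caputo_exponent[OF False], of g T h t] False assms
    by (simp add: Caputo_def continuous_Lp_fun)
qed (simp add: Caputo_def)

text \<open>Boundedness in the sup norm lets a uniform approximation of the ordinary derivative
  become one of the fractional derivative.\<close>

lemma Caputo_bound:
  obtains K where "K \<ge> 0"
    "\<And>h \<epsilon> t. continuous_on {0..T} h \<Longrightarrow> (\<And>s. s \<in> {0..T} \<Longrightarrow> \<bar>h s\<bar> \<le> \<epsilon>) \<Longrightarrow> t \<in> {0..T} \<Longrightarrow> \<bar>Caputo \<alpha> h t\<bar> \<le> K * \<epsilon>"
proof (cases "\<alpha> = 1")
  case True
  then show ?thesis using that[of 1] by (simp add: Caputo_def)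
next
  case False
  define q where "q = 2 / (1 - \<alpha>)"
  note ex = Caputo_exponent[OF False, folded q_def]
  define K where "K = RL_const (1 - \<alpha>) q * T powr (1 - \<alpha> - 1 / q) * T powr (1 / q)"
  have R: "0 \<le> RL_const (1 - \<alpha>) q" using False \<alpha>_le_1 by (intro RL_const_nonneg) auto
  then have "K \<ge> 0" by (simp add: K_def)
  moreover have "\<bar>Caputo \<alpha> h t\<bar> \<le> K * \<epsilon>"
    if h: "continuous_on {0..T} h" "\<And>s. s \<in> {0..T} \<Longrightarrow> \<bar>h s\<bar> \<le> \<epsilon>" and t: "t \<in> {0..T}" for h \<epsilon> t
  proof -
    have \<epsilon>: "\<epsilon> \<ge> 0" using h(2)[OF t] by linarith
    have hL: "h \<in> Lp_fun T q" using h ex by (intro continuous_Lp_fun) auto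
    have "\<bar>Caputo \<alpha> h t\<bar> \<le> RL_const (1 - \<alpha>) q * T powr (1 - \<alpha> - 1 / q) * Lp_int T q h powr (1 / q)"
      using RL_left_bound[OF ex hL t] False by (simp add: Caputo_def)
    also have "\<dots> \<le> RL_const (1 - \<alpha>) q * T powr (1 - \<alpha> - 1 / q) * (T * \<epsilon> powr q) powr (1 / q)"
      using Lp_int_le_const[OF T_pos _ hL h(2)] ex R by (intro mult_left_mono powr_mono2) auto
    also have "\<dots> = K * \<epsilon>" using ex \<epsilon> T_pos by (simp add: K_def powr_mult powr_powr)
    finally show ?thesis .
  qed
  ultimately show ?thesis using that by blast
qed

text \<open>The orders alpha and 1 - alpha add up to 1, so the composition integrates g and returns
  phi, which vanishes at 0.\<close>

lemma RL_left_Caputo: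
  assumes "C1_pair T \<phi> g" "t \<in> {0..T}"
  shows "RL_left \<alpha> (Caputo \<alpha> g) t = \<phi> t"
proof -
  have i: "integrable (lebesgue_on {0..T}) g"
    using assms by (auto simp: C1_pair_def intro: integrable_continuous_Icc)
  show ?thesis
  proof (cases "\<alpha> = 1")
    case True
    then show ?thesis using RL_left_1[OF i assms(2)] C1_pair_integral[OF assms] by (simp add: Caputo_def)
  next
    case False
    then show ?thesis using RL_left_RL_left[of "1 - \<alpha>" T g t] i assms C1_pair_integral[OF assms] \<alpha>_pos \<alpha>_le_1
      by (simp add: Caputo_def)
  qed
qed

text \<open>Replacing phi by the fractional integral of \<open>Caputo \<alpha> g\<close> turns the
  integral of order 1 - alpha into the plain integral of a continuous function, to which the
  fundamental theorem applies; no singular integral is differentiated. The endpoints are left out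
  because \<open>deriv\<close> is two-sided.\<close>

lemma RL_deriv_Caputo:
  assumes "C1_pair T \<phi> g" "t \<in> {0<..<T}"
  shows "RL_deriv \<alpha> \<phi> t = Caputo \<alpha> g t"
proof (cases "\<alpha> = 1")
  case True
  have "(\<phi> has_real_derivative g t) (at t within {0..T})" using assms by (auto simp: C1_pair_def)
  moreover have "at t within {0..T} = at t" using assms(2) by (intro at_within_interior) simp
  ultimately show ?thesis using True by (simp add: RL_deriv_def Caputo_def DERIV_imp_deriv)
next
  case False
  have cont: "continuous_on {0..T} (Caputo \<alpha> g)"
    using assms by (intro Caputo_continuous) (simp add: C1_pair_def)
  have eq: "RL_left (1 - \<alpha>) \<phi> s = integral {0..s} (Caputo \<alpha> g)" if s: "s \<in> {0..T}" for s
  proof -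
    have "RL_left (1 - \<alpha>) \<phi> s = RL_left (1 - \<alpha>) (RL_left \<alpha> (Caputo \<alpha> g)) s"
      using RL_left_Caputo[OF assms(1)] s by (intro RL_left_cong) auto
    also have "\<dots> = (LINT r:{0..s}|lebesgue. Caputo \<alpha> g r)"
      using \<alpha>_pos \<alpha>_le_1 False s integrable_continuous_Icc[OF cont] by (intro RL_left_RL_left) auto
    also have "\<dots> = integral {0..s} (Caputo \<alpha> g)"
      using s by (intro set_lebesgue_integral_eq_integral absolutely_integrable_continuous_real
          continuous_on_subset[OF cont]) auto
    finally show ?thesis .
  qed
  have "((\<lambda>s. integral {0..s} (Caputo \<alpha> g)) has_real_derivative Caputo \<alpha> g t) (at t within {0..T})"
    using integral_has_real_derivative[OF cont, of t] assms(2) by simp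
  moreover have "at t within {0..T} = at t" using assms(2) by (intro at_within_interior) simp
  ultimately have "((\<lambda>s. integral {0..s} (Caputo \<alpha> g)) has_real_derivative Caputo \<alpha> g t) (at t)" by simp
  then have "(RL_left (1 - \<alpha>) \<phi> has_real_derivative Caputo \<alpha> g t) (at t)"
    by (rule has_field_derivative_transform_within_open[of _ _ _ "{0<..<T}"]) (use assms(2) in \<open>auto simp: eq\<close>)
  then show ?thesis using False by (simp add: RL_deriv_def DERIV_imp_deriv)
qed

lemma AE_interior: "AE t in lebesgue_on {0..T}. t \<in> {0<..<T}"
proof -
  have "AE t in lebesgue_on {0..T}. t \<in> {0..T}" by (rule AE_I2) simp
  moreover have "AE t in lebesgue_on {0..T}. t \<noteq> 0" "AE t in lebesgue_on {0..T}. t \<noteq> T"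
    by (rule AE_lebesgue_on_neq; simp)+
  ultimately show ?thesis by eventually_elim auto
qed

lemma RL_deriv_AE:
  assumes "C1_pair T \<phi> g"
  shows "AE t in lebesgue_on {0..T}. RL_deriv \<alpha> \<phi> t = Caputo \<alpha> g t"
  using AE_interior by eventually_elim (rule RL_deriv_Caputo[OF assms])

lemma RL_deriv_Lp_fun:
  assumes "C1_pair T \<phi> g"
  shows "RL_deriv \<alpha> \<phi> \<in> Lp_fun T p" "Caputo \<alpha> g \<in> Lp_fun T p"
proof -
  have C: "Caputo \<alpha> g \<in> Lp_fun T p"
    using assms p_pos by (intro continuous_Lp_fun Caputo_continuous) (auto simp: C1_pair_def)
  then show "Caputo \<alpha> g \<in> Lp_fun T p" .
  have m[measurable]: "RL_deriv \<alpha> \<phi> \<in> borel_measurable (lebesgue_on {0..T})"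
  \<comment> \<open>\<open>RL_deriv\<close> may take arbitrary values at the two endpoints, and
    finitely many points do not affect measurability.\<close>
  proof (rule measurable_discrete_difference[where X = "{0, T}"])
    show "Caputo \<alpha> g \<in> borel_measurable (lebesgue_on {0..T})" by (rule Lp_funD[OF C])
    show "Caputo \<alpha> g x = RL_deriv \<alpha> \<phi> x" if "x \<in> space (lebesgue_on {0..T})" "x \<notin> {0, T}" for x
      using RL_deriv_Caputo[OF assms, of x] that by auto
  qed (use T_pos in \<open>auto simp: sets_restrict_space_iff\<close>)
  note [measurable] = Lp_funD(1)[OF C]
  show "RL_deriv \<alpha> \<phi> \<in> Lp_fun T p"
    using Lp_funD(2)[OF C] RL_deriv_AE[OF assms]
    by (auto simp: Lp_fun_def m intro!: integrable_cong_AE_imp[where g = "\<lambda>t. \<bar>Caputo \<alpha> g t\<bar> powr p"] elim!: eventually_mono)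
qed

lemma Lp_int_RL_deriv:
  assumes "C1_pair T \<phi> g" "w \<in> Lp_fun T p"
  shows "Lp_int T p (\<lambda>t. RL_deriv \<alpha> \<phi> t - w t) = Lp_int T p (\<lambda>t. Caputo \<alpha> g t - w t)"
  by (intro Lp_int_cong_AE Lp_fun_diff p_pos RL_deriv_Lp_fun[OF assms(1)] assms(2))
    (use RL_deriv_AE[OF assms(1)] in \<open>auto elim!: eventually_mono\<close>)

section \<open>The closure as a set of pairs (u, w)\<close>

abbreviation H :: "(real \<Rightarrow> real) \<Rightarrow> (real \<Rightarrow> real) \<Rightarrow> bool" where
  "H \<equiv> has_frac_deriv T \<alpha> p"

abbreviation N :: "(real \<Rightarrow> real) \<Rightarrow> real" where
  "N \<equiv> Lp_int T p"

text \<open>Continuity of the powers p and 1/p at 0 removes the roots, and approximation within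
  1/(n+1) recovers a sequence. The epsilon form is the one used from here on.\<close>

lemma has_frac_deriv_iff:
  "H u w \<longleftrightarrow> u \<in> Lp_fun T p \<and> w \<in> Lp_fun T p \<and>
    (\<forall>\<epsilon>>0. \<exists>\<phi>\<in>C0_inf T. N (\<lambda>t. \<phi> t - u t) < \<epsilon> \<and> N (\<lambda>t. RL_deriv \<alpha> \<phi> t - w t) < \<epsilon>)"
proof -
  define S where "S \<phi> = N (\<lambda>t. \<phi> t - u t) + N (\<lambda>t. RL_deriv \<alpha> \<phi> t - w t)" for \<phi>
  have S0: "S \<phi> \<ge> 0" for \<phi> by (simp add: S_def)
  have *: "(\<lambda>n. (Lp_norm T p (\<lambda>t. \<phi> n t - u t) powr p
              + Lp_norm T p (\<lambda>t. RL_deriv \<alpha> (\<phi> n) t - w t) powr p) powr (1 / p)) \<longlonglongrightarrow> 0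
      \<longleftrightarrow> (\<lambda>n. S (\<phi> n)) \<longlonglongrightarrow> 0" for \<phi> :: "nat \<Rightarrow> real \<Rightarrow> real"
  proof -
    have "(\<lambda>n. S (\<phi> n) powr (1 / p)) \<longlonglongrightarrow> 0 \<longleftrightarrow> (\<lambda>n. S (\<phi> n)) \<longlonglongrightarrow> 0"
    proof
      assume "(\<lambda>n. S (\<phi> n)) \<longlonglongrightarrow> 0"
      from tendsto_powr2[OF this tendsto_const[of "1 / p"]]
      show "(\<lambda>n. S (\<phi> n) powr (1 / p)) \<longlonglongrightarrow> 0" using S0 p_pos by simp
    next
      assume "(\<lambda>n. S (\<phi> n) powr (1 / p)) \<longlonglongrightarrow> 0"
      from tendsto_powr2[OF this tendsto_const[of p]]
      have "(\<lambda>n. (S (\<phi> n) powr (1 / p)) powr p) \<longlonglongrightarrow> 0" using S0 p_pos by simp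
      then show "(\<lambda>n. S (\<phi> n)) \<longlonglongrightarrow> 0" using S0 p_pos by (simp add: powr_powr)
    qed
    then show ?thesis by (simp add: S_def Lp_norm_powr[OF p_pos])
  qed
  have "(\<exists>\<phi>. (\<forall>n::nat. \<phi> n \<in> C0_inf T) \<and> (\<lambda>n. S (\<phi> n)) \<longlonglongrightarrow> 0) \<longleftrightarrow>
    (\<forall>\<epsilon>>0. \<exists>\<phi>\<in>C0_inf T. N (\<lambda>t. \<phi> t - u t) < \<epsilon> \<and> N (\<lambda>t. RL_deriv \<alpha> \<phi> t - w t) < \<epsilon>)" (is "?L \<longleftrightarrow> ?R")
  proof
    assume ?L
    then obtain \<phi> where \<phi>: "\<And>n::nat. \<phi> n \<in> C0_inf T" "(\<lambda>n. S (\<phi> n)) \<longlonglongrightarrow> 0" by blast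
    show ?R
    proof (intro allI impI)
      fix \<epsilon> :: real assume "\<epsilon> > 0"
      then obtain n where "S (\<phi> n) < \<epsilon>"
        using order_tendstoD(2)[OF \<phi>(2), of \<epsilon>] by (auto simp: eventually_sequentially)
      then have "N (\<lambda>t. \<phi> n t - u t) < \<epsilon>" "N (\<lambda>t. RL_deriv \<alpha> (\<phi> n) t - w t) < \<epsilon>"
        using Lp_int_nonneg[of T p "\<lambda>t. \<phi> n t - u t"] Lp_int_nonneg[of T p "\<lambda>t. RL_deriv \<alpha> (\<phi> n) t - w t"]
        unfolding S_def by linarith+
      then show "\<exists>\<phi>\<in>C0_inf T. N (\<lambda>t. \<phi> t - u t) < \<epsilon> \<and> N (\<lambda>t. RL_deriv \<alpha> \<phi> t - w t) < \<epsilon>"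
        using \<phi>(1) by blast
    qed
  next
    assume R: ?R
    have "\<exists>\<phi>\<in>C0_inf T. S \<phi> < 1 / real (Suc n)" for n
    proof -
      have "1 / real (Suc n) / 2 > 0" by simp
      with R obtain \<phi> where "\<phi> \<in> C0_inf T" "N (\<lambda>t. \<phi> t - u t) < 1 / real (Suc n) / 2"
        "N (\<lambda>t. RL_deriv \<alpha> \<phi> t - w t) < 1 / real (Suc n) / 2" by blast
      then show ?thesis unfolding S_def by (intro bexI[of _ \<phi>]) linarith+
    qed
    then obtain \<phi> where \<phi>: "\<And>n. \<phi> n \<in> C0_inf T" "\<And>n. S (\<phi> n) < 1 / real (Suc n)" by metis
    have "(\<lambda>n. S (\<phi> n)) \<longlonglongrightarrow> 0"
      by (rule real_tendsto_sandwich[OF _ _ tendsto_const LIMSEQ_Suc[OF lim_1_over_n]])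
        (use S0 \<phi>(2) in \<open>auto intro!: always_eventually simp: less_imp_le\<close>)
    then show ?L using \<phi>(1) by blast
  qed
  then show ?thesis unfolding has_frac_deriv_def * by blast
qed

lemma has_frac_deriv_Lp: assumes "H u w" shows "u \<in> Lp_fun T p" "w \<in> Lp_fun T p"
  using assms by (auto simp: has_frac_deriv_def)

lemma C0_inf_Lp:
  assumes "\<phi> \<in> C0_inf T" shows "\<phi> \<in> Lp_fun T p" "RL_deriv \<alpha> \<phi> \<in> Lp_fun T p"
proof -
  obtain g where g: "C1_pair T \<phi> g" using C0_inf_C1_pair[OF assms] .
  show "\<phi> \<in> Lp_fun T p" using C1_pair_continuous[OF g] p_pos by (intro continuous_Lp_fun)
  show "RL_deriv \<alpha> \<phi> \<in> Lp_fun T p" by (rule RL_deriv_Lp_fun[OF g])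
qed

lemma Lp_int_lincomb:
  assumes "u \<in> Lp_fun T p" "v \<in> Lp_fun T p"
  shows "N (\<lambda>t. a * u t + b * v t) \<le> 2 powr p * (\<bar>a\<bar> powr p * N u + \<bar>b\<bar> powr p * N v)"
  using Lp_fun_add(2)[OF p_pos Lp_fun_cmult(1)[OF p_pos assms(1), of a] Lp_fun_cmult(1)[OF p_pos assms(2), of b]]
  by (simp add: Lp_fun_cmult(2)[OF p_pos assms(1)] Lp_fun_cmult(2)[OF p_pos assms(2)])

lemma Lp_fun_lincomb:
  assumes "u \<in> Lp_fun T p" "v \<in> Lp_fun T p"
  shows "(\<lambda>t. a * u t + b * v t) \<in> Lp_fun T p"
  using Lp_fun_add(1)[OF p_pos Lp_fun_cmult(1)[OF p_pos assms(1), of a] Lp_fun_cmult(1)[OF p_pos assms(2), of b]] .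

text \<open>Additivity of \<open>RL_deriv\<close> is not immediate from \<open>deriv\<close>; it is
  obtained almost everywhere through the Caputo form, which is linear.\<close>

lemma has_frac_deriv_lincomb:
  assumes "H u w" "H u' w'"
  shows "H (\<lambda>t. a * u t + b * u' t) (\<lambda>t. a * w t + b * w' t)"
  unfolding has_frac_deriv_iff
proof (intro conjI allI impI)
  note L = has_frac_deriv_Lp[OF assms(1)] has_frac_deriv_Lp[OF assms(2)]
  show "(\<lambda>t. a * u t + b * u' t) \<in> Lp_fun T p" "(\<lambda>t. a * w t + b * w' t) \<in> Lp_fun T p"
    using L by (auto intro: Lp_fun_lincomb)
  fix \<epsilon> :: real assume \<epsilon>: "\<epsilon> > 0"
  \<comment> \<open>The summand 1 keeps K positive when a = b = 0 and makes the final estimate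
    strict.\<close>
  define K where "K = 2 powr p * (\<bar>a\<bar> powr p + \<bar>b\<bar> powr p) + 1"
  have K: "K > 0" by (simp add: K_def add_nonneg_pos)
  obtain \<phi> where \<phi>: "\<phi> \<in> C0_inf T" "N (\<lambda>t. \<phi> t - u t) < \<epsilon> / K" "N (\<lambda>t. RL_deriv \<alpha> \<phi> t - w t) < \<epsilon> / K"
    using assms(1) \<epsilon> K unfolding has_frac_deriv_iff by (meson divide_pos_pos)
  obtain \<psi> where \<psi>: "\<psi> \<in> C0_inf T" "N (\<lambda>t. \<psi> t - u' t) < \<epsilon> / K" "N (\<lambda>t. RL_deriv \<alpha> \<psi> t - w' t) < \<epsilon> / K"
    using assms(2) \<epsilon> K unfolding has_frac_deriv_iff by (meson divide_pos_pos)
  obtain g where g: "C1_pair T \<phi> g" using C0_inf_C1_pair[OF \<phi>(1)] .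
  obtain h where h: "C1_pair T \<psi> h" using C0_inf_C1_pair[OF \<psi>(1)] .
  define \<xi> where "\<xi> t = a * \<phi> t + b * \<psi> t" for t
  have \<xi>: "\<xi> \<in> C0_inf T" unfolding \<xi>_def by (rule C0_inf_lincomb[OF \<phi>(1) \<psi>(1)])
  have g\<xi>: "C1_pair T \<xi> (\<lambda>t. a * g t + b * h t)" unfolding \<xi>_def by (rule C1_pair_lincomb[OF g h])
  have est: "N (\<lambda>t. a * x t + b * y t) < \<epsilon>"
    if "x \<in> Lp_fun T p" "y \<in> Lp_fun T p" "N x < \<epsilon> / K" "N y < \<epsilon> / K" for x y
  proof -
    have "N (\<lambda>t. a * x t + b * y t) \<le> 2 powr p * (\<bar>a\<bar> powr p * N x + \<bar>b\<bar> powr p * N y)"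
      by (rule Lp_int_lincomb[OF that(1,2)])
    also have "\<dots> \<le> 2 powr p * (\<bar>a\<bar> powr p * (\<epsilon> / K) + \<bar>b\<bar> powr p * (\<epsilon> / K))"
      using that by (intro mult_left_mono add_mono) auto
    also have "\<dots> = 2 powr p * (\<bar>a\<bar> powr p + \<bar>b\<bar> powr p) * (\<epsilon> / K)"
      by (simp only: distrib_left distrib_right mult.assoc)
    also have "\<dots> = (K - 1) * (\<epsilon> / K)" by (simp add: K_def)
    also have "\<dots> < K * (\<epsilon> / K)" using \<epsilon> K by (intro mult_strict_right_mono) auto
    finally show ?thesis using K by simp
  qed
  have "N (\<lambda>t. \<xi> t - (a * u t + b * u' t)) < \<epsilon>"
    using est[OF Lp_fun_diff(1)[OF p_pos C0_inf_Lp(1)[OF \<phi>(1)] L(1)] Lp_fun_diff(1)[OF p_pos C0_inf_Lp(1)[OF \<psi>(1)] L(3)] \<phi>(2) \<psi>(2)]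
    by (simp add: \<xi>_def algebra_simps)
  moreover have "N (\<lambda>t. RL_deriv \<alpha> \<xi> t - (a * w t + b * w' t)) < \<epsilon>"
  proof -
    have "N (\<lambda>t. RL_deriv \<alpha> \<xi> t - (a * w t + b * w' t))
        = N (\<lambda>t. a * (RL_deriv \<alpha> \<phi> t - w t) + b * (RL_deriv \<alpha> \<psi> t - w' t))"
    proof (rule Lp_int_cong_AE)
      show "AE t in lebesgue_on {0..T}. RL_deriv \<alpha> \<xi> t - (a * w t + b * w' t)
          = a * (RL_deriv \<alpha> \<phi> t - w t) + b * (RL_deriv \<alpha> \<psi> t - w' t)"
        using RL_deriv_AE[OF g\<xi>] RL_deriv_AE[OF g] RL_deriv_AE[OF h] AE_interior
      proof eventually_elim
        case (elim t)
        then show ?case using Caputo_lincomb[of g h t a b] g h by (simp add: C1_pair_def algebra_simps)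
      qed
    qed (intro Lp_fun_diff Lp_fun_lincomb p_pos L C0_inf_Lp \<phi>(1) \<psi>(1) \<xi>)+
    also have "\<dots> < \<epsilon>"
      by (intro est Lp_fun_diff p_pos C0_inf_Lp L \<phi> \<psi>)
    finally show ?thesis .
  qed
  ultimately show "\<exists>\<phi>\<in>C0_inf T. N (\<lambda>t. \<phi> t - (a * u t + b * u' t)) < \<epsilon>
      \<and> N (\<lambda>t. RL_deriv \<alpha> \<phi> t - (a * w t + b * w' t)) < \<epsilon>"
    using \<xi> by blast
qed

lemma has_frac_deriv_closed:
  assumes u: "u \<in> Lp_fun T p" and w: "w \<in> Lp_fun T p" and H: "\<And>n::nat. H (U n) (W n)"
    and lim: "(\<lambda>n. N (\<lambda>t. U n t - u t)) \<longlonglongrightarrow> 0" "(\<lambda>n. N (\<lambda>t. W n t - w t)) \<longlonglongrightarrow> 0"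
  shows "H u w"
  unfolding has_frac_deriv_iff
proof (intro conjI allI impI u w)
  fix \<epsilon> :: real assume \<epsilon>: "\<epsilon> > 0"
  define e where "e = \<epsilon> / (2 * 2 powr p)"
  have e: "e > 0" using \<epsilon> by (simp add: e_def)
  have "\<forall>\<^sub>F n in sequentially. N (\<lambda>t. U n t - u t) < e \<and> N (\<lambda>t. W n t - w t) < e"
    using order_tendstoD(2)[OF lim(1) e] order_tendstoD(2)[OF lim(2) e] by (rule eventually_conj)
  then obtain n where n: "N (\<lambda>t. U n t - u t) < e" "N (\<lambda>t. W n t - w t) < e"
    by (auto simp: eventually_sequentially)
  obtain \<phi> where \<phi>: "\<phi> \<in> C0_inf T" "N (\<lambda>t. \<phi> t - U n t) < e" "N (\<lambda>t. RL_deriv \<alpha> \<phi> t - W n t) < e"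
    using H[of n] e unfolding has_frac_deriv_iff by blast
  have est: "N (\<lambda>t. x t - z t) < \<epsilon>"
    if "x \<in> Lp_fun T p" "y \<in> Lp_fun T p" "z \<in> Lp_fun T p" "N (\<lambda>t. x t - y t) < e" "N (\<lambda>t. y t - z t) < e" for x y z
  proof -
    have "N (\<lambda>t. x t - z t) \<le> 2 powr p * (N (\<lambda>t. x t - y t) + N (\<lambda>t. y t - z t))"
      by (rule Lp_int_diff_triangle[OF p_pos that(1-3)])
    also have "\<dots> < 2 powr p * (e + e)" using that by (intro mult_strict_left_mono add_strict_mono) auto
    finally show ?thesis by (simp add: e_def)
  qed
  show "\<exists>\<phi>\<in>C0_inf T. N (\<lambda>t. \<phi> t - u t) < \<epsilon> \<and> N (\<lambda>t. RL_deriv \<alpha> \<phi> t - w t) < \<epsilon>"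
    using \<phi> n has_frac_deriv_Lp[OF H[of n]] C0_inf_Lp[OF \<phi>(1)] u w by (intro bexI[of _ \<phi>] conjI) (auto intro: est)
qed

section \<open>Representation by the fractional integral, and uniqueness\<close>

lemma RL_left_lincomb:
  assumes "w \<in> Lp_fun T p" "w' \<in> Lp_fun T p" "t \<in> {0..T}"
  shows "RL_left \<alpha> (\<lambda>s. a * w s + b * w' s) t = a * RL_left \<alpha> w t + b * RL_left \<alpha> w' t"
  using RL_left_linear[OF p_gt_1 \<alpha>_gt \<alpha>_le_1 assms] .

definition sup_const :: real where "sup_const = RL_const \<alpha> p * T powr (\<alpha> - 1 / p)"

lemma sup_const_nonneg: "sup_const \<ge> 0"
  using RL_const_nonneg[OF \<alpha>_pos] by (simp add: sup_const_def)

lemma RL_left_Lp_bound: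
  assumes "w \<in> Lp_fun T p" "t \<in> {0..T}"
  shows "\<bar>RL_left \<alpha> w t\<bar> \<le> sup_const * N w powr (1 / p)"
  using RL_left_bound[OF p_gt_1 \<alpha>_gt \<alpha>_le_1 assms] by (simp add: sup_const_def)

text \<open>Each smooth approximant is the fractional integral of its own derivative. L^p
  convergence of the derivatives therefore gives uniform convergence of the approximants to
  \<open>RL_left \<alpha> w\<close>, while they converge to u in L^p. The two continuous limits
  coincide, and the boundary value at T survives the uniform limit.\<close>

lemma has_frac_deriv_RL_left:
  assumes Huw: "H u w" and cont: "continuous_on {0..T} u"
  shows "t \<in> {0..T} \<Longrightarrow> u t = RL_left \<alpha> w t" "u 0 = 0" "u T = 0"
proof -
  note L = has_frac_deriv_Lp[OF Huw]
  let ?v = "RL_left \<alpha> w"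
  have cv: "continuous_on {0..T} ?v" by (rule RL_left_continuous[OF p_gt_1 \<alpha>_gt \<alpha>_le_1 L(2)])
  have vL: "?v \<in> Lp_fun T p" using cv p_pos by (intro continuous_Lp_fun)
  have app: "\<exists>\<phi>\<in>C0_inf T. N (\<lambda>t. \<phi> t - u t) < \<epsilon> \<and> (\<forall>t\<in>{0..T}. \<bar>\<phi> t - ?v t\<bar> \<le> \<epsilon>)"
    if \<epsilon>: "\<epsilon> > 0" for \<epsilon>
  proof -
    \<comment> \<open>The second entry undoes the p-th root in the sup bound; the summand 1 covers a
      vanishing \<open>sup_const\<close>.\<close>
    define e where "e = min \<epsilon> ((\<epsilon> / (sup_const + 1)) powr p)"
    have C1: "sup_const + 1 > 0" using sup_const_nonneg by simp
    have e: "e > 0" using \<epsilon> C1 by (simp add: e_def)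
    obtain \<phi> where \<phi>: "\<phi> \<in> C0_inf T" "N (\<lambda>t. \<phi> t - u t) < e" "N (\<lambda>t. RL_deriv \<alpha> \<phi> t - w t) < e"
      using Huw e unfolding has_frac_deriv_iff by blast
    obtain g where g: "C1_pair T \<phi> g" using C0_inf_C1_pair[OF \<phi>(1)] .
    have CL: "Caputo \<alpha> g \<in> Lp_fun T p" by (rule RL_deriv_Lp_fun[OF g])
    have "\<bar>\<phi> t - ?v t\<bar> \<le> \<epsilon>" if t: "t \<in> {0..T}" for t
    proof -
      have "\<phi> t - ?v t = RL_left \<alpha> (\<lambda>s. Caputo \<alpha> g s - w s) t"
        using RL_left_lincomb[OF CL L(2) t, of 1 "-1"] RL_left_Caputo[OF g t] by simp
      also have "\<bar>\<dots>\<bar> \<le> sup_const * N (\<lambda>s. Caputo \<alpha> g s - w s) powr (1 / p)"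
        by (intro RL_left_Lp_bound Lp_fun_diff CL L p_pos t)
      also have "\<dots> \<le> sup_const * e powr (1 / p)"
        using \<phi>(3) Lp_int_RL_deriv[OF g L(2)] sup_const_nonneg p_pos by (intro mult_left_mono powr_mono2) auto
      also have "\<dots> \<le> sup_const * ((\<epsilon> / (sup_const + 1)) powr p) powr (1 / p)"
        using sup_const_nonneg p_pos e by (intro mult_left_mono powr_mono2) (auto simp: e_def)
      also have "\<dots> = sup_const * (\<epsilon> / (sup_const + 1))" using p_pos \<epsilon> C1 by (simp add: powr_powr)
      also have "\<dots> \<le> \<epsilon>" using \<epsilon> C1 by (simp add: field_simps)
      finally show ?thesis .
    qed
    then show ?thesis using \<phi> by (intro bexI[of _ \<phi>]) (auto simp: e_def)
  qed
  have "N (\<lambda>t. u t - ?v t) \<le> \<epsilon>" if "\<epsilon> > 0" for \<epsilon>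
  proof -
    define e where "e = min (\<epsilon> / (2 * 2 powr p)) ((\<epsilon> / (2 * 2 powr p * T)) powr (1 / p))"
    have "e > 0" using that T_pos by (simp add: e_def)
    from app[OF this] obtain \<phi> where \<phi>: "\<phi> \<in> C0_inf T" "N (\<lambda>t. \<phi> t - u t) < e"
      "\<And>t. t \<in> {0..T} \<Longrightarrow> \<bar>\<phi> t - ?v t\<bar> \<le> e" by blast
    note \<phi>L = C0_inf_Lp(1)[OF \<phi>(1)]
    have "N (\<lambda>t. \<phi> t - ?v t) \<le> T * e powr p"
      using \<phi>(3) by (intro Lp_int_le_const T_pos p_pos Lp_fun_diff \<phi>L vL) auto
    also have "\<dots> \<le> T * ((\<epsilon> / (2 * 2 powr p * T)) powr (1 / p)) powr p"
      using T_pos p_pos \<open>e > 0\<close> by (intro mult_left_mono powr_mono2) (auto simp: e_def)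
    also have "\<dots> = \<epsilon> / (2 * 2 powr p)" using T_pos p_pos that by (simp add: powr_powr)
    finally have 1: "N (\<lambda>t. \<phi> t - ?v t) \<le> \<epsilon> / (2 * 2 powr p)" .
    have "N (\<lambda>t. u t - ?v t) \<le> 2 powr p * (N (\<lambda>t. u t - \<phi> t) + N (\<lambda>t. \<phi> t - ?v t))"
      by (rule Lp_int_diff_triangle[OF p_pos L(1) \<phi>L vL])
    also have "\<dots> \<le> 2 powr p * (\<epsilon> / (2 * 2 powr p) + \<epsilon> / (2 * 2 powr p))"
      using 1 \<phi>(2) by (intro mult_left_mono add_mono) (auto simp: e_def Lp_int_diff_commute[of T p u])
    also have "\<dots> = \<epsilon>" by simp
    finally show ?thesis .
  qed
  then have "N (\<lambda>t. u t - ?v t) \<le> 0" by (rule field_le_epsilon) simp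
  then have N0: "N (\<lambda>t. u t - ?v t) = 0" using Lp_int_nonneg by (rule antisym)
  have c: "continuous_on {0..T} (\<lambda>t. \<bar>u t - ?v t\<bar> powr p)"
    using p_pos cont cv by (intro continuous_intros continuous_on_powr') auto
  have "integral {0..T} (\<lambda>t. \<bar>u t - ?v t\<bar> powr p) = 0"
    using N0 lebesgue_integral_eq_integral[OF integrable_continuous_Icc[OF c]] by (simp add: Lp_int_def)
  then have "\<forall>t\<in>{0..T}. \<bar>u t - ?v t\<bar> powr p = 0"
    using integral_eq_0_iff[OF c] T_pos by simp
  then show eq: "u t = ?v t" if "t \<in> {0..T}" for t using that by auto
  show "u 0 = 0" using eq[of 0] T_pos by simp
  have "\<bar>?v T\<bar> \<le> 0 + \<epsilon>" if "\<epsilon> > 0" for \<epsilon>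
  proof -
    from app[OF that] obtain \<phi> where \<phi>: "\<phi> \<in> C0_inf T" "\<forall>t\<in>{0..T}. \<bar>\<phi> t - ?v t\<bar> \<le> \<epsilon>" by blast
    have "T \<in> {0..T}" using T_pos by simp
    with \<phi>(2) have "\<bar>\<phi> T - ?v T\<bar> \<le> \<epsilon>" by blast
    moreover have "\<phi> T = 0" using \<phi>(1) by (simp add: C0_inf_def)
    ultimately show ?thesis by simp
  qed
  then have "\<bar>?v T\<bar> \<le> 0" by (rule field_le_epsilon)
  then show "u T = 0" using eq[of T] T_pos by simp
qed

text \<open>The difference of two derivatives is a derivative of 0, so its fractional integral
  vanishes; the integral of complementary order then yields vanishing integrals over all
  [0, t].\<close>

lemma has_frac_deriv_unique:
  assumes "H u w" "H u w'" "continuous_on {0..T} u"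
  shows "N w = N w'"
proof -
  note L = has_frac_deriv_Lp[OF assms(1)] has_frac_deriv_Lp[OF assms(2)]
  let ?d = "\<lambda>t. w t - w' t"
  have d: "?d \<in> Lp_fun T p" by (intro Lp_fun_diff p_pos L)
  have H0: "H (\<lambda>t. 0) ?d" using has_frac_deriv_lincomb[OF assms(1,2), of 1 "-1"] by simp
  have zero: "RL_left \<alpha> ?d t = 0" if "t \<in> {0..T}" for t
    using has_frac_deriv_RL_left(1)[OF H0 _ that] by simp
  have i: "integrable (lebesgue_on {0..T}) ?d" using Lp_fun_abs_integral_le(1)[OF T_pos p_gt_1 d] .
  have "(LINT r:{0..t}|lebesgue. ?d r) = 0" if t: "t \<in> {0..T}" for t
  proof (cases "\<alpha> = 1")
    case True
    then show ?thesis using RL_left_1[OF i t] zero[OF t] by simp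
  next
    case False
    have "(LINT r:{0..t}|lebesgue. ?d r) = RL_left (1 - \<alpha>) (RL_left \<alpha> ?d) t"
      using RL_left_RL_left[OF \<alpha>_pos _ i t] False \<alpha>_le_1 by simp
    also have "\<dots> = RL_left (1 - \<alpha>) (\<lambda>_. 0) t" using zero t by (intro RL_left_cong) auto
    finally show ?thesis by (simp add: RL_left_kernel)
  qed
  from AE_zero_if_integrals_zero[OF i this] have "AE r in lebesgue_on {0..T}. w r = w' r"
    by (auto elim!: eventually_mono)
  then show ?thesis by (intro Lp_int_cong_AE L)
qed

lemma E0_iff: "u \<in> E0 T \<alpha> p \<longleftrightarrow> continuous_on {0..T} u \<and> (\<exists>w. H u w)"
  by (simp add: E0_def)

text \<open>From here on the choice made by \<open>SOME\<close> is harmless: any available w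
  computes the norm.\<close>

lemma E_norm_eq:
  assumes "H u w" "continuous_on {0..T} u"
  shows "E_norm T \<alpha> p u = N w powr (1 / p)"
proof -
  have "H u (frac_deriv T \<alpha> p u)" unfolding frac_deriv_def using assms(1) by (rule someI[of "H u" w])
  then show ?thesis using has_frac_deriv_unique[OF _ assms(1,2)] by (simp add: E_norm_def Lp_norm_eq)
qed

section \<open>Continuously differentiable functions belong to the space\<close>

lemma smooth_Icc_poly: "smooth_Icc T (poly q)"
  unfolding smooth_Icc_def
  by (intro exI[of _ "\<lambda>n. poly ((pderiv ^^ n) q)"]) (auto intro: DERIV_subset[OF poly_DERIV])

text \<open>Weierstrass is applied to the derivative g, and the approximating polynomial is
  integrated term by term. Approximating u itself would give no control of its derivative.\<close>

lemma polynomial_antiderivative_approx: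
  assumes "continuous_on {0..T} g" "\<epsilon> > 0"
  obtains q where "poly q 0 = 0" "\<And>t. t \<in> {0..T} \<Longrightarrow> \<bar>poly (pderiv q) t - g t\<bar> < \<epsilon>"
proof -
  obtain P where P: "real_polynomial_function P" "\<And>x. x \<in> {0..T} \<Longrightarrow> \<bar>g x - P x\<bar> < \<epsilon>"
    using Stone_Weierstrass_real_polynomial_function[OF compact_Icc assms] by blast
  obtain a n where a: "P = (\<lambda>x. \<Sum>i\<le>n. a i * x ^ i)"
    using P(1) real_polynomial_function_iff_sum by blast
  define q where "q = (\<Sum>i\<le>n. monom (a i / real (Suc i)) (Suc i))"
  have pderiv_sum: "pderiv (\<Sum>i\<in>A. f i) = (\<Sum>i\<in>A. pderiv (f i))" for A and f :: "nat \<Rightarrow> real poly"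
    by (induction A rule: infinite_finite_induct) (simp_all add: pderiv_add)
  have "poly (pderiv q) x = P x" for x
    by (simp add: q_def a pderiv_sum pderiv_monom poly_sum poly_monom)
  moreover have "poly q 0 = 0" by (simp add: q_def poly_sum poly_monom)
  ultimately show ?thesis using P(2) by (intro that[of q]) (auto simp: abs_minus_commute)
qed

text \<open>A polynomial with nearly the right derivative and value 0 at 0 misses the boundary
  condition at T only slightly; a small linear term repairs this. Polynomials are smooth, so the
  corrected one is admissible.\<close>

lemma C1_pair_has_frac_deriv:
  assumes "C1_pair T u g"
  shows "H u (Caputo \<alpha> g)"
  unfolding has_frac_deriv_iff
proof (intro conjI allI impI)
  have cg: "continuous_on {0..T} g" using assms by (simp add: C1_pair_def)
  have uL: "u \<in> Lp_fun T p" using C1_pair_continuous[OF assms] p_pos by (intro continuous_Lp_fun)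
  have CL: "Caputo \<alpha> g \<in> Lp_fun T p" by (rule RL_deriv_Lp_fun[OF assms])
  show "u \<in> Lp_fun T p" "Caputo \<alpha> g \<in> Lp_fun T p" by fact+
  fix \<epsilon> :: real assume \<epsilon>: "\<epsilon> > 0"
  obtain K where K: "K \<ge> 0" "\<And>h \<epsilon> t. continuous_on {0..T} h \<Longrightarrow> (\<And>s. s \<in> {0..T} \<Longrightarrow> \<bar>h s\<bar> \<le> \<epsilon>) \<Longrightarrow> t \<in> {0..T} \<Longrightarrow> \<bar>Caputo \<alpha> h t\<bar> \<le> K * \<epsilon>"
    using Caputo_bound by blast
  \<comment> \<open>The functions will differ by at most 2 T e and the fractional derivatives by at
    most 2 K e; \<open>e\<close> is chosen so that T (m e)^p is half of epsilon.\<close>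
  define m where "m = max (2 * T) (2 * K) + 1"
  define e where "e = (\<epsilon> / (2 * T)) powr (1 / p) / m"
  have m: "m > 0" "2 * T \<le> m" "2 * K \<le> m" using T_pos by (auto simp: m_def)
  have e: "e > 0" using \<epsilon> T_pos m by (simp add: e_def)
  have small: "N x < \<epsilon>" if "x \<in> Lp_fun T p" "\<And>t. t \<in> {0..T} \<Longrightarrow> \<bar>x t\<bar> \<le> m * e" for x
  proof -
    have "N x \<le> T * (m * e) powr p" by (rule Lp_int_le_const[OF T_pos p_pos that])
    also have "\<dots> = \<epsilon> / 2" using m T_pos \<epsilon> p_pos by (simp add: e_def powr_powr)
    finally show ?thesis using \<epsilon> by simp
  qed
  obtain q where q: "poly q 0 = 0" "\<And>t. t \<in> {0..T} \<Longrightarrow> \<bar>poly (pderiv q) t - g t\<bar> < e"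
    using polynomial_antiderivative_approx[OF cg e] by blast
  have q_u: "\<bar>poly q t - u t\<bar> \<le> e * t" if t: "t \<in> {0..T}" for t
  proof -
    have "norm ((poly q t - u t) - (poly q 0 - u 0)) \<le> e * norm (t - 0)"
    proof (rule field_differentiable_bound[where S = "{0..T}" and f' = "\<lambda>t. poly (pderiv q) t - g t"])
      show "((\<lambda>t. poly q t - u t) has_field_derivative poly (pderiv q) z - g z) (at z within {0..T})"
        if "z \<in> {0..T}" for z
        using that assms by (intro DERIV_diff DERIV_subset[OF poly_DERIV]) (auto simp: C1_pair_def)
      show "norm (poly (pderiv q) z - g z) \<le> e" if "z \<in> {0..T}" for z using q(2)[OF that] by simp
    qed (use t T_pos in auto)
    then show ?thesis using q(1) assms t by (simp add: C1_pair_def)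
  qed
  \<comment> \<open>The slope that cancels the value at T. As u vanishes there,
    \<open>poly q T\<close> is at most e T in modulus.\<close>
  define c where "c = poly q T / T"
  have c: "\<bar>c\<bar> \<le> e"
    using q_u[of T] assms T_pos by (simp add: c_def C1_pair_def abs_divide divide_le_eq)
  define r where "r = q - [:0, c:]"
  have dr: "poly (pderiv r) t = poly (pderiv q) t - c" "poly r t = poly q t - c * t" for t
    by (simp_all add: r_def pderiv_diff pderiv_pCons)
  have rC: "poly r \<in> C0_inf T" using smooth_Icc_poly q(1) T_pos by (simp add: C0_inf_def dr c_def)
  have r1: "C1_pair T (poly r) (poly (pderiv r))"
    using rC by (auto simp: C1_pair_def C0_inf_def intro!: continuous_intros DERIV_subset[OF poly_DERIV])
  have "N (\<lambda>t. poly r t - u t) < \<epsilon>"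
  proof (rule small)
    show "(\<lambda>t. poly r t - u t) \<in> Lp_fun T p" by (intro Lp_fun_diff p_pos uL C0_inf_Lp rC)
    fix t assume t: "t \<in> {0..T}"
    have "\<bar>poly r t - u t\<bar> \<le> \<bar>poly q t - u t\<bar> + \<bar>c\<bar> * \<bar>t\<bar>"
      unfolding dr by (simp flip: abs_mult)
    also have "\<dots> \<le> e * T + e * T"
      using q_u[OF t] c e t by (intro add_mono mult_mono order_trans[OF q_u[OF t] mult_left_mono]) auto
    also have "\<dots> = (2 * T) * e" by simp
    also have "\<dots> \<le> m * e" using m e by (intro mult_right_mono) auto
    finally show "\<bar>poly r t - u t\<bar> \<le> m * e" .
  qed
  moreover have "N (\<lambda>t. RL_deriv \<alpha> (poly r) t - Caputo \<alpha> g t) < \<epsilon>"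
    unfolding Lp_int_RL_deriv[OF r1 CL]
  proof (rule small)
    show "(\<lambda>t. Caputo \<alpha> (poly (pderiv r)) t - Caputo \<alpha> g t) \<in> Lp_fun T p"
      by (intro Lp_fun_diff p_pos CL RL_deriv_Lp_fun[OF r1])
    fix t assume t: "t \<in> {0..T}"
    have ch: "continuous_on {0..T} (\<lambda>s. poly (pderiv r) s - g s)" by (intro continuous_intros cg)
    have "Caputo \<alpha> (poly (pderiv r)) t - Caputo \<alpha> g t = Caputo \<alpha> (\<lambda>s. poly (pderiv r) s - g s) t"
      using Caputo_lincomb[of "poly (pderiv r)" g t 1 "-1"] cg t by (simp add: continuous_intros)
    also have "\<bar>\<dots>\<bar> \<le> K * (2 * e)"
    proof (rule K(2)[OF ch _ t])
      fix s assume "s \<in> {0..T}"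
      then show "\<bar>poly (pderiv r) s - g s\<bar> \<le> 2 * e" using q(2)[of s] c unfolding dr by linarith
    qed
    also have "\<dots> = (2 * K) * e" by simp
    also have "\<dots> \<le> m * e" using m e by (intro mult_right_mono) auto
    finally show "\<bar>Caputo \<alpha> (poly (pderiv r)) t - Caputo \<alpha> g t\<bar> \<le> m * e" .
  qed
  ultimately show "\<exists>\<phi>\<in>C0_inf T. N (\<lambda>t. \<phi> t - u t) < \<epsilon> \<and> N (\<lambda>t. RL_deriv \<alpha> \<phi> t - Caputo \<alpha> g t) < \<epsilon>"
    using rC by blast
qed

text \<open>Squaring the positive part removes its corner, since the derivative of (max 0 y)^2 is
  the continuous function 2 max 0 y. One continuous derivative is enough for membership, so no
  smooth bump has to be built.\<close>

lemma bump_in_E0: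
  assumes "0 \<le> c" "c < d" "d \<le> T"
  defines "u \<equiv> \<lambda>t::real. (max 0 ((t - c) * (d - t)))\<^sup>2"
  shows "continuous_on {0..T} u" "\<exists>w. H u w" "\<And>t. t \<notin> {c<..<d} \<Longrightarrow> u t = 0" "\<And>t. t \<in> {c<..<d} \<Longrightarrow> u t > 0"
proof -
  define g where "g t = 2 * max 0 ((t - c) * (d - t)) * (c + d - 2 * t)" for t :: real
  show out: "u t = 0" if "t \<notin> {c<..<d}" for t
  proof -
    have "(t - c) * (d - t) \<le> 0"
      using that assms by (cases "t \<le> c") (auto intro: mult_nonpos_nonneg mult_nonneg_nonpos)
    then show ?thesis by (simp add: u_def max_def)
  qed
  show "u t > 0" if "t \<in> {c<..<d}" for t
    using that by (auto simp: u_def max_def not_le)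
  have sq: "((\<lambda>y::real. (max 0 y)\<^sup>2) has_real_derivative 2 * max 0 y) (at y)" for y
  proof -
    consider "y > 0" | "y < 0" | "y = 0" by linarith
    then show ?thesis
    proof cases
      case 1
      have "((\<lambda>y::real. y\<^sup>2) has_real_derivative 2 * max 0 y) (at y)"
        using 1 by (auto intro!: derivative_eq_intros)
      then show ?thesis
        by (rule has_field_derivative_transform_within_open[of _ _ _ "{0<..}"]) (use 1 in auto)
    next
      case 2
      have "((\<lambda>y::real. 0) has_real_derivative 2 * max 0 y) (at y)" using 2 by simp
      then show ?thesis
        by (rule has_field_derivative_transform_within_open[of _ _ _ "{..<0}"]) (use 2 in auto)
    next
      case 3
      have "((\<lambda>h::real. (max 0 h)\<^sup>2 / h) \<longlongrightarrow> 0) (at 0)"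
      proof (rule Lim_null_comparison)
        show "\<forall>\<^sub>F h::real in at 0. norm ((max 0 h)\<^sup>2 / h) \<le> \<bar>h\<bar>"
          by (intro always_eventually allI) (auto simp: max_def power2_eq_square)
        show "(abs \<longlongrightarrow> 0) (at (0::real))" by (rule tendsto_eq_intros) (auto intro: tendsto_eq_intros)
      qed
      then show ?thesis using 3 by (simp add: has_field_derivative_iff)
    qed
  qed
  have "(u has_real_derivative g t) (at t)" for t
  proof -
    have "((\<lambda>t. (t - c) * (d - t)) has_real_derivative (c + d - 2 * t)) (at t)"
      by (auto intro!: derivative_eq_intros)
    from DERIV_chain2[OF sq this] show ?thesis by (simp add: u_def g_def)
  qed
  then have "C1_pair T u g"
    unfolding C1_pair_def using out[of 0] out[of T] assms(1-3)
    by (auto intro: DERIV_subset simp: g_def intro!: continuous_intros)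
  then show "continuous_on {0..T} u" "\<exists>w. H u w" using C1_pair_has_frac_deriv C1_pair_continuous by blast+
qed

end

section \<open>Perturbing the norm and the potential\<close>

context frac_space
begin

section \<open>Convexity and perturbation estimates for the norm\<close>

lemma Lp_fun_half_sum:
  assumes "x \<in> Lp_fun T p" "y \<in> Lp_fun T p"
  shows "(\<lambda>t. (x t + y t) / 2) \<in> Lp_fun T p"
  using Lp_fun_lincomb[OF assms, of "1/2" "1/2"] by (simp add: add_divide_distrib)

lemma Lp_int_uniformly_convex:
  assumes "\<epsilon> > 0"
  obtains C where "C \<ge> 0" "\<And>x y. x \<in> Lp_fun T p \<Longrightarrow> y \<in> Lp_fun T p \<Longrightarrow>
    N (\<lambda>t. x t - y t) \<le> \<epsilon> * (N x + N y) + C * ((N x + N y) / 2 - N (\<lambda>t. (x t + y t) / 2))"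
proof -
  obtain C where C: "C \<ge> 0" "\<And>x y::real. \<bar>x - y\<bar> powr p \<le> \<epsilon> * (\<bar>x\<bar> powr p + \<bar>y\<bar> powr p)
      + C * ((\<bar>x\<bar> powr p + \<bar>y\<bar> powr p) / 2 - \<bar>(x + y) / 2\<bar> powr p)"
    using powr_uniformly_convex[OF p_gt_1 assms] by blast
  show ?thesis
  proof (rule that[OF C(1)])
    fix x y assume xy: "x \<in> Lp_fun T p" "y \<in> Lp_fun T p"
    note i = Lp_funD(2)[OF xy(1)] Lp_funD(2)[OF xy(2)] Lp_funD(2)[OF Lp_fun_half_sum[OF xy]]
      Lp_funD(2)[OF Lp_fun_diff(1)[OF p_pos xy]]
    have "N (\<lambda>t. x t - y t) \<le> (LINT t|lebesgue_on {0..T}. \<epsilon> * (\<bar>x t\<bar> powr p + \<bar>y t\<bar> powr p)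
      + C * ((\<bar>x t\<bar> powr p + \<bar>y t\<bar> powr p) / 2 - \<bar>(x t + y t) / 2\<bar> powr p))"
      unfolding Lp_int_def by (intro integral_mono C(2)) (use i in simp_all)
    also have "\<dots> = \<epsilon> * (N x + N y) + C * ((N x + N y) / 2 - N (\<lambda>t. (x t + y t) / 2))"
      unfolding Lp_int_def using i by simp
    finally show "N (\<lambda>t. x t - y t) \<le> \<epsilon> * (N x + N y) + C * ((N x + N y) / 2 - N (\<lambda>t. (x t + y t) / 2))" .
  qed
qed

text \<open>For the conjugate exponent q one has (p - 1) q = p, so |w|^(p-1) lies in L^q and pairs
  with h.\<close>

lemma Lp_cross_term:
  assumes "w \<in> Lp_fun T p" "h \<in> Lp_fun T p"
  shows "integrable (lebesgue_on {0..T}) (\<lambda>t. \<bar>w t\<bar> powr (p - 1) * \<bar>h t\<bar>)"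
    and "(LINT t|lebesgue_on {0..T}. \<bar>w t\<bar> powr (p - 1) * \<bar>h t\<bar>) \<le> N w powr (1 - 1 / p) * N h powr (1 / p)"
proof -
  define q where "q = p / (p - 1)"
  have pq: "1 < q" "1 / q + 1 / p = 1" "1 / q = 1 - 1 / p" "(p - 1) * q = p"
    using p_gt_1 by (auto simp: q_def field_simps)
  note [measurable] = Lp_funD(1)[OF assms(1)] Lp_funD(1)[OF assms(2)]
  have i: "integrable (lebesgue_on {0..T}) (\<lambda>x. \<bar>\<bar>w x\<bar> powr (p - 1)\<bar> powr q)"
    "integrable (lebesgue_on {0..T}) (\<lambda>x. \<bar>\<bar>h x\<bar>\<bar> powr p)"
    using Lp_funD(2)[OF assms(1)] Lp_funD(2)[OF assms(2)] by (simp_all add: powr_powr pq(4))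
  show "integrable (lebesgue_on {0..T}) (\<lambda>t. \<bar>w t\<bar> powr (p - 1) * \<bar>h t\<bar>)"
    by (rule Hoelder_integrable[OF pq(1) p_gt_1 pq(2) _ _ i]) measurable
  show "(LINT t|lebesgue_on {0..T}. \<bar>w t\<bar> powr (p - 1) * \<bar>h t\<bar>) \<le> N w powr (1 - 1 / p) * N h powr (1 / p)"
    using Hoelder_inequality[OF pq(1) p_gt_1 pq(2) _ _ i]
    by (simp add: Lp_int_def abs_mult powr_powr pq(3,4))
qed

lemma Lp_int_Lipschitz:
  obtains C where "C \<ge> 0" "\<And>w h. w \<in> Lp_fun T p \<Longrightarrow> h \<in> Lp_fun T p \<Longrightarrow>
    \<bar>N (\<lambda>t. w t + h t) - N w\<bar> \<le> C * (N w powr (1 - 1 / p) * N h powr (1 / p) + N h)"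
proof -
  define C where "C = p * 2 powr (p - 1)"
  have C: "C \<ge> 0" using p_pos by (simp add: C_def)
  show ?thesis
  proof (rule that[OF C])
    fix w h assume wh: "w \<in> Lp_fun T p" "h \<in> Lp_fun T p"
    note i = Lp_funD(2)[OF wh(1)] Lp_funD(2)[OF wh(2)] Lp_funD(2)[OF Lp_fun_add(1)[OF p_pos wh]]
      Lp_cross_term(1)[OF wh]
    have "\<bar>N (\<lambda>t. w t + h t) - N w\<bar> = \<bar>LINT t|lebesgue_on {0..T}. \<bar>w t + h t\<bar> powr p - \<bar>w t\<bar> powr p\<bar>"
      unfolding Lp_int_def using i by simp
    also have "\<dots> \<le> (LINT t|lebesgue_on {0..T}. \<bar>\<bar>w t + h t\<bar> powr p - \<bar>w t\<bar> powr p\<bar>)"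
      by (rule integral_abs_bound)
    also have "\<dots> \<le> (LINT t|lebesgue_on {0..T}. C * (\<bar>w t\<bar> powr (p - 1) * \<bar>h t\<bar> + \<bar>h t\<bar> powr p))"
      unfolding C_def by (intro integral_mono abs_powr_diff_le p_gt_1) (use i in simp_all)
    also have "\<dots> = C * ((LINT t|lebesgue_on {0..T}. \<bar>w t\<bar> powr (p - 1) * \<bar>h t\<bar>) + N h)"
      unfolding Lp_int_def using i by simp
    also have "\<dots> \<le> C * (N w powr (1 - 1 / p) * N h powr (1 / p) + N h)"
      using C Lp_cross_term(2)[OF wh] by (intro mult_left_mono add_mono) auto
    finally show "\<bar>N (\<lambda>t. w t + h t) - N w\<bar> \<le> C * (N w powr (1 - 1 / p) * N h powr (1 / p) + N h)" .
  qed
qed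

text \<open>For fixed w the right side is epsilon times a constant times the norm of h, plus a p-th
  power of that norm; as p > 1 the second difference is of smaller order than the norm.\<close>

lemma Lp_int_second_difference:
  assumes "\<epsilon> > 0"
  obtains C where "C \<ge> 0" "\<And>w h. w \<in> Lp_fun T p \<Longrightarrow> h \<in> Lp_fun T p \<Longrightarrow>
    N (\<lambda>t. w t + h t) + N (\<lambda>t. w t - h t) - 2 * N w \<le> \<epsilon> * (N w powr (1 - 1 / p) * N h powr (1 / p)) + C * N h"
proof -
  obtain C where C: "C \<ge> 0" "\<And>x y::real. \<bar>x + y\<bar> powr p + \<bar>x - y\<bar> powr p - 2 * \<bar>x\<bar> powr p
      \<le> \<epsilon> * (\<bar>x\<bar> powr (p - 1) * \<bar>y\<bar>) + C * \<bar>y\<bar> powr p"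
    using powr_second_difference_small[OF p_gt_1 assms] by blast
  show ?thesis
  proof (rule that[OF C(1)])
    fix w h assume wh: "w \<in> Lp_fun T p" "h \<in> Lp_fun T p"
    note i = Lp_funD(2)[OF wh(1)] Lp_funD(2)[OF wh(2)] Lp_funD(2)[OF Lp_fun_add(1)[OF p_pos wh]]
      Lp_funD(2)[OF Lp_fun_diff(1)[OF p_pos wh]] Lp_cross_term(1)[OF wh]
    have "N (\<lambda>t. w t + h t) + N (\<lambda>t. w t - h t) - 2 * N w
      = (LINT t|lebesgue_on {0..T}. \<bar>w t + h t\<bar> powr p + \<bar>w t - h t\<bar> powr p - 2 * \<bar>w t\<bar> powr p)"
      unfolding Lp_int_def using i by simp
    also have "\<dots> \<le> (LINT t|lebesgue_on {0..T}. \<epsilon> * (\<bar>w t\<bar> powr (p - 1) * \<bar>h t\<bar>) + C * \<bar>h t\<bar> powr p)"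
      by (intro integral_mono C(2)) (use i in simp_all)
    also have "\<dots> = \<epsilon> * (LINT t|lebesgue_on {0..T}. \<bar>w t\<bar> powr (p - 1) * \<bar>h t\<bar>) + C * N h"
      unfolding Lp_int_def using i by simp
    also have "\<dots> \<le> \<epsilon> * (N w powr (1 - 1 / p) * N h powr (1 / p)) + C * N h"
      using assms Lp_cross_term(2)[OF wh] by (intro add_right_mono mult_left_mono) auto
    finally show "N (\<lambda>t. w t + h t) + N (\<lambda>t. w t - h t) - 2 * N w
      \<le> \<epsilon> * (N w powr (1 - 1 / p) * N h powr (1 / p)) + C * N h" .
  qed
qed

end

section \<open>The nonlinearity and its potential\<close>

locale kirchhoff = frac_space +
  fixes a b r1 :: real and f :: "real \<Rightarrow> real \<Rightarrow> real" and d :: "real \<Rightarrow> real"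
  assumes a_pos: "a > 0" and b_pos: "b > 0"
    and f_cont: "continuous_on ({0..T} \<times> UNIV) (\<lambda>(t, x). f t x)"
    and r1_gt: "1 < r1" and r1_less: "r1 < p\<^sup>2"
    and d_int: "integrable (lebesgue_on {0..T}) d" and d_nonneg: "\<And>t. t \<in> {0..T} \<Longrightarrow> 0 \<le> d t"
    and f_bound: "\<And>t x. t \<in> {0..T} \<Longrightarrow> \<bar>f t x\<bar> \<le> r1 * d t * \<bar>x\<bar> powr (r1 - 1)"
begin

text \<open>An antiderivative A on the whole line writes the oriented integral as A x - A 0, which
  treats both signs of x at once.\<close>

lemma primitive_deriv:
  assumes t: "t \<in> {0..T}"
  shows "(primitive f t has_real_derivative f t x) (at x)" and "primitive f t 0 = 0"
proof -
  have "continuous_on UNIV (\<lambda>x. (\<lambda>(t, x). f t x) (t, x))"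
    by (rule continuous_on_compose2[OF f_cont]) (use t in \<open>auto intro!: continuous_intros\<close>)
  then have c: "continuous_on UNIV (f t)" by simp
  have "\<exists>A. \<forall>x::real. - \<infinity> < ereal x \<longrightarrow> ereal x < \<infinity> \<longrightarrow> (A has_vector_derivative f t x) (at x)"
    by (rule einterval_antiderivative) (use c in \<open>auto simp: continuous_on_eq_continuous_at\<close>)
  then obtain A where A: "\<And>x. (A has_vector_derivative f t x) (at x)" by auto
  have eq: "primitive f t x = A x - A 0" for x
    using interval_integral_FTC_finite[of 0 x "f t" A] A c
    by (auto simp: primitive_def zero_ereal_def intro: continuous_on_subset has_vector_derivative_at_within)
  show "primitive f t 0 = 0" by (simp add: eq)
  have "(A has_real_derivative f t x) (at x)" using A by (simp add: has_real_derivative_iff_has_vector_derivative)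
  then have "((\<lambda>x. A x - A 0) has_real_derivative f t x) (at x)"
    by (auto intro!: derivative_eq_intros)
  moreover have "primitive f t = (\<lambda>x. A x - A 0)" using eq by (simp add: fun_eq_iff)
  ultimately show "(primitive f t has_real_derivative f t x) (at x)" by simp
qed

lemma primitive_MVT:
  assumes "t \<in> {0..T}"
  obtains z where "min x y \<le> z" "z \<le> max x y" "primitive f t y - primitive f t x = (y - x) * f t z"
proof -
  consider "x < y" | "y < x" | "x = y" by linarith
  then show ?thesis
  proof cases
    case 1
    then obtain z where "x < z" "z < y" "primitive f t y - primitive f t x = (y - x) * f t z"
      using MVT2[OF 1, of "primitive f t" "f t"] primitive_deriv(1)[OF assms] by auto
    then show ?thesis using that[of z] by auto
  next
    case 2
    then obtain z where "y < z" "z < x" "primitive f t x - primitive f t y = (x - y) * f t z"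
      using MVT2[OF 2, of "primitive f t" "f t"] primitive_deriv(1)[OF assms] by auto
    then show ?thesis using that[of z] by (auto simp: algebra_simps)
  next
    case 3
    then show ?thesis using that[of x] by auto
  qed
qed

text \<open>The mean value theorem in place of integrating the bound on f: it costs a factor r1,
  which the later growth comparison tolerates.\<close>

lemma primitive_bound:
  assumes t: "t \<in> {0..T}"
  shows "\<bar>primitive f t x\<bar> \<le> r1 * d t * \<bar>x\<bar> powr r1"
proof -
  obtain z where z: "min 0 x \<le> z" "z \<le> max 0 x" "primitive f t x - primitive f t 0 = (x - 0) * f t z"
    using primitive_MVT[OF t] .
  have "\<bar>primitive f t x\<bar> = \<bar>x\<bar> * \<bar>f t z\<bar>" using z(3) primitive_deriv(2)[OF t] by (simp add: abs_mult)
  also have "\<dots> \<le> \<bar>x\<bar> * (r1 * d t * \<bar>z\<bar> powr (r1 - 1))" by (intro mult_left_mono f_bound t) auto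
  also have "\<dots> \<le> \<bar>x\<bar> * (r1 * d t * \<bar>x\<bar> powr (r1 - 1))"
    using z(1,2) r1_gt d_nonneg[OF t] by (intro mult_left_mono powr_mono2) auto
  also have "\<dots> = r1 * d t * \<bar>x\<bar> powr r1"
    by (cases "x = 0") (auto simp: powr_diff)
  finally show ?thesis .
qed

text \<open>Rescaling F(t, x) to the integral of x f(t, s x) over s in [0, 1] fixes the domain of
  integration, so continuity of parameter integrals applies.\<close>

lemma primitive_continuous:
  assumes u: "continuous_on {0..T} u"
  shows "continuous_on {0..T} (\<lambda>t. primitive f t (u t))"
proof -
  have eq: "primitive f t (u t) = integral {0..1} (\<lambda>s. u t * f t (s * u t))" if t: "t \<in> {0..T}" for t
  proof -
    have "((\<lambda>s. u t * f t (s * u t)) has_integral primitive f t (1 * u t) - primitive f t (0 * u t)) {0..1}"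
    proof (rule fundamental_theorem_of_calculus)
      fix s :: real
      have "((\<lambda>s. s * u t) has_real_derivative u t) (at s)" by (auto intro!: derivative_eq_intros)
      from DERIV_chain2[OF primitive_deriv(1)[OF t] this]
      have "((\<lambda>s. primitive f t (s * u t)) has_real_derivative u t * f t (s * u t)) (at s)" by (simp add: mult.commute)
      then show "((\<lambda>s. primitive f t (s * u t)) has_vector_derivative u t * f t (s * u t)) (at s within {0..1})"
        by (auto simp: has_real_derivative_iff_has_vector_derivative intro: has_vector_derivative_at_within)
    qed simp
    from integral_unique[OF this] show ?thesis
      using primitive_deriv(2)[OF t] by (simp del: integral_mult_right)
  qed
  have cu: "continuous_on ({0..T} \<times> {0..1::real}) (\<lambda>z. u (fst z))"
    by (rule continuous_on_compose2[OF u]) (auto intro!: continuous_intros)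
  have "continuous_on ({0..T} \<times> {0..1::real}) (\<lambda>z. (\<lambda>(t, x). f t x) (fst z, snd z * u (fst z)))"
    by (rule continuous_on_compose2[OF f_cont]) (auto intro!: continuous_intros cu)
  then have "continuous_on ({0..T} \<times> {0..1::real}) (\<lambda>z. u (fst z) * f (fst z) (snd z * u (fst z)))"
    by (intro continuous_on_mult cu) simp
  then have "continuous_on ({0..T} \<times> cbox 0 (1::real)) (\<lambda>(t, s). u t * f t (s * u t))"
    by (simp add: case_prod_beta)
  from integral_continuous_on_param[OF this]
  have "continuous_on {0..T} (\<lambda>t. integral {0..1} (\<lambda>s. u t * f t (s * u t)))" by simp
  then show ?thesis by (rule continuous_on_eq) (simp add: eq)
qed

definition potential :: "(real \<Rightarrow> real) \<Rightarrow> real" where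
  "potential u = (LINT t|lebesgue_on {0..T}. primitive f t (u t))"

lemma primitive_integrable:
  "continuous_on {0..T} u \<Longrightarrow> integrable (lebesgue_on {0..T}) (\<lambda>t. primitive f t (u t))"
  by (intro integrable_continuous_Icc primitive_continuous)

lemma f_compact_bound:
  obtains K where "K \<ge> 0" "\<And>t x. t \<in> {0..T} \<Longrightarrow> \<bar>x\<bar> \<le> R \<Longrightarrow> \<bar>f t x\<bar> \<le> K"
proof -
  have "compact ((\<lambda>(t, x). f t x) ` ({0..T} \<times> {-R..R}))"
    by (intro compact_continuous_image continuous_on_subset[OF f_cont] compact_Times) auto
  then obtain K where K: "K > 0" "\<And>y. y \<in> (\<lambda>(t, x). f t x) ` ({0..T} \<times> {-R..R}) \<Longrightarrow> norm y \<le> K"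
    using compact_imp_bounded bounded_pos by metis
  have "\<bar>f t x\<bar> \<le> K" if "t \<in> {0..T}" "\<bar>x\<bar> \<le> R" for t x
  proof -
    have "f t x \<in> (\<lambda>(t, x). f t x) ` ({0..T} \<times> {-R..R})"
      by (rule image_eqI[of _ _ "(t, x)"]) (use that in auto)
    from K(2)[OF this] show ?thesis by simp
  qed
  then show ?thesis using that[of K] K(1) by auto
qed

lemma integral_le_const:
  assumes "integrable (lebesgue_on {0..T}) h" "\<And>t. t \<in> {0..T} \<Longrightarrow> h t \<le> c"
  shows "(LINT t|lebesgue_on {0..T}. h t) \<le> T * c"
proof -
  have "(LINT t|lebesgue_on {0..T}. h t) \<le> (LINT t|lebesgue_on {0..T}. c)"
    using assms by (intro integral_mono integrable_const_ivl) auto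
  then show ?thesis using T_pos by (simp add: measure_restrict_space)
qed

text \<open>The intermediate points of the mean value theorem stay between u and v, hence in the
  compact strip of height R, where f is bounded. \<open>K\<close> depends on R alone and so serves a
  whole bounded sequence.\<close>

lemma potential_Lipschitz:
  obtains K where "K \<ge> 0" "\<And>u v \<epsilon>. continuous_on {0..T} u \<Longrightarrow> continuous_on {0..T} v \<Longrightarrow>
    (\<And>t. t \<in> {0..T} \<Longrightarrow> \<bar>u t\<bar> \<le> R) \<Longrightarrow> (\<And>t. t \<in> {0..T} \<Longrightarrow> \<bar>v t\<bar> \<le> R) \<Longrightarrow>
    (\<And>t. t \<in> {0..T} \<Longrightarrow> \<bar>u t - v t\<bar> \<le> \<epsilon>) \<Longrightarrow> \<bar>potential u - potential v\<bar> \<le> K * \<epsilon>"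
proof -
  obtain K where K: "K \<ge> 0" "\<And>t x. t \<in> {0..T} \<Longrightarrow> \<bar>x\<bar> \<le> R \<Longrightarrow> \<bar>f t x\<bar> \<le> K"
    using f_compact_bound by blast
  show ?thesis
  proof (rule that[of "T * K"])
    show "0 \<le> T * K" using K T_pos by simp
    fix u v \<epsilon> assume cu: "continuous_on {0..T} u" and cv: "continuous_on {0..T} v"
      and R: "\<And>t. t \<in> {0..T} \<Longrightarrow> \<bar>u t\<bar> \<le> R" "\<And>t. t \<in> {0..T} \<Longrightarrow> \<bar>v t\<bar> \<le> R"
      and uv: "\<And>t. t \<in> {0..T} \<Longrightarrow> \<bar>u t - v t\<bar> \<le> \<epsilon>"
    note i = primitive_integrable[OF cu] primitive_integrable[OF cv]
    have "\<bar>potential u - potential v\<bar> = \<bar>LINT t|lebesgue_on {0..T}. primitive f t (u t) - primitive f t (v t)\<bar>"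
      unfolding potential_def using i by simp
    also have "\<dots> \<le> (LINT t|lebesgue_on {0..T}. \<bar>primitive f t (u t) - primitive f t (v t)\<bar>)"
      by (rule integral_abs_bound)
    also have "\<dots> \<le> T * (K * \<epsilon>)"
    proof (rule integral_le_const)
      show "integrable (lebesgue_on {0..T}) (\<lambda>t. \<bar>primitive f t (u t) - primitive f t (v t)\<bar>)" using i by simp
      fix t assume t: "t \<in> {0..T}"
      obtain z where z: "min (v t) (u t) \<le> z" "z \<le> max (v t) (u t)"
        "primitive f t (u t) - primitive f t (v t) = (u t - v t) * f t z"
        using primitive_MVT[OF t] .
      have "\<bar>z\<bar> \<le> R" using z(1,2) R[OF t] by linarith
      then have "\<bar>u t - v t\<bar> * \<bar>f t z\<bar> \<le> \<epsilon> * K" using K(2)[OF t] uv[OF t] by (intro mult_mono) auto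
      then show "\<bar>primitive f t (u t) - primitive f t (v t)\<bar> \<le> K * \<epsilon>" by (simp add: z(3) abs_mult mult.commute)
    qed
    finally show "\<bar>potential u - potential v\<bar> \<le> T * K * \<epsilon>" by (simp add: mult.assoc)
  qed
qed

definition growth_const :: real where "growth_const = r1 * (LINT t|lebesgue_on {0..T}. d t)"

lemma growth_const_nonneg: "growth_const \<ge> 0"
  unfolding growth_const_def using r1_gt d_nonneg by (intro mult_nonneg_nonneg integral_nonneg_AE AE_I2) auto

lemma potential_bound:
  assumes u: "continuous_on {0..T} u" and R: "\<And>t. t \<in> {0..T} \<Longrightarrow> \<bar>u t\<bar> \<le> R"
  shows "\<bar>potential u\<bar> \<le> growth_const * R powr r1"
proof -
  have "\<bar>potential u\<bar> \<le> (LINT t|lebesgue_on {0..T}. \<bar>primitive f t (u t)\<bar>)"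
    unfolding potential_def by (rule integral_abs_bound)
  also have "\<dots> \<le> (LINT t|lebesgue_on {0..T}. r1 * R powr r1 * d t)"
  proof (rule integral_mono)
    fix t assume "t \<in> space (lebesgue_on {0..T})"
    then have t: "t \<in> {0..T}" by simp
    have "\<bar>primitive f t (u t)\<bar> \<le> r1 * d t * \<bar>u t\<bar> powr r1" by (rule primitive_bound[OF t])
    also have "\<dots> \<le> r1 * d t * R powr r1"
      using r1_gt d_nonneg[OF t] R[OF t] by (intro mult_left_mono powr_mono2) auto
    finally show "\<bar>primitive f t (u t)\<bar> \<le> r1 * R powr r1 * d t" by (simp add: mult_ac)
  qed (use primitive_integrable[OF u] d_int in simp_all)
  finally show ?thesis by (simp add: growth_const_def mult_ac)
qed

text \<open>Two applications of the mean value theorem turn the second difference into v (f(t, z') -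
  f(t, z)) with z and z' close to u. Uniform continuity of f makes the bracket small, so no
  derivative of f is involved.\<close>

lemma potential_second_difference:
  assumes u: "continuous_on {0..T} u" and \<epsilon>: "\<epsilon> > 0"
  obtains \<delta> where "\<delta> > 0" "\<And>v m. continuous_on {0..T} v \<Longrightarrow> (\<And>t. t \<in> {0..T} \<Longrightarrow> \<bar>v t\<bar> \<le> m) \<Longrightarrow> m < \<delta> \<Longrightarrow>
    2 * potential u - potential (\<lambda>t. u t + v t) - potential (\<lambda>t. u t - v t) \<le> \<epsilon> * m"
proof -
  have "compact (u ` {0..T})" by (intro compact_continuous_image u) auto
  then obtain R where R: "\<And>t. t \<in> {0..T} \<Longrightarrow> \<bar>u t\<bar> \<le> R"
    using compact_imp_bounded bounded_iff by (metis image_eqI real_norm_def)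
  \<comment> \<open>The margin 1 leaves room for the points between u and u + v or u - v.\<close>
  have "uniformly_continuous_on ({0..T} \<times> {-(R+1)..R+1}) (\<lambda>(t, x). f t x)"
    by (intro compact_uniformly_continuous continuous_on_subset[OF f_cont] compact_Times) auto
  then obtain e where e: "e > 0" "\<And>z z'. z \<in> {0..T} \<times> {-(R+1)..R+1} \<Longrightarrow> z' \<in> {0..T} \<times> {-(R+1)..R+1} \<Longrightarrow>
     dist z' z < e \<Longrightarrow> dist ((\<lambda>(t, x). f t x) z') ((\<lambda>(t, x). f t x) z) < \<epsilon> / T"
    using \<epsilon> T_pos unfolding uniformly_continuous_on_def by (metis divide_pos_pos)
  have osc: "\<bar>f t x - f t y\<bar> \<le> \<epsilon> / T" if "t \<in> {0..T}" "\<bar>x\<bar> \<le> R + 1" "\<bar>y\<bar> \<le> R + 1" "\<bar>x - y\<bar> < e" for t x y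
    using e(2)[of "(t, y)" "(t, x)"] that by (auto simp: dist_Pair_Pair dist_real_def abs_le_iff)
  show ?thesis
  \<comment> \<open>The bound 1 keeps z and z' inside the strip, and e / 2 keeps their mutual
    distance below e.\<close>
  proof (rule that[of "min 1 (e / 2)"])
    show "0 < min 1 (e / 2)" using e by simp
    fix v m assume cv: "continuous_on {0..T} v" and m: "\<And>t. t \<in> {0..T} \<Longrightarrow> \<bar>v t\<bar> \<le> m" and small: "m < min 1 (e / 2)"
    have cs: "continuous_on {0..T} (\<lambda>t. u t + v t)" "continuous_on {0..T} (\<lambda>t. u t - v t)"
      by (intro continuous_intros u cv)+
    note i = primitive_integrable[OF u] primitive_integrable[OF cs(1)] primitive_integrable[OF cs(2)]
    have "2 * potential u - potential (\<lambda>t. u t + v t) - potential (\<lambda>t. u t - v t)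
      = (LINT t|lebesgue_on {0..T}. 2 * primitive f t (u t) - primitive f t (u t + v t) - primitive f t (u t - v t))"
      unfolding potential_def using i by simp
    also have "\<dots> \<le> T * (\<epsilon> / T * m)"
    proof (rule integral_le_const)
      show "integrable (lebesgue_on {0..T}) (\<lambda>t. 2 * primitive f t (u t) - primitive f t (u t + v t) - primitive f t (u t - v t))"
        using i by simp
      fix t assume t: "t \<in> {0..T}"
      obtain z where z: "min (u t) (u t + v t) \<le> z" "z \<le> max (u t) (u t + v t)"
        "primitive f t (u t + v t) - primitive f t (u t) = (u t + v t - u t) * f t z"
        using primitive_MVT[OF t] .
      obtain z' where z': "min (u t) (u t - v t) \<le> z'" "z' \<le> max (u t) (u t - v t)"
        "primitive f t (u t - v t) - primitive f t (u t) = (u t - v t - u t) * f t z'"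
        using primitive_MVT[OF t] .
      have "\<bar>f t z' - f t z\<bar> \<le> \<epsilon> / T"
        using z(1,2) z'(1,2) R[OF t] m[OF t] small by (intro osc t) linarith+
      then have "\<bar>v t\<bar> * \<bar>f t z' - f t z\<bar> \<le> m * (\<epsilon> / T)" using m[OF t] by (intro mult_mono) auto
      then have "\<bar>v t * (f t z' - f t z)\<bar> \<le> m * (\<epsilon> / T)" by (simp add: abs_mult)
      moreover have "2 * primitive f t (u t) - primitive f t (u t + v t) - primitive f t (u t - v t) = v t * (f t z' - f t z)"
        using z(3) z'(3) by (simp add: algebra_simps)
      ultimately show "2 * primitive f t (u t) - primitive f t (u t + v t) - primitive f t (u t - v t) \<le> \<epsilon> / T * m"
        by (simp add: mult.commute abs_le_iff)
    qed
    also have "\<dots> = \<epsilon> * m" using T_pos by simp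
    finally show "2 * potential u - potential (\<lambda>t. u t + v t) - potential (\<lambda>t. u t - v t) \<le> \<epsilon> * m" .
  qed
qed

end

section \<open>Minimization\<close>

context kirchhoff
begin

text \<open>The Kirchhoff term as a function of the p-th power of the norm. Its value at 0 is the
  constant subtracted in the energy.\<close>

definition \<psi> :: "real \<Rightarrow> real" where "\<psi> x = 1 / (b * p\<^sup>2) * (a + b * x) powr p"

definition pair_energy :: "(real \<Rightarrow> real) \<Rightarrow> (real \<Rightarrow> real) \<Rightarrow> real" where
  "pair_energy u w = \<psi> (N w) - potential u - \<psi> 0"

lemma energy_eq:
  assumes "H u w" "continuous_on {0..T} u"
  shows "energy T a b p \<alpha> f u = pair_energy u w"
  using E_norm_eq[OF assms] p_pos by (simp add: energy_def pair_energy_def \<psi>_def potential_def powr_powr)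

lemma \<psi>_strict_mono: "0 \<le> x \<Longrightarrow> x < y \<Longrightarrow> \<psi> x < \<psi> y"
  unfolding \<psi>_def using a_pos b_pos p_pos
  by (intro mult_strict_left_mono powr_less_mono2) (auto intro: add_pos_nonneg add_nonneg_nonneg)

lemma \<psi>_mono: "0 \<le> x \<Longrightarrow> x \<le> y \<Longrightarrow> \<psi> x \<le> \<psi> y"
  using \<psi>_strict_mono[of x y] by (cases "x = y") auto

lemma \<psi>_deriv:
  assumes "x \<ge> 0"
  shows "(\<psi> has_real_derivative 1 / p * (a + b * x) powr (p - 1)) (at x)"
proof -
  have "a + b * x > 0" using assms a_pos b_pos by (intro add_pos_nonneg) auto
  from has_real_derivative_powr[OF this, of p]
  have "((\<lambda>x. (a + b * x) powr p) has_real_derivative p * (a + b * x) powr (p - 1) * b) (at x)"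
    by (rule DERIV_chain2) (auto intro!: derivative_eq_intros)
  from DERIV_cmult[OF this, of "1 / (b * p\<^sup>2)"]
  show ?thesis using b_pos p_pos by (simp add: \<psi>_def[abs_def] power2_eq_square)
qed

lemma \<psi>_tendsto: "(x \<longlongrightarrow> l) F \<Longrightarrow> l \<ge> 0 \<Longrightarrow> ((\<lambda>n. \<psi> (x n)) \<longlongrightarrow> \<psi> l) F"
  using isCont_tendsto_compose[OF DERIV_isCont[OF \<psi>_deriv]] .

lemma sup_bound:
  assumes "H u w" "continuous_on {0..T} u" "N w \<le> X" "t \<in> {0..T}"
  shows "\<bar>u t\<bar> \<le> sup_const * X powr (1 / p)"
proof -
  have "\<bar>u t\<bar> \<le> sup_const * N w powr (1 / p)"
    using has_frac_deriv_RL_left(1)[OF assms(1,2,4)] RL_left_Lp_bound[OF has_frac_deriv_Lp(2)[OF assms(1)] assms(4)] by simp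
  also have "\<dots> \<le> sup_const * X powr (1 / p)" using assms p_pos sup_const_nonneg by (intro mult_left_mono powr_mono2) auto
  finally show ?thesis .
qed

text \<open>With x = \<open>N w\<close> the Kirchhoff term is at least k x^p and the potential at
  most c x^(r1/p). The condition r1 < p^2 says that the second exponent is below the first.\<close>

lemma pair_energy_coercive:
  obtains X where "X \<ge> 0" "\<And>u w. H u w \<Longrightarrow> continuous_on {0..T} u \<Longrightarrow> pair_energy u w \<le> K \<Longrightarrow> N w \<le> X"
proof -
  define k where "k = b powr p / (b * p\<^sup>2)"
  define \<sigma> where "\<sigma> = r1 / p"
  define c where "c = growth_const * sup_const powr r1"
  define M where "M = \<bar>K\<bar> + \<psi> 0"
  \<comment> \<open>Beyond X the difference k x^(p-sigma) - c is at least M + 1, and x > 1 allows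
    multiplication by x^sigma without loss.\<close>
  define X where "X = max 1 (((c + M + 1) / k) powr (1 / (p - \<sigma>)))"
  have k: "k > 0" using b_pos p_pos by (simp add: k_def)
  have \<sigma>: "\<sigma> < p" "\<sigma> > 0" using r1_less r1_gt p_pos by (simp_all add: \<sigma>_def divide_less_eq power2_eq_square)
  have c: "c \<ge> 0" using growth_const_nonneg by (simp add: c_def)
  have M: "M \<ge> 0" by (simp add: M_def \<psi>_def b_pos less_imp_le)
  show ?thesis
  proof (rule that[of X])
    show "X \<ge> 0" by (simp add: X_def)
    fix u w assume u: "H u w" "continuous_on {0..T} u" and le: "pair_energy u w \<le> K"
    show "N w \<le> X"
    proof (rule ccontr)
      define x where "x = N w"
      assume "\<not> N w \<le> X"
      then have x: "x > X" by (simp add: x_def)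
      then have x1: "x > 1" by (simp add: X_def)
      have "(c + M + 1) / k = (((c + M + 1) / k) powr (1 / (p - \<sigma>))) powr (p - \<sigma>)"
        using \<sigma> c M k by (simp add: powr_powr)
      also have "\<dots> \<le> x powr (p - \<sigma>)" using x \<sigma> by (intro powr_mono2) (auto simp: X_def)
      finally have "c + M + 1 \<le> k * x powr (p - \<sigma>)" using k by (simp add: field_simps)
      then have "1 * (M + 1) \<le> x powr \<sigma> * (k * x powr (p - \<sigma>) - c)"
        using x1 \<sigma> M by (intro mult_mono) (auto simp: ge_one_powr_ge_zero)
      also have "\<dots> = k * x powr p - c * x powr \<sigma>"
        using powr_add[of x \<sigma> "p - \<sigma>"] by (simp add: algebra_simps)
      finally have 1: "M + 1 \<le> k * x powr p - c * x powr \<sigma>" by simp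
      have "b powr p * x powr p \<le> (a + b * x) powr p"
        using a_pos b_pos x1 p_pos by (subst powr_mult[symmetric]) (auto intro!: powr_mono2)
      then have 2: "k * x powr p \<le> \<psi> x"
        using b_pos p_pos by (simp add: k_def \<psi>_def divide_right_mono)
      have "\<bar>potential u\<bar> \<le> growth_const * (sup_const * x powr (1 / p)) powr r1"
        using sup_bound[OF u order_refl] by (intro potential_bound u) (simp add: x_def)
      also have "\<dots> = c * x powr \<sigma>"
        using sup_const_nonneg by (simp add: c_def \<sigma>_def powr_mult powr_powr)
      finally have "pair_energy u w \<ge> k * x powr p - c * x powr \<sigma> - \<psi> 0"
        using 2 by (simp add: pair_energy_def x_def)
      then show False using 1 le by (simp add: M_def)
    qed
  qed
qed

lemma equicontinuity_modulus:
  assumes "X \<ge> 0" "e > 0"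
  obtains \<delta> where "\<delta> > 0" "\<And>u w s t. H u w \<Longrightarrow> continuous_on {0..T} u \<Longrightarrow> N w \<le> X \<Longrightarrow>
    s \<in> {0..T} \<Longrightarrow> t \<in> {0..T} \<Longrightarrow> \<bar>s - t\<bar> < \<delta> \<Longrightarrow> \<bar>u s - u t\<bar> < e"
proof -
  define C where "C = RL_const \<alpha> p * X powr (1 / p)"
  define \<kappa> where "\<kappa> = \<alpha> - 1 / p"
  have C: "C \<ge> 0" using RL_const_nonneg[OF \<alpha>_pos] by (simp add: C_def)
  have \<kappa>: "\<kappa> > 0" using \<alpha>_gt by (simp add: \<kappa>_def)
  show ?thesis
  proof (rule that[of "(e / (C + 1)) powr (1 / \<kappa>)"])
    show "0 < (e / (C + 1)) powr (1 / \<kappa>)" using assms C by simp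
    fix u w s t assume u: "H u w" "continuous_on {0..T} u" and X: "N w \<le> X" and st: "s \<in> {0..T}" "t \<in> {0..T}"
      and close: "\<bar>s - t\<bar> < (e / (C + 1)) powr (1 / \<kappa>)"
    have "\<bar>u s - u t\<bar> \<le> RL_const \<alpha> p * \<bar>s - t\<bar> powr \<kappa> * N w powr (1 / p)"
      using RL_left_Hoelder[OF p_gt_1 \<alpha>_gt \<alpha>_le_1 has_frac_deriv_Lp(2)[OF u(1)] st] has_frac_deriv_RL_left(1)[OF u] st by (simp add: \<kappa>_def)
    also have "\<dots> \<le> RL_const \<alpha> p * \<bar>s - t\<bar> powr \<kappa> * X powr (1 / p)"
      using X p_pos RL_const_nonneg[OF \<alpha>_pos] by (intro mult_left_mono powr_mono2) auto
    also have "\<dots> = C * \<bar>s - t\<bar> powr \<kappa>" by (simp add: C_def)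
    also have "\<dots> \<le> C * ((e / (C + 1)) powr (1 / \<kappa>)) powr \<kappa>"
      using close C \<kappa> by (intro mult_left_mono powr_mono2) auto
    also have "\<dots> = C * (e / (C + 1))" using \<kappa> C assms by (simp add: powr_powr)
    also have "\<dots> < e" using C assms by (simp add: field_simps)
    finally show "\<bar>u s - u t\<bar> < e" .
  qed
qed

lemma has_frac_deriv_zero: "H (\<lambda>_. 0) (\<lambda>_. 0)"
proof -
  have "C1_pair T (\<lambda>_. 0) (\<lambda>_. 0)" by (simp add: C1_pair_def)
  from has_frac_deriv_lincomb[OF C1_pair_has_frac_deriv[OF this] C1_pair_has_frac_deriv[OF this], of 0 0] show ?thesis by simp
qed

text \<open>By coercivity the pairs of nonpositive energy are bounded, and on bounded sets the
  potential is bounded; all other pairs have positive energy.\<close>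

lemma pair_energy_bounded_below: obtains B where "\<And>u w. H u w \<Longrightarrow> continuous_on {0..T} u \<Longrightarrow> B \<le> pair_energy u w"
proof -
  obtain X where X: "X \<ge> 0" "\<And>u w. H u w \<Longrightarrow> continuous_on {0..T} u \<Longrightarrow> pair_energy u w \<le> 0 \<Longrightarrow> N w \<le> X"
    using pair_energy_coercive[of 0] by blast
  define B where "B = - (growth_const * (sup_const * X powr (1 / p)) powr r1)"
  have B: "B \<le> 0" using growth_const_nonneg by (simp add: B_def)
  have "B \<le> pair_energy u w" if u: "H u w" "continuous_on {0..T} u" for u w
  proof (cases "pair_energy u w \<le> 0")
    case True
    have "\<bar>potential u\<bar> \<le> growth_const * (sup_const * X powr (1 / p)) powr r1"
      using sup_bound[OF u X(2)[OF u True]] by (intro potential_bound u)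
    moreover have "\<psi> 0 \<le> \<psi> (N w)" by (intro \<psi>_mono) auto
    ultimately show ?thesis by (simp add: pair_energy_def B_def)
  next
    case False
    then show ?thesis using B by simp
  qed
  then show ?thesis using that by blast
qed

lemma minimizer_exists:
  obtains u w where "continuous_on {0..T} u" "H u w"
    "\<And>u' w'. H u' w' \<Longrightarrow> continuous_on {0..T} u' \<Longrightarrow> pair_energy u w \<le> pair_energy u' w'"
proof -
  define S where "S = {pair_energy u w | u w. H u w \<and> continuous_on {0..T} u}"
  define m where "m = Inf S"
  obtain B where B: "\<And>u w. H u w \<Longrightarrow> continuous_on {0..T} u \<Longrightarrow> B \<le> pair_energy u w" using pair_energy_bounded_below by blast
  have bdd: "bdd_below S" using B by (auto simp: S_def intro!: bdd_belowI[of _ B])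
  have ne: "S \<noteq> {}" using has_frac_deriv_zero by (auto simp: S_def intro!: exI[of _ "\<lambda>_. 0"] exI[of _ "\<lambda>_::real. 0::real"])
  have m_le: "m \<le> pair_energy u w" if "H u w" "continuous_on {0..T} u" for u w
    unfolding m_def using that by (intro cInf_lower bdd) (auto simp: S_def)
  have "\<exists>u w. H u w \<and> continuous_on {0..T} u \<and> pair_energy u w < m + 1 / real (Suc n)" for n
  proof -
    have "Inf S < m + 1 / real (Suc n)" by (simp add: m_def)
    from cInf_lessD[OF ne this] show ?thesis by (auto simp: S_def)
  qed
  then obtain U W where UW: "\<And>n. H (U n) (W n)" "\<And>n. continuous_on {0..T} (U n)"
    "\<And>n. pair_energy (U n) (W n) < m + 1 / real (Suc n)" by metis
  obtain X where X: "X \<ge> 0" "\<And>u w. H u w \<Longrightarrow> continuous_on {0..T} u \<Longrightarrow> pair_energy u w \<le> m + 1 \<Longrightarrow> N w \<le> X"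
    using pair_energy_coercive[of "m + 1"] by blast
  have NX: "N (W n) \<le> X" for n
  proof (rule X(2)[OF UW(1,2)])
    have "1 / real (Suc n) \<le> 1" by simp
    then show "pair_energy (U n) (W n) \<le> m + 1" using UW(3)[of n] by linarith
  qed
  define R where "R = sup_const * X powr (1 / p)"
  have UR: "\<bar>U n t\<bar> \<le> R" if "t \<in> {0..T}" for n t
    unfolding R_def by (rule sup_bound[OF UW(1,2) NX that])
  obtain g k where g: "continuous_on {0..T} g" and k: "strict_mono (k :: nat \<Rightarrow> nat)"
    and unif: "\<And>e. 0 < e \<Longrightarrow> \<exists>M. \<forall>n x. n \<ge> M \<and> x \<in> {0..T} \<longrightarrow> norm (U (k n) x - g x) < e"
  proof (rule Arzela_Ascoli[of "{0..T}" U R])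
    show "norm (U n x) \<le> R" if "x \<in> {0..T}" for n x using UR[OF that] by simp
    fix x e :: real assume x: "x \<in> {0..T}" and e: "0 < e"
    obtain \<delta> where \<delta>: "\<delta> > 0" "\<And>u w s t. H u w \<Longrightarrow> continuous_on {0..T} u \<Longrightarrow> N w \<le> X \<Longrightarrow>
      s \<in> {0..T} \<Longrightarrow> t \<in> {0..T} \<Longrightarrow> \<bar>s - t\<bar> < \<delta> \<Longrightarrow> \<bar>u s - u t\<bar> < e"
      using equicontinuity_modulus[OF X(1) e] by blast
    then show "\<exists>d>0. \<forall>n y. y \<in> {0..T} \<and> norm (x - y) < d \<longrightarrow> norm (U n x - U n y) < e"
      using \<delta>(1) \<delta>(2)[OF UW(1,2) NX x] by (intro exI[of _ \<delta>]) simp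
  qed auto
  \<comment> \<open>A second subsequence makes the norms converge too. Uniform convergence says
    nothing about the derivatives, so L is for now only a limit of numbers.\<close>
  have bnd: "\<forall>n. N (W (k n)) \<in> {0..X}" using NX by simp
  obtain L r where L: "L \<in> {0..X}" and r: "strict_mono (r :: nat \<Rightarrow> nat)" "((\<lambda>n. N (W (k n))) \<circ> r) \<longlonglongrightarrow> L"
    using seq_compactE[OF compact_imp_seq_compact[OF compact_Icc] bnd] by metis
  define V where "V n = U (k (r n))" for n
  define Y where "Y n = W (k (r n))" for n
  have kr: "k (r n) \<ge> n" for n
    using seq_suble[OF k, of "r n"] seq_suble[OF r(1), of n] by linarith
  have VY: "H (V n) (Y n)" "continuous_on {0..T} (V n)" "N (Y n) \<le> X" for n
    using UW(1,2) NX by (auto simp: V_def Y_def)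
  note YL = has_frac_deriv_Lp(2)[OF VY(1)] and VL = has_frac_deriv_Lp(1)[OF VY(1)]
  have VR: "\<bar>V n t\<bar> \<le> R" if "t \<in> {0..T}" for n t using UR[OF that] by (simp add: V_def)
  have NY: "(\<lambda>n. N (Y n)) \<longlonglongrightarrow> L" using r(2) by (simp add: Y_def comp_def)
  have unifV: "\<exists>M. \<forall>n\<ge>M. \<forall>t\<in>{0..T}. \<bar>V n t - g t\<bar> \<le> e" if e: "e > 0" for e
  proof -
    obtain M where M: "\<And>n x. n \<ge> M \<Longrightarrow> x \<in> {0..T} \<Longrightarrow> norm (U (k n) x - g x) < e" using unif[OF e] by blast
    have "\<bar>V n t - g t\<bar> \<le> e" if "n \<ge> M" "t \<in> {0..T}" for n t
    proof -
      have "r n \<ge> M" using seq_suble[OF r(1), of n] that by linarith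
      from M[OF this that(2)] show ?thesis by (simp add: V_def)
    qed
    then show ?thesis by blast
  qed
  have gR: "\<bar>g t\<bar> \<le> R + 1" if "t \<in> {0..T}" for t
  proof -
    obtain M where M: "\<forall>n\<ge>M. \<forall>t\<in>{0..T}. \<bar>V n t - g t\<bar> \<le> 1" using unifV[of 1] by auto
    then have "\<bar>V M t - g t\<bar> \<le> 1" using that by blast
    then show ?thesis using VR[OF that, of M] by linarith
  qed
  obtain K where K: "K \<ge> 0" "\<And>u v \<epsilon>. continuous_on {0..T} u \<Longrightarrow> continuous_on {0..T} v \<Longrightarrow>
    (\<And>t. t \<in> {0..T} \<Longrightarrow> \<bar>u t\<bar> \<le> R + 1) \<Longrightarrow> (\<And>t. t \<in> {0..T} \<Longrightarrow> \<bar>v t\<bar> \<le> R + 1) \<Longrightarrow>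
    (\<And>t. t \<in> {0..T} \<Longrightarrow> \<bar>u t - v t\<bar> \<le> \<epsilon>) \<Longrightarrow> \<bar>potential u - potential v\<bar> \<le> K * \<epsilon>"
    using potential_Lipschitz[of "R + 1"] by blast
  have VR1: "\<bar>V n t\<bar> \<le> R + 1" if "t \<in> {0..T}" for n t using VR[OF that, of n] by simp
  have GV: "(\<lambda>n. potential (V n)) \<longlonglongrightarrow> potential g"
  proof (rule LIMSEQ_I)
    fix e :: real assume e: "e > 0"
    then have "e / (K + 1) > 0" using K by simp
    from unifV[OF this] obtain M where M: "\<And>n t. n \<ge> M \<Longrightarrow> t \<in> {0..T} \<Longrightarrow> \<bar>V n t - g t\<bar> \<le> e / (K + 1)" by blast
    have "norm (potential (V n) - potential g) < e" if "n \<ge> M" for n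
    proof -
      have "\<bar>potential (V n) - potential g\<bar> \<le> K * (e / (K + 1))" using M[OF that] by (intro K(2) VY g VR1 gR)
      also have "\<dots> < e" using e K by (simp add: field_simps)
      finally show ?thesis by simp
    qed
    then show "\<exists>M. \<forall>n\<ge>M. norm (potential (V n) - potential g) < e" by blast
  qed
  have "(\<lambda>n. pair_energy (V n) (Y n)) \<longlonglongrightarrow> m"
  proof (rule real_tendsto_sandwich)
    show "\<forall>\<^sub>F n in sequentially. m \<le> pair_energy (V n) (Y n)" using m_le[OF VY(1,2)] by simp
    have "pair_energy (V n) (Y n) \<le> m + 1 / real (Suc n)" for n
    proof -
      have "1 / real (Suc (k (r n))) \<le> 1 / real (Suc n)" using kr[of n] by (intro divide_left_mono) auto
      then show ?thesis using UW(3)[of "k (r n)"] by (simp add: V_def Y_def)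
    qed
    then show "\<forall>\<^sub>F n in sequentially. pair_energy (V n) (Y n) \<le> m + 1 / real (Suc n)" by simp
    show "(\<lambda>n. m + 1 / real (Suc n)) \<longlonglongrightarrow> m"
      using tendsto_add[OF tendsto_const[of m] LIMSEQ_Suc[OF lim_1_over_n]] by simp
  qed simp
  moreover have "(\<lambda>n. pair_energy (V n) (Y n)) \<longlonglongrightarrow> \<psi> L - potential g - \<psi> 0"
    unfolding pair_energy_def using L by (intro tendsto_intros \<psi>_tendsto NY GV) auto
  \<comment> \<open>The infimum is identified before any limit of the derivatives is known; what
    remains is a derivative w of g with \<open>N w = L\<close>.\<close>
  ultimately have m_eq: "m = \<psi> L - potential g - \<psi> 0" by (rule LIMSEQ_unique)

  have mid: "\<exists>M. \<forall>i\<ge>M. \<forall>j\<ge>M. L - e \<le> N (\<lambda>t. (Y i t + Y j t) / 2)" if e: "e > 0" for e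
  proof (cases "L - e \<le> 0")
    case True
    then show ?thesis using order_trans[OF True Lp_int_nonneg] by blast
  next
    case False
    \<comment> \<open>A midpoint norm below L - e would save more than \<open>gap\<close> in the
      Kirchhoff term. The tolerance gap / (K + 1) keeps the change of the potential strictly below
      \<open>gap\<close>.\<close>
    define gap where "gap = \<psi> L - \<psi> (L - e)"
    have gap: "gap > 0" using \<psi>_strict_mono[of "L - e" L] False e by (simp add: gap_def)
    then have "gap / (K + 1) > 0" using K by simp
    from unifV[OF this] obtain M where M: "\<And>n t. n \<ge> M \<Longrightarrow> t \<in> {0..T} \<Longrightarrow> \<bar>V n t - g t\<bar> \<le> gap / (K + 1)" by blast
    have "L - e \<le> N (\<lambda>t. (Y i t + Y j t) / 2)" if ij: "i \<ge> M" "j \<ge> M" for i j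
    proof (rule ccontr)
      let ?v = "\<lambda>t. (V i t + V j t) / 2" and ?y = "\<lambda>t. (Y i t + Y j t) / 2"
      assume "\<not> L - e \<le> N ?y"
      then have "\<psi> (N ?y) < \<psi> (L - e)" by (intro \<psi>_strict_mono) auto
      have "H (\<lambda>t. 1 / 2 * V i t + 1 / 2 * V j t) (\<lambda>t. 1 / 2 * Y i t + 1 / 2 * Y j t)"
        by (intro has_frac_deriv_lincomb VY)
      then have Hv: "H ?v ?y" by (simp add: add_divide_distrib)
      have cv: "continuous_on {0..T} ?v" by (intro continuous_intros VY) auto
      have avg: "\<bar>(x + y) / 2 - z\<bar> \<le> c" if "\<bar>x - z\<bar> \<le> c" "\<bar>y - z\<bar> \<le> c" for x y z c :: real
        using that unfolding abs_le_iff by (auto simp: field_simps)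
      have vb: "\<bar>?v t\<bar> \<le> R + 1" if "t \<in> {0..T}" for t
        using avg[of "V i t" 0 "R + 1" "V j t"] VR1[OF that] by simp
      have vg: "\<bar>?v t - g t\<bar> \<le> gap / (K + 1)" if "t \<in> {0..T}" for t
        using M[OF ij(1) that] M[OF ij(2) that] by (rule avg)
      have "\<bar>potential ?v - potential g\<bar> \<le> K * (gap / (K + 1))" by (intro K(2) cv g vb gR vg)
      also have "\<dots> < gap" using gap K by (simp add: field_simps)
      finally have "potential ?v > potential g - gap" by linarith
      moreover have "m \<le> \<psi> (N ?y) - potential ?v - \<psi> 0" using m_le[OF Hv cv] by (simp add: pair_energy_def)
      ultimately show False using \<open>\<psi> (N ?y) < \<psi> (L - e)\<close> unfolding m_eq gap_def by linarith
    qed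
    then show ?thesis by blast
  qed
  have Cauchy: "\<exists>M. \<forall>i\<ge>M. \<forall>j\<ge>M. N (\<lambda>t. Y i t - Y j t) < \<epsilon>" if \<epsilon>: "\<epsilon> > 0" for \<epsilon>
  proof -
    define e1 where "e1 = \<epsilon> / (4 * (X + 1))"
    have e1: "e1 > 0" using \<epsilon> X by (simp add: e1_def)
    obtain C where C: "C \<ge> 0" "\<And>x y. x \<in> Lp_fun T p \<Longrightarrow> y \<in> Lp_fun T p \<Longrightarrow>
      N (\<lambda>t. x t - y t) \<le> e1 * (N x + N y) + C * ((N x + N y) / 2 - N (\<lambda>t. (x t + y t) / 2))"
      using Lp_int_uniformly_convex[OF e1] by blast
    \<comment> \<open>C depends on e1, so e2 is fixed only now. The two contributions are at most
      epsilon/2 and epsilon/4.\<close>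
    define e2 where "e2 = \<epsilon> / (4 * (C + 1))"
    have e2: "e2 > 0" using \<epsilon> C by (simp add: e2_def)
    obtain M1 where M1: "\<And>i j. i \<ge> M1 \<Longrightarrow> j \<ge> M1 \<Longrightarrow> L - e2 / 2 \<le> N (\<lambda>t. (Y i t + Y j t) / 2)"
      using mid[of "e2 / 2"] e2 by auto
    obtain M2 where M2: "\<And>i. i \<ge> M2 \<Longrightarrow> N (Y i) < L + e2 / 2"
      using order_tendstoD(2)[OF NY, of "L + e2 / 2"] e2 by (auto simp: eventually_sequentially)
    have "N (\<lambda>t. Y i t - Y j t) < \<epsilon>" if "i \<ge> max M1 M2" "j \<ge> max M1 M2" for i j
    proof -
      have "(N (Y i) + N (Y j)) / 2 - N (\<lambda>t. (Y i t + Y j t) / 2) \<le> e2"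
        using M1[of i j] M2[of i] M2[of j] that by (simp add: field_simps)
      then have "C * ((N (Y i) + N (Y j)) / 2 - N (\<lambda>t. (Y i t + Y j t) / 2)) \<le> C * e2"
        using C by (intro mult_left_mono)
      moreover have "e1 * (N (Y i) + N (Y j)) \<le> e1 * (X + X)"
        using VY(3)[of i] VY(3)[of j] e1 by (intro mult_left_mono add_mono) auto
      ultimately have "N (\<lambda>t. Y i t - Y j t) \<le> e1 * (X + X) + C * e2"
        using C(2)[OF YL YL, of i j] by linarith
      also have "e1 * (X + X) \<le> \<epsilon> / 2" using X \<epsilon> by (simp add: e1_def field_simps)
      also have "C * e2 \<le> \<epsilon> / 4" using C \<epsilon> by (simp add: e2_def field_simps)
      finally show ?thesis using \<epsilon> by simp
    qed
    then show ?thesis by blast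
  qed
  obtain w where w: "w \<in> Lp_fun T p" "(\<lambda>n. N (\<lambda>t. Y n t - w t)) \<longlonglongrightarrow> 0"
    using Lp_complete[OF T_pos p_gt_1 YL Cauchy] by blast
  have gL: "g \<in> Lp_fun T p" using g p_pos by (intro continuous_Lp_fun)
  have Vg: "(\<lambda>n. N (\<lambda>t. V n t - g t)) \<longlonglongrightarrow> 0"
  proof (rule LIMSEQ_I)
    fix e :: real assume e: "e > 0"
    define e' where "e' = (e / (2 * T)) powr (1 / p)"
    have e': "e' > 0" using e T_pos by (simp add: e'_def)
    from unifV[OF this] obtain M where M: "\<And>n t. n \<ge> M \<Longrightarrow> t \<in> {0..T} \<Longrightarrow> \<bar>V n t - g t\<bar> \<le> e'" by blast
    have "norm (N (\<lambda>t. V n t - g t) - 0) < e" if "n \<ge> M" for n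
    proof -
      have "N (\<lambda>t. V n t - g t) \<le> T * e' powr p"
        using M[OF that] by (intro Lp_int_le_const T_pos p_pos Lp_fun_diff VL gL)
      also have "\<dots> = e / 2" using T_pos p_pos e by (simp add: e'_def powr_powr)
      finally show ?thesis using e by simp
    qed
    then show "\<exists>M. \<forall>n\<ge>M. norm (N (\<lambda>t. V n t - g t) - 0) < e" by blast
  qed
  have Hgw: "H g w" by (rule has_frac_deriv_closed[OF gL w(1) VY(1) Vg w(2)])
  \<comment> \<open>Strong convergence gives equality of the limit norm with L, hence g attains the
    infimum.\<close>
  have "(\<lambda>n. N (Y n)) \<longlonglongrightarrow> N w"
  proof -
    obtain C where C: "C \<ge> 0" "\<And>w h. w \<in> Lp_fun T p \<Longrightarrow> h \<in> Lp_fun T p \<Longrightarrow>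
      \<bar>N (\<lambda>t. w t + h t) - N w\<bar> \<le> C * (N w powr (1 - 1 / p) * N h powr (1 / p) + N h)"
      using Lp_int_Lipschitz by blast
    let ?n = "\<lambda>n. N (\<lambda>t. Y n t - w t)"
    have "(\<lambda>n. N (Y n) - N w) \<longlonglongrightarrow> 0"
    proof (rule Lim_null_comparison)
      have "\<bar>N (Y n) - N w\<bar> \<le> C * (N w powr (1 - 1 / p) * ?n n powr (1 / p) + ?n n)" for n
        using C(2)[OF w(1) Lp_fun_diff(1)[OF p_pos YL w(1)], of n] by simp
      then show "\<forall>\<^sub>F n in sequentially. norm (N (Y n) - N w) \<le> C * (N w powr (1 - 1 / p) * ?n n powr (1 / p) + ?n n)"
        by simp
      have "(\<lambda>n. C * (N w powr (1 - 1 / p) * ?n n powr (1 / p) + ?n n)) \<longlonglongrightarrow> C * (N w powr (1 - 1 / p) * 0 powr (1 / p) + 0)"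
        by (intro tendsto_intros w(2) tendsto_powr2) (use p_pos in auto)
      then show "(\<lambda>n. C * (N w powr (1 - 1 / p) * ?n n powr (1 / p) + ?n n)) \<longlonglongrightarrow> 0" by simp
    qed
    then show ?thesis by (simp add: LIM_zero_iff)
  qed
  then have "N w = L" using NY LIMSEQ_unique by blast
  then have "pair_energy g w = m" by (simp add: pair_energy_def m_eq)
  then show ?thesis using that[OF g Hgw] m_le by simp
qed

text \<open>
  The energy at \<open>u - v\<close> is at least the minimum, so the increment at \<open>u + v\<close> is bounded by the second
  difference; hence the derivative of the energy is never computed.
\<close>

lemma minimizer_critical:
  assumes u: "continuous_on {0..T} u" "H u w"
    and min: "\<And>u' w'. H u' w' \<Longrightarrow> continuous_on {0..T} u' \<Longrightarrow> pair_energy u w \<le> pair_energy u' w'"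
  shows "critical_point T \<alpha> p (energy T a b p \<alpha> f) u"
  unfolding critical_point_def
proof (intro conjI allI impI)
  show "u \<in> E0 T \<alpha> p" using u by (auto simp: E0_iff)
  fix \<epsilon> :: real assume \<epsilon>: "\<epsilon> > 0"
  have wL: "w \<in> Lp_fun T p" using has_frac_deriv_Lp[OF u(2)] by simp
  define n where "n = N w"
  define Q where "Q = n powr (1 - 1 / p)"
  define P where "P = 1 / p * (a + b * n) powr (p - 1)"
  have Q: "Q \<ge> 0" and P: "P \<ge> 0" using p_pos by (simp_all add: Q_def P_def)
  obtain C1 where C1: "C1 \<ge> 0" "\<And>w h. w \<in> Lp_fun T p \<Longrightarrow> h \<in> Lp_fun T p \<Longrightarrow>
    \<bar>N (\<lambda>t. w t + h t) - N w\<bar> \<le> C1 * (N w powr (1 - 1 / p) * N h powr (1 / p) + N h)"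
    using Lp_int_Lipschitz by blast
  \<comment> \<open>The error budget, in multiples of s, the norm of v: epsilon/4 for linearizing
    \<open>\<psi>\<close> at the two perturbed norms (e1), epsilon/4 for the second difference of
    \<open>N\<close> (half through e2, half through the radius e4), epsilon/2 for the potential
    (e3).\<close>
  define e1 where "e1 = \<epsilon> / (8 * (C1 * (Q + 1) + 1))"
  define e2 where "e2 = \<epsilon> / (8 * (P * Q + 1))"
  define e3 where "e3 = \<epsilon> / (2 * (sup_const + 1))"
  have pos: "C1 * (Q + 1) \<ge> 0" "P * Q \<ge> 0" using C1 Q P by simp_all
  then have e: "e1 > 0" "e2 > 0" "e3 > 0" using \<epsilon> sup_const_nonneg by (simp_all add: e1_def e2_def e3_def)
  obtain C2 where C2: "C2 \<ge> 0" "\<And>w h. w \<in> Lp_fun T p \<Longrightarrow> h \<in> Lp_fun T p \<Longrightarrow>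
    N (\<lambda>t. w t + h t) + N (\<lambda>t. w t - h t) - 2 * N w \<le> e2 * (N w powr (1 - 1 / p) * N h powr (1 / p)) + C2 * N h"
    using Lp_int_second_difference[OF e(2)] by blast
  obtain \<delta> where \<delta>: "\<delta> > 0" "\<And>v m. continuous_on {0..T} v \<Longrightarrow> (\<And>t. t \<in> {0..T} \<Longrightarrow> \<bar>v t\<bar> \<le> m) \<Longrightarrow> m < \<delta> \<Longrightarrow>
    2 * potential u - potential (\<lambda>t. u t + v t) - potential (\<lambda>t. u t - v t) \<le> e3 * m"
    using potential_second_difference[OF u(1) e(3)] by blast
  have "(\<psi> has_derivative (\<lambda>x. P * x)) (at n)"
    using \<psi>_deriv[of n] unfolding P_def has_field_derivative_def by (simp only: n_def Lp_int_nonneg simp_thms)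
  then obtain \<delta>1 where \<delta>1: "\<delta>1 > 0" "\<And>x. \<bar>x - n\<bar> < \<delta>1 \<Longrightarrow> \<bar>\<psi> x - \<psi> n - P * (x - n)\<bar> \<le> e1 * \<bar>x - n\<bar>"
    using e(1) unfolding has_derivative_at_alt by (auto simp: real_norm_def)
  define e4 where "e4 = (\<epsilon> / (8 * (P * C2 + 1))) powr (1 / (p - 1))"
  have PC2: "P * C2 \<ge> 0" using P C2 by simp
  then have e4: "e4 > 0" using \<epsilon> by (simp add: e4_def)
  \<comment> \<open>The entries in turn give s^p <= s, a sup norm of v below delta, perturbed norms
    within the range of the linearization, and P C2 s^(p-1) at most epsilon/8.\<close>
  define \<rho> where "\<rho> = min (min 1 (\<delta> / (sup_const + 1))) (min (\<delta>1 / (C1 * (Q + 1) + 1)) e4)"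
  have \<rho>: "\<rho> > 0" using \<delta> \<delta>1 e4 sup_const_nonneg pos by (simp add: \<rho>_def)
  have main: "\<bar>energy T a b p \<alpha> f (\<lambda>t. u t + v t) - energy T a b p \<alpha> f u\<bar> \<le> \<epsilon> * E_norm T \<alpha> p v"
    if v: "v \<in> E0 T \<alpha> p" and small: "E_norm T \<alpha> p v < \<rho>" for v
  proof -
    from v obtain h where h: "continuous_on {0..T} v" "H v h" by (auto simp: E0_iff)
    note hL = has_frac_deriv_Lp(2)[OF h(2)]
    define s where "s = E_norm T \<alpha> p v"
    have s_eq: "s = N h powr (1 / p)" using E_norm_eq[OF h(2,1)] by (simp add: s_def)
    have s0: "s \<ge> 0" by (simp add: s_eq)
    have Nh: "N h = s powr p" using p_pos by (simp add: s_eq powr_powr)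
    have spp: "(s powr p) powr (1 / p) = s" using p_pos s0 by (simp add: powr_powr)
    have s: "s < 1" "s < \<delta> / (sup_const + 1)" "s < \<delta>1 / (C1 * (Q + 1) + 1)" "s < e4"
      using small by (simp_all add: s_def \<rho>_def)
    have sp: "s powr p = s * s powr (p - 1)" using s0 by (cases "s = 0") (auto simp: powr_diff)
    have "s powr (p - 1) \<le> 1 powr (p - 1)" using s s0 p_gt_1 by (intro powr_mono2) auto
    then have sp1: "s powr p \<le> s" using s0 by (simp add: sp mult_left_le)
    have vb: "\<bar>v t\<bar> \<le> sup_const * s" if "t \<in> {0..T}" for t
      using sup_bound[OF h(2,1) order_refl that] by (simp add: s_eq)
    let ?np = "N (\<lambda>t. w t + h t)" and ?nm = "N (\<lambda>t. w t - h t)"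
    have lip: "\<bar>x - n\<bar> \<le> C1 * (Q + 1) * s" if "\<bar>x - n\<bar> \<le> C1 * (Q * s + s powr p)" for x
    proof -
      have "C1 * (Q * s + s powr p) \<le> C1 * (Q * s + s)" using sp1 C1 by (intro mult_left_mono) auto
      then show ?thesis using that by (simp add: algebra_simps)
    qed
    have np: "\<bar>?np - n\<bar> \<le> C1 * (Q + 1) * s"
      using C1(2)[OF wL hL] by (intro lip) (simp add: n_def Q_def Nh spp)
    have nm: "\<bar>?nm - n\<bar> \<le> C1 * (Q + 1) * s"
      using C1(2)[OF wL Lp_fun_cmult(1)[OF p_pos hL, of "-1"]] Lp_fun_cmult(2)[OF p_pos hL, of "-1"]
      by (intro lip) (simp add: n_def Q_def Nh spp)
    have "C1 * (Q + 1) * s < \<delta>1"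
    proof -
      have "C1 * (Q + 1) * s \<le> (C1 * (Q + 1) + 1) * s" using s0 by (simp add: algebra_simps)
      also have "\<dots> < \<delta>1" using s(3) pos by (simp add: field_simps)
      finally show ?thesis .
    qed
    then have d: "\<bar>\<psi> ?np - \<psi> n - P * (?np - n)\<bar> \<le> e1 * \<bar>?np - n\<bar>" "\<bar>\<psi> ?nm - \<psi> n - P * (?nm - n)\<bar> \<le> e1 * \<bar>?nm - n\<bar>"
      using np nm by (auto intro!: \<delta>1(2))
    have "e1 * \<bar>?np - n\<bar> + e1 * \<bar>?nm - n\<bar> \<le> e1 * (C1 * (Q + 1) * s) + e1 * (C1 * (Q + 1) * s)"
      using np nm e by (intro add_mono mult_left_mono) auto
    also have "\<dots> \<le> 2 * (e1 * (C1 * (Q + 1) + 1)) * s" using s0 e by (simp add: algebra_simps)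
    also have "e1 * (C1 * (Q + 1) + 1) = \<epsilon> / 8" using pos by (simp add: e1_def field_simps)
    finally have t1: "e1 * \<bar>?np - n\<bar> + e1 * \<bar>?nm - n\<bar> \<le> \<epsilon> / 4 * s" by simp
    have "P * (?np + ?nm - 2 * n) \<le> P * (e2 * (Q * s) + C2 * s powr p)"
      using C2(2)[OF wL hL] P by (intro mult_left_mono) (simp_all add: n_def Q_def Nh spp)
    also have "\<dots> = e2 * (P * Q) * s + P * C2 * s powr (p - 1) * s" by (simp add: sp algebra_simps)
    also have "\<dots> \<le> \<epsilon> / 8 * s + \<epsilon> / 8 * s"
    proof (intro add_mono mult_right_mono s0)
      show "e2 * (P * Q) \<le> \<epsilon> / 8" using pos \<epsilon> by (simp add: e2_def field_simps)
      have "s powr (p - 1) \<le> e4 powr (p - 1)" using s(4) s0 p_gt_1 by (intro powr_mono2) auto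
      also have "\<dots> = \<epsilon> / (8 * (P * C2 + 1))" using p_gt_1 PC2 \<epsilon> by (simp add: e4_def powr_powr)
      finally have "P * C2 * s powr (p - 1) \<le> P * C2 * (\<epsilon> / (8 * (P * C2 + 1)))"
        using PC2 by (intro mult_left_mono)
      also have "\<dots> \<le> \<epsilon> / 8" using PC2 \<epsilon> by (simp add: field_simps)
      finally show "P * C2 * s powr (p - 1) \<le> \<epsilon> / 8" .
    qed
    finally have t2: "P * (?np + ?nm - 2 * n) \<le> \<epsilon> / 4 * s" by simp
    \<comment> \<open>Up to the linearization errors, the second difference of \<open>\<psi>\<close>
      composed with \<open>N\<close> is P times that of \<open>N\<close>.\<close>
    have "P * (?np + ?nm - 2 * n) = P * (?np - n) + P * (?nm - n)" by (simp add: algebra_simps)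
    then have psi: "\<psi> ?np + \<psi> ?nm - 2 * \<psi> n \<le> \<epsilon> / 2 * s" using d t1 t2 by linarith
    have "sup_const * s < \<delta>"
    proof -
      have "sup_const * s \<le> (sup_const + 1) * s" using s0 by (simp add: algebra_simps)
      also have "\<dots> < \<delta>" using s(2) sup_const_nonneg by (simp add: field_simps)
      finally show ?thesis .
    qed
    from \<delta>(2)[OF h(1) vb this]
    have "2 * potential u - potential (\<lambda>t. u t + v t) - potential (\<lambda>t. u t - v t) \<le> e3 * sup_const * s" by simp
    also have "\<dots> \<le> \<epsilon> / 2 * s"
      using sup_const_nonneg \<epsilon> s0 by (intro mult_right_mono) (simp_all add: e3_def field_simps)
    finally have g: "2 * potential u - potential (\<lambda>t. u t + v t) - potential (\<lambda>t. u t - v t) \<le> \<epsilon> / 2 * s" .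
    have Hp: "H (\<lambda>t. u t + v t) (\<lambda>t. w t + h t)" using has_frac_deriv_lincomb[OF u(2) h(2), of 1 1] by simp
    have Hm: "H (\<lambda>t. u t - v t) (\<lambda>t. w t - h t)" using has_frac_deriv_lincomb[OF u(2) h(2), of 1 "-1"] by simp
    have cp: "continuous_on {0..T} (\<lambda>t. u t + v t)" and cm: "continuous_on {0..T} (\<lambda>t. u t - v t)"
      by (intro continuous_intros u h)+
    have "pair_energy (\<lambda>t. u t + v t) (\<lambda>t. w t + h t) + pair_energy (\<lambda>t. u t - v t) (\<lambda>t. w t - h t) - 2 * pair_energy u w \<le> \<epsilon> * s"
      using psi g by (simp add: pair_energy_def n_def)
    moreover note min[OF Hp cp] min[OF Hm cm]
    ultimately have "\<bar>pair_energy (\<lambda>t. u t + v t) (\<lambda>t. w t + h t) - pair_energy u w\<bar> \<le> \<epsilon> * s" by linarith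
    then show ?thesis by (simp add: energy_eq[OF Hp cp] energy_eq[OF u(2,1)] s_def)
  qed
  show "\<exists>\<rho>>0. \<forall>v\<in>E0 T \<alpha> p. E_norm T \<alpha> p v < \<rho> \<longrightarrow>
    \<bar>energy T a b p \<alpha> f (\<lambda>t. u t + v t) - energy T a b p \<alpha> f u\<bar> \<le> \<epsilon> * E_norm T \<alpha> p v"
    using \<rho> main by blast
qed

text \<open>Along s u with u the bump, the Kirchhoff part rises by at most M s^p, whereas the
  potential is at least eta A s^r2. For small s the lower power r2 dominates.\<close>

lemma pair_energy_negative:
  assumes cd: "0 \<le> c" "c < e" "e \<le> T" and "\<eta> > 0" "\<delta> > 0" "1 < r2" "r2 < p"
    and F: "\<And>t x. t \<in> {c<..<e} \<Longrightarrow> x \<in> {-\<delta>..\<delta>} \<Longrightarrow> primitive f t x \<ge> \<eta> * \<bar>x\<bar> powr r2"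
  obtains u w where "H u w" "continuous_on {0..T} u" "pair_energy u w < 0"
proof -
  define u where "u t = (max 0 ((t - c) * (e - t)))\<^sup>2" for t :: real
  note bump = bump_in_E0[OF cd, folded u_def]
  obtain w where w: "H u w" using bump(2) by blast
  have cu: "continuous_on {0..T} u" by (rule bump(1))
  have u0: "u t \<ge> 0" for t by (simp add: u_def)
  have "compact (u ` {0..T})" by (intro compact_continuous_image cu) auto
  then obtain B where B: "\<And>t. t \<in> {0..T} \<Longrightarrow> \<bar>u t\<bar> \<le> B"
    using compact_imp_bounded bounded_iff by (metis image_eqI real_norm_def)
  have B0: "B \<ge> 0" using B[of 0] T_pos by auto
  define A where "A = (LINT t|lebesgue_on {0..T}. u t powr r2)"
  have cur: "continuous_on {0..T} (\<lambda>t. u t powr r2)"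
    using assms u0 by (intro continuous_on_powr' cu) (auto intro!: continuous_intros)
  have A_pos: "A > 0"
  proof -
    have Aint: "A = integral {0..T} (\<lambda>t. u t powr r2)"
      unfolding A_def by (rule lebesgue_integral_eq_integral[OF integrable_continuous_Icc[OF cur]]) simp
    have "A \<noteq> 0"
    proof
      assume "A = 0"
      then have "\<forall>t\<in>{0..T}. u t powr r2 = 0"
        using integral_eq_0_iff[OF cur] T_pos Aint by simp
      moreover have "(c + e) / 2 \<in> {0..T}" "(c + e) / 2 \<in> {c<..<e}" using cd by auto
      ultimately show False using bump(4)[of "(c + e) / 2"] by auto
    qed
    moreover have "A \<ge> 0" by (simp add: A_def)
    ultimately show ?thesis by simp
  qed
  \<comment> \<open>The slope bound of \<open>powr_diff_le\<close> evaluated at s = 1; it covers all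
    s <= 1, because \<open>N ?w\<close> is then at most \<open>N w\<close>.\<close>
  define M where "M = 1 / (b * p\<^sup>2) * (p * (a + b * N w) powr (p - 1) * (b * N w))"
  have M: "M \<ge> 0" using b_pos p_pos by (simp add: M_def)
  \<comment> \<open>The first entry keeps s u within the range [0, delta] where the lower bound on F
    holds; the second yields (M + 1) s^(p-r2) <= eta A.\<close>
  define q where "q = min (\<delta> / (B + 1)) ((\<eta> * A / (M + 1)) powr (1 / (p - r2)))"
  define s where "s = min 1 (q / 2)"
  have q: "q > 0" using assms A_pos B0 M by (simp add: q_def)
  then have s: "s > 0" "s \<le> 1" "s < q" by (auto simp: s_def)
  let ?u = "\<lambda>t. s * u t" and ?w = "\<lambda>t. s * w t"
  have Hs: "H ?u ?w" using has_frac_deriv_lincomb[OF w w, of s 0] by simp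
  have cs: "continuous_on {0..T} ?u" by (intro continuous_intros cu)
  have "s * (B + 1) \<le> \<delta>" using s B0 by (simp add: q_def field_simps)
  then have su: "s * u t \<le> \<delta>" if "t \<in> {0..T}" for t
  proof -
    have "u t \<le> B + 1" using B[OF that] by simp
    then have "s * u t \<le> s * (B + 1)" using s by (intro mult_left_mono) auto
    then show ?thesis using \<open>s * (B + 1) \<le> \<delta>\<close> by linarith
  qed
  have "\<eta> * s powr r2 * A \<le> potential ?u"
  proof -
    have "\<eta> * s powr r2 * A = (LINT t|lebesgue_on {0..T}. \<eta> * s powr r2 * u t powr r2)"
      by (simp add: A_def)
    also have "\<dots> \<le> potential ?u" unfolding potential_def
    proof (rule integral_mono)
      show "integrable (lebesgue_on {0..T}) (\<lambda>t. \<eta> * s powr r2 * u t powr r2)"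
        using integrable_continuous_Icc[OF cur] by simp
      fix t assume "t \<in> space (lebesgue_on {0..T})"
      then have t: "t \<in> {0..T}" by simp
      show "\<eta> * s powr r2 * u t powr r2 \<le> primitive f t (s * u t)"
      proof (cases "t \<in> {c<..<e}")
        case True
        have "s * u t \<in> {-\<delta>..\<delta>}" using su[OF t] u0[of t] s assms(5) by (auto intro: order_trans[of _ 0])
        from F[OF True this] show ?thesis using s u0[of t] by (simp add: powr_mult mult.assoc)
      next
        case False
        then show ?thesis using bump(3)[of t] primitive_deriv(2)[OF t] by simp
      qed
    qed (rule primitive_integrable[OF cs])
    finally show ?thesis .
  qed
  moreover have "\<psi> (N ?w) - \<psi> 0 \<le> M * s powr p"
  proof -
    have Nw: "N ?w = s powr p * N w" using Lp_fun_cmult(2)[OF p_pos has_frac_deriv_Lp(2)[OF w], of s] s by simp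
    have "s powr p \<le> 1 powr p" using s p_pos by (intro powr_mono2) auto
    then have le: "s powr p * N w \<le> N w" by (simp add: mult_left_le_one_le)
    have "(a + b * (s powr p * N w)) powr p - a powr p
      \<le> p * (a + b * (s powr p * N w)) powr (p - 1) * (a + b * (s powr p * N w) - a)"
      using a_pos b_pos by (intro powr_diff_le p_gt_1) auto
    also have "\<dots> \<le> p * (a + b * N w) powr (p - 1) * (b * (s powr p * N w))"
      using le a_pos b_pos p_gt_1 by (intro mult_mono mult_left_mono powr_mono2) (auto intro!: mult_nonneg_nonneg)
    finally have "1 / (b * p\<^sup>2) * ((a + b * (s powr p * N w)) powr p - a powr p)
      \<le> 1 / (b * p\<^sup>2) * (p * (a + b * N w) powr (p - 1) * (b * (s powr p * N w)))"
      using b_pos p_pos by (intro mult_left_mono) auto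
    then have "\<psi> (N ?w) - \<psi> 0 \<le> 1 / (b * p\<^sup>2) * (p * (a + b * N w) powr (p - 1) * (b * (s powr p * N w)))"
      by (simp add: \<psi>_def Nw diff_divide_distrib)
    then show ?thesis using b_pos by (simp add: M_def mult_ac)
  qed
  moreover have "M * s powr p < \<eta> * s powr r2 * A"
  proof -
    have "s powr (p - r2) \<le> ((\<eta> * A / (M + 1)) powr (1 / (p - r2))) powr (p - r2)"
      using s assms by (intro powr_mono2) (auto simp: q_def)
    also have "\<dots> = \<eta> * A / (M + 1)" using assms A_pos M by (simp add: powr_powr)
    finally have "(M + 1) * s powr (p - r2) \<le> \<eta> * A" using M by (simp add: field_simps)
    moreover have "M * s powr (p - r2) < (M + 1) * s powr (p - r2)" using s by (intro mult_strict_right_mono) auto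
    ultimately have "M * s powr (p - r2) < \<eta> * A" by linarith
    then have "s powr r2 * (M * s powr (p - r2)) < s powr r2 * (\<eta> * A)"
      using s by (intro mult_strict_left_mono) auto
    moreover have "s powr p = s powr r2 * s powr (p - r2)" by (simp flip: powr_add)
    ultimately show ?thesis by (simp add: mult_ac)
  qed
  ultimately have "pair_energy ?u ?w < 0" by (simp add: pair_energy_def)
  then show ?thesis using that Hs cs by blast
qed

end

theorem theorem1p2:
  fixes T a b p \<alpha> r1 r2 \<eta> \<delta> :: real
    and f :: "real \<Rightarrow> real \<Rightarrow> real" and d :: "real \<Rightarrow> real" and J :: "real set"
  assumes "T > 0" and "a > 0" and "b > 0" and "p > 1" and "1 / p < \<alpha>" and "\<alpha> \<le> 1"
    and "continuous_on ({0..T} \<times> UNIV) (\<lambda>(t, x). f t x)"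
    and "1 < r1" and "r1 < p\<^sup>2"
    and "integrable (lebesgue_on {0..T}) d" and "\<And>t. t \<in> {0..T} \<Longrightarrow> 0 \<le> d t"
    and "\<And>t x. t \<in> {0..T} \<Longrightarrow> \<bar>f t x\<bar> \<le> r1 * d t * \<bar>x\<bar> powr (r1 - 1)"
    and "open J" and "is_interval J" and "J \<noteq> {}" and "J \<subseteq> {0..T}"
    and "\<eta> > 0" and "\<delta> > 0" and "1 < r2" and "r2 < p"
    and "\<And>t x. t \<in> J \<Longrightarrow> x \<in> {-\<delta>..\<delta>} \<Longrightarrow> primitive f t x \<ge> \<eta> * \<bar>x\<bar> powr r2"
  shows "\<exists>u. weak_solution T a b p \<alpha> f u \<and> (\<exists>t\<in>{0..T}. u t \<noteq> 0)"
proof -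
  interpret kirchhoff T \<alpha> p a b r1 f d
    by unfold_locales (use assms(1-12) in auto)
  obtain x0 where "x0 \<in> J" using \<open>J \<noteq> {}\<close> by blast
  then obtain \<epsilon> where \<epsilon>: "\<epsilon> > 0" "cball x0 \<epsilon> \<subseteq> J" using \<open>open J\<close> open_contains_cball by blast
  \<comment> \<open>A closed ball inside J supplies explicit endpoints lying in [0, T], between
    which the bump is placed.\<close>
  define c where "c = x0 - \<epsilon>"
  define e where "e = x0 + \<epsilon>"
  have ce: "c < e" "{c..e} \<subseteq> J" using \<epsilon> by (auto simp: c_def e_def cball_eq_atLeastAtMost)
  have "c \<in> {c..e}" "e \<in> {c..e}" using ce(1) by auto
  with ce(2) \<open>J \<subseteq> {0..T}\<close> have "c \<in> {0..T}" "e \<in> {0..T}" by blast+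
  then have bounds: "0 \<le> c" "e \<le> T" by auto
  have F: "primitive f t x \<ge> \<eta> * \<bar>x\<bar> powr r2" if "t \<in> {c<..<e}" "x \<in> {-\<delta>..\<delta>}" for t x
    using that ce(2) by (intro assms(21)) auto
  obtain u0 w0 where neg: "H u0 w0" "continuous_on {0..T} u0" "pair_energy u0 w0 < 0"
    by (rule pair_energy_negative[OF bounds(1) ce(1) bounds(2) assms(17-20) F])
  obtain u w where u: "continuous_on {0..T} u" "H u w"
    and min: "\<And>u' w'. H u' w' \<Longrightarrow> continuous_on {0..T} u' \<Longrightarrow> pair_energy u w \<le> pair_energy u' w'"
    using minimizer_exists by blast
  have "weak_solution T a b p \<alpha> f u"
    using minimizer_critical[OF u min] has_frac_deriv_RL_left(2,3)[OF u(2,1)] by (simp add: weak_solution_def)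
  moreover have "\<exists>t\<in>{0..T}. u t \<noteq> 0"
  proof (rule ccontr)
    assume "\<not> ?thesis"
    \<comment> \<open>If u vanished on [0, T], its potential would be 0 and its energy nonnegative,
      whatever w is, against the negative value already found.\<close>
    then have "potential u = (LINT t|lebesgue_on {0..T}. 0)"
      unfolding potential_def by (intro Bochner_Integration.integral_cong refl) (auto simp: primitive_deriv(2))
    then have "pair_energy u w \<ge> 0" using \<psi>_mono[of 0 "N w"] by (simp add: pair_energy_def)
    then show False using min[OF neg(1,2)] neg(3) by linarith
  qed
  ultimately show ?thesis by blast
qed

end
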